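(* Let $n\in\{2,3\}$, let $\Omega\subset\mathbb{R}^n$ and $\Gamma=\partial\Omega$ be as in the context, and let $\mathcal{T}_h$ be a quasi uniform, shape regular mesh on $\Gamma$ of mesh size $h$, with set of nodes $\mathcal{N}$ and node patches $\tau_{\mathbf{y}}$, $\mathbf{y}\in\mathcal{N}$. Let $\Phi^\star=\{\varphi^*_{\mathbf{y}} : \mathbf{y}\in\mathcal{N}\}\subset L^2(\Gamma)$ be a set of functions, not necessarily linearly independent, such that for all $\mathbf{y}\in\mathcal{N}$ $$\int_\Gamma \varphi^*_{\mathbf{y}}(s)\,ds=1,\qquad \operatorname{supp}\varphi^*_{\mathbf{y}}\subseteq\tau_{\mathbf{y}},\qquad c_0\,h^{1/2-n/2}\le\|\varphi^*_{\mathbf{y}}\|_{0,\tau_{\mathbf{y}}}\le C_0\,h^{1/2-n/2},$$ with positive constants $c_0,C_0$ independent of $\mathbf{y}$ and $h$. Then there exist positive constants $c,C$, independent of $h$ (depending only on $\Gamma$, on the shape regularity and quasi uniformity constants of the mesh, and on $c_0,C_0$), such that every $w\in H^{1/2}(\Gamma)$ satisfying $$\int_\Gamma w\,\varphi^*_{\mathbf{y}}\,ds=0\quad\text{for all }\mathbf{y}\in\mathcal{N}$$ satisfies $$c\,\sum_{\mathbf{y}\in\mathcal{N}}|w|^2_{1/2,\tau_{\mathbf{y}}}\le\|w\|^2_{1/2,\Gamma}\le C\sum_{\mathbf{y}\in\mathcal{N}}|w|^2_{1/2,\tau_{\mathbf{y}}}.$$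
   Context: Domain. $\Omega\subset\mathbb{R}^n$ ($n=2,3$) is a bounded, simply connected, possibly curvilinear polygon ($n=2$) or polyhedron ($n=3$) with Lipschitz boundary $\Gamma=\partial\Omega$, such that the geodesic distance on $\Gamma$ is bounded from above by a constant times the Euclidean distance in $\mathbb{R}^n$. Mesh. $\mathcal{T}_h$ is a decomposition, in the usual finite element sense, of $\Gamma$ into (possibly curvilinear) segments ($n=2$) or triangles ($n=3$), of mesh size $h$. It is quasi uniform (the diameters of all elements are comparable to $h$) and shape regular (the ratio of the diameter of an element to that of its largest inscribed ball is bounded), with constants fixed independently of $h$. $\mathcal{N}$ is the set of nodes (vertices) of $\mathcal{T}_h$, and for $\mathbf{y}\in\mathcal{N}$ the patch of elements sharing $\mathbf{y}$ as a vertex is $\tau_{\mathbf{y}}=\bigcup_{T\in\mathcal{T}_h:\ \mathbf{y}\in\partial T}T$. Norms. For $\tau\subseteq\Gamma$, $\|\cdot\|_{0,\tau}$ is the $L^2(\tau)$ norm (with respect to the surface/arclength measure on $\Gamma$), and $$|v|^2_{1/2,\tau}=\int_\tau dt\int_\tau ds\,\frac{|v(t)-v(s)|^2}{|t-s|^n},\qquad \|v\|^2_{1/2,\tau}=\|v\|^2_{0,\tau}+|v|^2_{1/2,\tau}.$$ $H^{1/2}(\tau)$ is the space of $v\in L^2(\tau)$ with $\|v\|_{1/2,\tau}<\infty$.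
   Formalization: Curvilinear elements are regular C¹ images of straight simplices with a uniform bi-Lipschitz constant L, on which c and C may also depend (L=1 for straight elements); with only the diameter/inscribed-ball ratio bounded, curved triangles with thin necks violate the upper estimate. *)

theory Defs
  imports "HOL-Analysis.Analysis"
begin

section \<open>Hausdorff measure and surface measure\<close>

definition hausdorff_pre :: "nat \<Rightarrow> real \<Rightarrow> 'a::metric_space set \<Rightarrow> ennreal" where
  "hausdorff_pre k \<delta> A =
     (INF U \<in> {U :: nat \<Rightarrow> 'a set. A \<subseteq> (\<Union>i. U i) \<and> (\<forall>i. bounded (U i) \<and> diameter (U i) \<le> \<delta>)}.
        \<Sum>i. ennreal (unit_ball_vol (real k) * (diameter (U i) / 2) ^ k))"

definition hausdorff :: "nat \<Rightarrow> 'a::metric_space set \<Rightarrow> ennreal" where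
  "hausdorff k A = (SUP \<delta>\<in>{0<..}. hausdorff_pre k \<delta> A)"

text \<open>
  The measure \<open>ds\<close> on a hypersurface of dimension \<open>n - 1\<close> in \<open>n\<close>-space. The outer measure
  \<open>hausdorff k\<close> is metric, hence countably additive on the Borel sets (Caratheodory), so that
  \<open>measure_of\<close> returns the actual Hausdorff measure here and not the zero measure.
\<close>
definition surface_measure :: "(real^'n) set \<Rightarrow> (real^'n::finite) measure" where
  "surface_measure \<Gamma> =
     restrict_space (measure_of UNIV (sets borel) (hausdorff (CARD('n) - 1))) \<Gamma>"

section \<open>Geodesic distance\<close>

definition path_length :: "(real \<Rightarrow> 'a::metric_space) \<Rightarrow> ennreal" where
  "path_length g =
     (SUP (m, u) \<in> {(m :: nat, u :: nat \<Rightarrow> real). mono u \<and> range u \<subseteq> {0..1}}.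
        \<Sum>i<m. ennreal (dist (g (u i)) (g (u (Suc i)))))"

definition geodesic_dist :: "'a::metric_space set \<Rightarrow> 'a \<Rightarrow> 'a \<Rightarrow> ennreal" where
  "geodesic_dist S x y =
     (INF g \<in> {g. path g \<and> path_image g \<subseteq> S \<and> pathstart g = x \<and> pathfinish g = y}. path_length g)"

definition geodesic_ball :: "'a::metric_space set \<Rightarrow> 'a \<Rightarrow> real \<Rightarrow> 'a set" where
  "geodesic_ball S x r = {y \<in> S. geodesic_dist S x y < ennreal r}"

section \<open>Curvilinear segments and triangles\<close>

text \<open>
  A curvilinear simplex is represented by a pair \<open>(V, F)\<close>: the finite set \<open>V\<close> of corners of a
  straight reference simplex of dimension \<open>n - 1\<close>, lying in some hyperplane of \<open>n\<close>-space (a segment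
  for \<open>n = 2\<close>, a triangle for \<open>n = 3\<close>), and a parametrisation \<open>F\<close>. The reference simplex has no
  prescribed size or position, so that for a straight simplex one can take \<open>F = id\<close>.
\<close>
type_synonym 'n simp = "(real^'n) set \<times> (real^'n \<Rightarrow> real^'n)"

definition C1_on :: "'a::real_normed_vector set \<Rightarrow> ('a \<Rightarrow> 'b::real_normed_vector) \<Rightarrow> bool" where
  "C1_on U f \<longleftrightarrow>
     (\<exists>f' :: 'a \<Rightarrow> 'a \<Rightarrow>\<^sub>L 'b.
        (\<forall>x\<in>U. (f has_derivative blinfun_apply (f' x)) (at x)) \<and> continuous_on U f')"

definition pts :: "('n::finite) simp \<Rightarrow> (real^'n) set" where
  "pts T = snd T ` (convex hull (fst T))"

definition corners :: "('n::finite) simp \<Rightarrow> (real^'n) set" where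
  "corners T = snd T ` fst T"

definition bdry :: "('n::finite) simp \<Rightarrow> (real^'n) set" where
  "bdry T = snd T ` rel_frontier (convex hull (fst T))"

text \<open>
  The number \<open>L\<close> bounds the distortion of the parametrisation (\<open>L = 1\<close> is possible for straight
  simplices). On a compact simplex such an \<open>L\<close> exists for every injective \<open>C\<^sup>1\<close> immersion, so
  that \<open>\<exists>L. curvilinear_simplex L T\<close> only says that \<open>T\<close> is regularly parametrised.
\<close>
definition curvilinear_simplex :: "real \<Rightarrow> ('n::finite) simp \<Rightarrow> bool" where
  "curvilinear_simplex L T \<longleftrightarrow>
     (case T of (V, F) \<Rightarrow>
        \<not> affine_dependent V \<and> card V = CARD('n) \<and>
        (\<exists>U. open U \<and> convex hull V \<subseteq> U \<and> C1_on U F) \<and>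
        (\<forall>x \<in> convex hull V. \<forall>y \<in> convex hull V.
           dist (F x) (F y) \<le> L * dist x y \<and> dist x y \<le> L * dist (F x) (F y)))"

section \<open>Domains\<close>

definition lipschitz_boundary :: "(real^'n::finite) set \<Rightarrow> bool" where
  "lipschitz_boundary \<Omega> \<longleftrightarrow>
     (\<forall>p \<in> frontier \<Omega>. \<exists>r>0. \<exists>e. norm e = 1 \<and>
        (\<exists>L g. L-lipschitz_on {x. x \<bullet> e = 0} g \<and>
           \<Omega> \<inter> ball p r = {x \<in> ball p r. g (x - (x \<bullet> e) *\<^sub>R e) < x \<bullet> e}))"

text \<open>
  Possibly curvilinear polygons (\<open>n = 2\<close>) and polyhedra (\<open>n = 3\<close>): the boundary consists of
  finitely many curvilinear segments or triangles that overlap at most along their boundaries.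
  For \<open>n = 3\<close> the polygonal faces of a polyhedron are thought of as cut into triangles; the pieces
  need not meet along full edges.
\<close>
definition curvilinear_polytope :: "(real^'n::finite) set \<Rightarrow> bool" where
  "curvilinear_polytope \<Omega> \<longleftrightarrow>
     (\<exists>\<F> :: 'n simp set. finite \<F> \<and> (\<forall>T\<in>\<F>. \<exists>L. curvilinear_simplex L T) \<and>
        frontier \<Omega> = (\<Union>T\<in>\<F>. pts T) \<and>
        (\<forall>T\<in>\<F>. \<forall>T'\<in>\<F>. T \<noteq> T' \<longrightarrow> pts T \<inter> pts T' \<subseteq> bdry T \<inter> bdry T'))"

definition admissible_domain :: "(real^'n::finite) set \<Rightarrow> bool" where
  "admissible_domain \<Omega> \<longleftrightarrow>
     open \<Omega> \<and> \<Omega> \<noteq> {} \<and> bounded \<Omega> \<and> simply_connected \<Omega> \<and>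
     curvilinear_polytope \<Omega> \<and> lipschitz_boundary \<Omega> \<and>
     (\<exists>C. \<forall>x \<in> frontier \<Omega>. \<forall>y \<in> frontier \<Omega>.
        geodesic_dist (frontier \<Omega>) x y \<le> ennreal (C * dist x y))"

section \<open>Meshes\<close>

text \<open>
  Conforming decompositions: two different elements meet in a common proper face (given by a set
  of corners of each of them), the empty face included.
\<close>
definition is_mesh :: "real \<Rightarrow> (real^'n) set \<Rightarrow> ('n::finite) simp set \<Rightarrow> bool" where
  "is_mesh L \<Gamma> \<T> \<longleftrightarrow>
     finite \<T> \<and> (\<forall>T\<in>\<T>. curvilinear_simplex L T) \<and> (\<Union>T\<in>\<T>. pts T) = \<Gamma> \<and>
     (\<forall>T\<in>\<T>. \<forall>T'\<in>\<T>. T \<noteq> T' \<longrightarrow>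
        (\<exists>A A'. A \<subset> fst T \<and> A' \<subset> fst T' \<and>
           snd T ` A = snd T' ` A' \<and>
           pts T \<inter> pts T' = snd T ` (convex hull A) \<and>
           pts T \<inter> pts T' = snd T' ` (convex hull A')))"

definition quasi_uniform :: "real \<Rightarrow> real \<Rightarrow> ('n::finite) simp set \<Rightarrow> bool" where
  "quasi_uniform q h \<T> \<longleftrightarrow>
     (\<forall>T\<in>\<T>. diameter (pts T) \<le> q * h \<and> h \<le> q * diameter (pts T))"

text \<open>
  The balls inscribed in an element are those of the geodesic distance of the surface; for a
  straight triangle the largest one is the inscribed disc.
\<close>
definition shape_regular :: "real \<Rightarrow> (real^'n) set \<Rightarrow> ('n::finite) simp set \<Rightarrow> bool" where
  "shape_regular \<kappa> \<Gamma> \<T> \<longleftrightarrow>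
     (\<forall>T\<in>\<T>. \<exists>x \<in> pts T. \<exists>r>0. geodesic_ball \<Gamma> x r \<subseteq> pts T \<and> diameter (pts T) \<le> \<kappa> * (2 * r))"

definition nodes :: "('n::finite) simp set \<Rightarrow> (real^'n) set" where
  "nodes \<T> = (\<Union>T\<in>\<T>. corners T)"

definition patch :: "('n::finite) simp set \<Rightarrow> real^'n \<Rightarrow> (real^'n) set" where
  "patch \<T> y = (\<Union>T \<in> {T \<in> \<T>. y \<in> bdry T}. pts T)"

section \<open>Function spaces\<close>

text \<open>
  Elements of the spaces are represented by Borel functions. Squares of norms take values in
  \<open>[0, \<infinity>]\<close>. The integrand of the seminorm is \<open>0\<close> on the diagonal, a null set.
\<close>

definition L2_norm_sq :: "(real^'n) set \<Rightarrow> (real^'n) set \<Rightarrow> (real^'n::finite \<Rightarrow> real) \<Rightarrow> ennreal" where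
  "L2_norm_sq \<Gamma> \<tau> v = (\<integral>\<^sup>+ s \<in> \<tau>. ennreal (\<bar>v s\<bar>\<^sup>2) \<partial>surface_measure \<Gamma>)"

text \<open>Only meaningful when \<open>L2_norm_sq \<Gamma> \<tau> v < \<infinity>\<close>.\<close>
definition L2_norm :: "(real^'n) set \<Rightarrow> (real^'n) set \<Rightarrow> (real^'n::finite \<Rightarrow> real) \<Rightarrow> real" where
  "L2_norm \<Gamma> \<tau> v = sqrt (enn2real (L2_norm_sq \<Gamma> \<tau> v))"

definition L2_space :: "(real^'n::finite) set \<Rightarrow> (real^'n \<Rightarrow> real) set" where
  "L2_space \<Gamma> = {v \<in> borel_measurable (surface_measure \<Gamma>). L2_norm_sq \<Gamma> \<Gamma> v < \<infinity>}"

definition Hhalf_seminorm_sq ::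
    "(real^'n) set \<Rightarrow> (real^'n) set \<Rightarrow> (real^'n::finite \<Rightarrow> real) \<Rightarrow> ennreal" where
  "Hhalf_seminorm_sq \<Gamma> \<tau> v =
     (\<integral>\<^sup>+ t \<in> \<tau>. (\<integral>\<^sup>+ s \<in> \<tau>. ennreal (\<bar>v t - v s\<bar>\<^sup>2 / norm (t - s) ^ CARD('n))
        \<partial>surface_measure \<Gamma>) \<partial>surface_measure \<Gamma>)"

definition Hhalf_norm_sq ::
    "(real^'n) set \<Rightarrow> (real^'n) set \<Rightarrow> (real^'n::finite \<Rightarrow> real) \<Rightarrow> ennreal" where
  "Hhalf_norm_sq \<Gamma> \<tau> v = L2_norm_sq \<Gamma> \<tau> v + Hhalf_seminorm_sq \<Gamma> \<tau> v"

definition Hhalf_space :: "(real^'n::finite) set \<Rightarrow> (real^'n \<Rightarrow> real) set" where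
  "Hhalf_space \<Gamma> = {v \<in> L2_space \<Gamma>. Hhalf_norm_sq \<Gamma> \<Gamma> v < \<infinity>}"

text \<open>The support of a class of functions modulo null sets.\<close>
definition ess_supp :: "(real^'n) set \<Rightarrow> (real^'n::finite \<Rightarrow> real) \<Rightarrow> (real^'n) set" where
  "ess_supp \<Gamma> f =
     {x \<in> \<Gamma>. \<forall>U. open U \<and> x \<in> U \<longrightarrow> \<not> (AE s in surface_measure \<Gamma>. s \<in> U \<longrightarrow> f s = 0)}"

end

theory Submission
  imports Defs
begin

text \<open>
  Since \<open>w\<close> is orthogonal to \<open>\<phi> y\<close>, whose integral is \<open>1\<close>, one has
  \<open>w t = \<integral> (w t - w s) * \<phi> y s ds\<close> on the patch of \<open>y\<close>. Cauchy-Schwarz and the diameter \<open>2 * q * h\<close> of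
  the patch turn this into a bound of the squared \<open>L\<^sup>2\<close> norm on the patch by \<open>C * h\<close> times the squared
  seminorm there. In the double integral over the surface, pairs of points in a common patch are
  covered by the sum of the seminorms; all other pairs have distance at least \<open>sep * h\<close>, so that they
  contribute at most \<open>C / h\<close> times the squared \<open>L\<^sup>2\<close> norm, because a ball of radius \<open>r\<close> has surface measure
  at most \<open>K * r ^ (n - 1)\<close>. The factors \<open>h\<close> and \<open>1 / h\<close> cancel.

  The geometric point is the separation of disjoint elements: nearby points are joined by a short
  curve in the surface, and the curve cannot leave the star of a vertex, or cross from one element
  around an edge to a disjoint one, without covering a distance comparable to \<open>h\<close>.
  The lower bound holds because almost every point lies in exactly one element.
\<close>

section \<open>Upper bounds for Hausdorff measures\<close>

text \<open>The obstacle is the freedom in the elements: \<open>L\<close> bounds the distortion of a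
  parametrisation, but the reference simplex has no prescribed size or shape, while shape regularity
  speaks of geodesic balls of \<Gamma>. Separation needs lower bounds of order \<open>h\<close> for
  the heights of the reference simplices. They come from a fixed decomposition of \<Gamma>: one of
  its pieces, shrunk by a factor of order \<open>h\<close>, fits into the inscribed ball, so a thin
  reference simplex would have to contain a bi-Lipschitz image of a fat one. Heights give two length
  scales: \<open>c1 * h\<close>, at which a node sees only the elements around it, and the smaller
  \<open>c2 * h\<close> for points of an edge. Nodes are treated apart because near an end of an
  edge the distance to the other faces through that end degenerates. The measure bounds come from
  grids of barycentric coordinates: a simplex with \<open>m\<close> corners has \<open>m - 1\<close>
  free coordinates, which yields both the growth \<open>r ^ (n - 1)\<close> and the vanishing of
  common faces.\<close>

lemma hausdorff_pre_le_card:
  fixes A :: "'a::metric_space set" and I :: "'i set"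
  assumes fin: "finite I" and cov: "A \<subseteq> (\<Union>i\<in>I. U i)"
    and bd: "\<And>i. i \<in> I \<Longrightarrow> bounded (U i)" and dm: "\<And>i. i \<in> I \<Longrightarrow> diameter (U i) \<le> \<rho>"
    and \<rho>: "0 \<le> \<rho>" "\<rho> \<le> \<delta>" and k: "0 < k"
  shows "hausdorff_pre k \<delta> A \<le> ennreal (real (card I) * (unit_ball_vol (real k) * (\<rho> / 2) ^ k))"
proof -
  obtain f where f: "bij_betw f {0..<card I} I"
    using ex_bij_betw_nat_finite[OF fin] by blast
  define W where "W i = (if i < card I then U (f i) else {})" for i
  have fI: "f i \<in> I" if "i < card I" for i
    using f that by (auto simp: bij_betw_def)
  have "A \<subseteq> (\<Union>i. W i)"
  proof
    fix x assume "x \<in> A"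
    then obtain j where j: "j \<in> I" "x \<in> U j" using cov by blast
    then obtain i where "i < card I" "f i = j"
      using f by (metis atLeastLessThan_iff bij_betw_iff_bijections)
    then show "x \<in> (\<Union>i. W i)" using j by (auto simp: W_def)
  qed
  moreover have "\<forall>i. bounded (W i) \<and> diameter (W i) \<le> \<delta>"
    using fI bd dm \<rho> by (auto simp: W_def intro: order_trans)
  ultimately have "hausdorff_pre k \<delta> A \<le> (\<Sum>i. ennreal (unit_ball_vol (real k) * (diameter (W i) / 2) ^ k))"
    unfolding hausdorff_pre_def by (intro INF_lower) auto
  \<comment> \<open>The empty sets used as padding contribute \<open>0 ^ k\<close>, which is
    \<open>0\<close> because \<open>k\<close> is positive.\<close>
  also have "\<dots> = (\<Sum>i<card I. ennreal (unit_ball_vol (real k) * (diameter (W i) / 2) ^ k))"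
    by (rule suminf_finite) (use k in \<open>auto simp: W_def\<close>)
  also have "\<dots> \<le> (\<Sum>i<card I. ennreal (unit_ball_vol (real k) * (\<rho> / 2) ^ k))"
    using fI bd dm \<rho>
    by (intro sum_mono ennreal_leI mult_left_mono power_mono divide_right_mono)
      (auto simp: W_def diameter_ge_0 intro: unit_ball_vol_nonneg)
  also have "\<dots> = ennreal (real (card I) * (unit_ball_vol (real k) * (\<rho> / 2) ^ k))"
    using \<rho> by (subst sum_ennreal) (auto intro!: mult_nonneg_nonneg)
  finally show ?thesis .
qed

lemma hausdorff_leI:
  assumes "\<And>\<delta>. \<delta> > 0 \<Longrightarrow> hausdorff_pre k \<delta> A \<le> B"
  shows "hausdorff k A \<le> B"
  unfolding hausdorff_def by (rule SUP_least) (use assms in auto)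

text \<open>Each coordinate interval is cut into \<open>N\<close> equal parts; points in one cell
  have images at distance at most \<open>D * R / N\<close>. The number of coordinates
  \<open>card J\<close> is kept apart from the dimension \<open>k\<close>: equality gives a volume
  bound, a deficit gives a null set.\<close>

lemma hausdorff_pre_grid:
  fixes F :: "'b \<Rightarrow> 'a::metric_space" and u :: "'b \<Rightarrow> 'j \<Rightarrow> real"
  assumes J: "finite J" and R: "R > 0" and D: "D \<ge> 0" and N: "N > 0" and k: "k > 0"
    and u: "\<And>x j. x \<in> S \<Longrightarrow> j \<in> J \<Longrightarrow> a j \<le> u x j \<and> u x j \<le> a j + R"
    and F: "\<And>x y \<epsilon>. x \<in> S \<Longrightarrow> y \<in> S \<Longrightarrow> \<epsilon> \<ge> 0 \<Longrightarrow> (\<And>j. j \<in> J \<Longrightarrow> \<bar>u x j - u y j\<bar> \<le> \<epsilon>) \<Longrightarrow>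
              dist (F x) (F y) \<le> D * \<epsilon>"
    and \<delta>: "D * R / real N \<le> \<delta>"
  shows "hausdorff_pre k \<delta> (F ` S)
    \<le> ennreal (real ((N + 1) ^ card J) * (unit_ball_vol (real k) * (D * R / real N / 2) ^ k))"
proof -
  \<comment> \<open>The right end point of an interval falls into a cell of its own with index
    \<open>N\<close>, hence \<open>N + 1\<close> cells per coordinate.\<close>
  define I where "I = PiE J (\<lambda>_. {0..N})"
  define cell where "cell x j = nat \<lfloor>real N * (u x j - a j) / R\<rfloor>" for x j
  define U where "U f = F ` {x \<in> S. \<forall>j\<in>J. cell x j = f j}" for f
  have rng: "0 \<le> real N * (u x j - a j) / R" "real N * (u x j - a j) / R \<le> real N"
    if "x \<in> S" "j \<in> J" for x j
  proof -
    show "0 \<le> real N * (u x j - a j) / R" using u[OF that] R by simp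
    have "real N * (u x j - a j) \<le> real N * R"
      using u[OF that] by (intro mult_left_mono) auto
    then show "real N * (u x j - a j) / R \<le> real N" using R by (simp add: divide_simps)
  qed
  have finI: "finite I" unfolding I_def by (intro finite_PiE J) auto
  have cardI: "card I = (N + 1) ^ card J" unfolding I_def by (simp add: card_PiE J)
  have cov: "F ` S \<subseteq> (\<Union>f\<in>I. U f)"
  proof
    fix y assume "y \<in> F ` S"
    then obtain x where x: "x \<in> S" "y = F x" by blast
    have "restrict (cell x) J \<in> I"
      unfolding I_def
    proof (intro restrict_PiE_iff[THEN iffD2] ballI)
      fix j assume "j \<in> J"
      then have "\<lfloor>real N * (u x j - a j) / R\<rfloor> \<le> int N"
        using rng(2)[OF x(1)] by (metis floor_mono floor_of_nat)
      then show "cell x j \<in> {0..N}" by (simp add: cell_def)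
    qed
    moreover have "y \<in> U (restrict (cell x) J)" using x by (auto simp: U_def)
    ultimately show "y \<in> (\<Union>f\<in>I. U f)" by blast
  qed
  have close: "dist p p' \<le> D * R / real N" if "p \<in> U f" "p' \<in> U f" for f p p'
  proof -
    from that obtain x x' where x: "x \<in> S" "x' \<in> S" "p = F x" "p' = F x'"
      and c: "\<And>j. j \<in> J \<Longrightarrow> cell x j = cell x' j"
      by (auto simp: U_def)
    have "\<bar>u x j - u x' j\<bar> \<le> R / real N" if j: "j \<in> J" for j
    proof -
      have "\<lfloor>real N * (u x j - a j) / R\<rfloor> = \<lfloor>real N * (u x' j - a j) / R\<rfloor>"
        using c[OF j] rng(1)[OF x(1) j] rng(1)[OF x(2) j] unfolding cell_def
        by (metis eq_nat_nat_iff zero_le_floor)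
      then have "\<bar>real N * (u x j - a j) / R - real N * (u x' j - a j) / R\<bar> \<le> 1"
        by linarith
      moreover have "real N * (u x j - a j) / R - real N * (u x' j - a j) / R = real N / R * (u x j - u x' j)"
        by (simp add: diff_divide_distrib right_diff_distrib)
      ultimately have "\<bar>real N / R * (u x j - u x' j)\<bar> \<le> 1"
        by metis
      then have "real N / R * \<bar>u x j - u x' j\<bar> \<le> 1"
        using R by (simp add: abs_mult)
      then show ?thesis using R N by (simp add: field_simps)
    qed
    then have "dist (F x) (F x') \<le> D * (R / real N)"
      using R N x by (intro F) auto
    then show ?thesis using x by simp
  qed
  have "bounded (U f)" for f
    using close unfolding bounded_two_points by blast
  moreover have "diameter (U f) \<le> D * R / real N" for f
    unfolding diameter_def using close D R by (auto intro!: cSUP_least)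
  ultimately show ?thesis
    using hausdorff_pre_le_card[OF finI cov, of "D * R / real N" \<delta> k] cardI D R \<delta> k by auto
qed

text \<open>There are \<open>(N + 1) ^ k\<close> cells, and the half in the radius absorbs the
  surplus because \<open>(N + 1) / (2 * N) \<le> 1\<close>. So the bound is uniform in
  \<open>N\<close>, which only serves to bring the diameters below \<open>\<delta>\<close>.\<close>

lemma hausdorff_grid_bound:
  fixes F :: "'b \<Rightarrow> 'a::metric_space" and u :: "'b \<Rightarrow> 'j \<Rightarrow> real"
  assumes J: "finite J" "card J = k" and R: "R > 0" and D: "D \<ge> 0" and k: "k > 0"
    and u: "\<And>x j. x \<in> S \<Longrightarrow> j \<in> J \<Longrightarrow> a j \<le> u x j \<and> u x j \<le> a j + R"
    and F: "\<And>x y \<epsilon>. x \<in> S \<Longrightarrow> y \<in> S \<Longrightarrow> \<epsilon> \<ge> 0 \<Longrightarrow> (\<And>j. j \<in> J \<Longrightarrow> \<bar>u x j - u y j\<bar> \<le> \<epsilon>) \<Longrightarrow>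
              dist (F x) (F y) \<le> D * \<epsilon>"
  shows "hausdorff k (F ` S) \<le> ennreal (unit_ball_vol (real k) * (D * R) ^ k)"
proof (rule hausdorff_leI)
  fix \<delta> :: real assume "\<delta> > 0"
  then obtain N :: nat where N: "D * R / \<delta> < real N"
    using reals_Archimedean2 by blast
  have "0 \<le> D * R / \<delta>" using D R \<open>\<delta> > 0\<close> by simp
  with N have Npos: "N > 0" by (cases N) auto
  have le: "D * R / real N \<le> \<delta>"
    using N Npos \<open>\<delta> > 0\<close> by (simp add: field_simps)
  have "hausdorff_pre k \<delta> (F ` S) \<le>
      ennreal (real ((N + 1) ^ card J) * (unit_ball_vol (real k) * (D * R / real N / 2) ^ k))"
    by (rule hausdorff_pre_grid[OF J(1) R D Npos k u F le])
  also have "\<dots> \<le> ennreal (unit_ball_vol (real k) * (D * R) ^ k)"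
  proof (rule ennreal_leI)
    have "real ((N + 1) ^ card J) * (D * R / real N / 2) ^ k
        = ((real N + 1) * (D * R / real N / 2)) ^ k"
      by (simp add: J(2) add.commute flip: power_mult_distrib)
    also have "(real N + 1) * (D * R / real N / 2) = (D * R) * ((real N + 1) / (2 * real N))"
      by (simp add: mult_ac)
    also have "\<dots> ^ k \<le> (D * R) ^ k"
    proof (rule power_mono)
      have "(real N + 1) / (2 * real N) \<le> 1" using Npos by simp
      then show "D * R * ((real N + 1) / (2 * real N)) \<le> D * R"
        using D R by (intro mult_left_le) auto
      show "0 \<le> D * R * ((real N + 1) / (2 * real N))" using D R by simp
    qed
    finally have *: "real ((N + 1) ^ card J) * (D * R / real N / 2) ^ k \<le> (D * R) ^ k" .
    show "real ((N + 1) ^ card J) * (unit_ball_vol (real k) * (D * R / real N / 2) ^ k)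
        \<le> unit_ball_vol (real k) * (D * R) ^ k"
      using mult_left_mono[OF *, of "unit_ball_vol (real k)"] by (simp add: mult_ac)
  qed
  finally show "hausdorff_pre k \<delta> (F ` S) \<le> ennreal (unit_ball_vol (real k) * (D * R) ^ k)" .
qed

text \<open>With at most \<open>k - 1\<close> coordinates the number of cells grows at most like
  \<open>N ^ (k - 1)\<close>, while each contributes a multiple of \<open>1 / N ^ k\<close>; the
  total is of order \<open>1 / N\<close>.\<close>

lemma hausdorff_grid_null:
  fixes F :: "'b \<Rightarrow> 'a::metric_space" and u :: "'b \<Rightarrow> 'j \<Rightarrow> real"
  assumes J: "finite J" "card J < k" and R: "R > 0" and D: "D \<ge> 0"
    and u: "\<And>x j. x \<in> S \<Longrightarrow> j \<in> J \<Longrightarrow> a j \<le> u x j \<and> u x j \<le> a j + R"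
    and F: "\<And>x y \<epsilon>. x \<in> S \<Longrightarrow> y \<in> S \<Longrightarrow> \<epsilon> \<ge> 0 \<Longrightarrow> (\<And>j. j \<in> J \<Longrightarrow> \<bar>u x j - u y j\<bar> \<le> \<epsilon>) \<Longrightarrow>
              dist (F x) (F y) \<le> D * \<epsilon>"
  shows "hausdorff k (F ` S) = 0"
proof -
  have k: "k > 0" using J by simp
  have "hausdorff_pre k \<delta> (F ` S) \<le> ennreal e" if "\<delta> > 0" "e > 0" for \<delta> e
  proof -
    define c where "c = unit_ball_vol (real k) * (D * R) ^ k"
    have c0: "c \<ge> 0" using D R by (simp add: c_def)
    define A B where "A = D * R / \<delta>" and "B = c / e"
    have p: "0 \<le> A" "0 \<le> B" using D R that c0 by (auto simp: A_def B_def)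
    obtain N :: nat where N: "A + B + 1 < real N"
      using reals_Archimedean2 by blast
    have Npos: "N > 0" using N p by (cases N) auto
    have N1: "A < real N" using N p by linarith
    have N2: "B < real N" using N p by linarith
    have le: "D * R / real N \<le> \<delta>" using N1 Npos that by (simp add: A_def field_simps)
    have "hausdorff_pre k \<delta> (F ` S) \<le>
        ennreal (real ((N + 1) ^ card J) * (unit_ball_vol (real k) * (D * R / real N / 2) ^ k))"
      by (rule hausdorff_pre_grid[OF J(1) R D Npos k u F le])
    also have "\<dots> \<le> ennreal e"
    proof (rule ennreal_leI)
      have "real ((N + 1) ^ card J) = (real N + 1) ^ card J"
        by (simp add: add.commute)
      also have "\<dots> \<le> (real N + 1) ^ (k - 1)"
        using J by (intro power_increasing) auto
      also have "\<dots> \<le> (2 * real N) ^ (k - 1)"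
        using Npos by (intro power_mono) auto
      finally have "real ((N + 1) ^ card J) \<le> (2 * real N) ^ (k - 1)" .
      then have "real ((N + 1) ^ card J) * (unit_ball_vol (real k) * (D * R / real N / 2) ^ k)
          \<le> (2 * real N) ^ (k - 1) * (unit_ball_vol (real k) * (D * R / real N / 2) ^ k)"
        using D R by (intro mult_right_mono) auto
      also have "D * R / real N / 2 = D * R / (2 * real N)"
        by simp
      also have "(2 * real N) ^ (k - 1) * (unit_ball_vol (real k) * (D * R / (2 * real N)) ^ k)
          = (2 * real N) ^ (k - 1) / (2 * real N) ^ k * c"
        unfolding c_def power_divide by simp
      also have "(2 * real N) ^ k = (2 * real N) ^ (k - 1) * (2 * real N)"
        by (rule power_minus_mult[symmetric, OF k])
      also have "(2 * real N) ^ (k - 1) / ((2 * real N) ^ (k - 1) * (2 * real N)) * c = c / (2 * real N)"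
        using Npos by simp
      also have "\<dots> \<le> e"
      proof -
        have "c < real N * e" using N2 that by (simp add: B_def field_simps)
        moreover have "real N * e \<le> 2 * real N * e" using that by simp
        ultimately show ?thesis using Npos by (simp add: field_simps)
      qed
      finally show "real ((N + 1) ^ card J) * (unit_ball_vol (real k) * (D * R / real N / 2) ^ k) \<le> e"
        by (simp add: mult.commute)
    qed
    finally show ?thesis .
  qed
  then have le: "hausdorff k (F ` S) \<le> ennreal e" if "e > 0" for e
    using that by (intro hausdorff_leI) auto
  have "hausdorff k (F ` S) \<le> 0"
    by (rule ennreal_le_epsilon) (simp add: le)
  then show ?thesis by simp
qed

section \<open>From the Hausdorff outer measure to the surface measure\<close>

lemma sets_measure_of_borel [simp]: "sets (measure_of UNIV (sets borel) \<mu>) = sets borel"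
  using sets.sigma_sets_eq[of borel] by simp

lemma sets_surface_measure:
  "sets (surface_measure \<Gamma>) = sets (restrict_space borel (\<Gamma> :: (real^'n::finite) set))"
  unfolding surface_measure_def by (rule sets_restrict_space_cong) simp

lemma space_surface_measure [simp]: "space (surface_measure \<Gamma>) = \<Gamma>"
  by (simp add: surface_measure_def space_restrict_space)

text \<open>No appeal to Caratheodory is needed: if \<open>hausdorff\<close> were not a measure on the Borel sets,
  \<open>measure_of\<close> would return the zero measure, for which the inequality holds as well.\<close>
lemma emeasure_surface_measure_le:
  fixes \<Gamma> :: "(real^'n::finite) set"
  assumes "\<Gamma> \<in> sets borel" "A \<subseteq> \<Gamma>"
  shows "emeasure (surface_measure \<Gamma>) A \<le> hausdorff (CARD('n) - 1) A"
proof -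
  let ?M = "measure_of UNIV (sets borel) (hausdorff (CARD('n) - 1)) :: (real^'n) measure"
  have "emeasure (surface_measure \<Gamma>) A = emeasure ?M A"
    unfolding surface_measure_def using assms by (intro emeasure_restrict_space) auto
  also have "\<dots> \<le> hausdorff (CARD('n) - 1) A"
    by (subst emeasure_measure_of_conv) auto
  finally show ?thesis .
qed

section \<open>Reference simplices\<close>

lemma finite_uniform_pos:
  fixes P :: "'a \<Rightarrow> real \<Rightarrow> bool"
  assumes "finite A" and "\<And>a. a \<in> A \<Longrightarrow> \<exists>c>0. P a c"
    and mono: "\<And>a c d. P a c \<Longrightarrow> 0 < d \<Longrightarrow> d \<le> c \<Longrightarrow> P a d"
  shows "\<exists>c>0. \<forall>a\<in>A. P a c"
  using assms(1,2)
proof (induction A rule: finite_induct)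
  case empty
  then show ?case by (auto intro: exI[of _ 1])
next
  case (insert x A)
  then obtain c where c: "c > 0" "\<forall>a\<in>A. P a c" by auto
  obtain d where d: "d > 0" "P x d" using insert by auto
  show ?case
    by (rule exI[of _ "min c d"]) (use c d mono[of _ c "min c d"] mono[of _ d "min c d"] in auto)
qed

lemma finite_uniform_bound:
  fixes P :: "'a \<Rightarrow> real \<Rightarrow> bool"
  assumes "finite A" and "\<And>a. a \<in> A \<Longrightarrow> \<exists>c. P a c"
    and mono: "\<And>a c d. P a c \<Longrightarrow> c \<le> d \<Longrightarrow> P a d"
  shows "\<exists>c. \<forall>a\<in>A. P a c"
  using assms(1,2)
proof (induction A rule: finite_induct)
  case empty
  then show ?case by auto
next
  case (insert x A)
  then obtain c where c: "\<forall>a\<in>A. P a c" by auto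
  obtain d where d: "P x d" using insert by auto
  show ?case
    by (rule exI[of _ "max c d"]) (use c d mono[of _ c "max c d"] mono[of _ d "max c d"] in auto)
qed

text \<open>\<open>m\<close> is the altitude of the simplex from \<open>v\<close>: the component of
  \<open>v - w0\<close> orthogonal to the opposite face. Affine independence keeps it from
  vanishing, and the last clause places its foot \<open>v - m\<close> in the affine hull of that
  face.\<close>

lemma height_vector:
  fixes V :: "'a::euclidean_space set"
  assumes V: "\<not> affine_dependent V" and v: "v \<in> V" and w0: "w0 \<in> V" "w0 \<noteq> v"
  shows "\<exists>m. m \<noteq> 0 \<and> (\<forall>w\<in>V - {v}. m \<bullet> (w - w0) = 0) \<and> m \<bullet> (v - w0) = m \<bullet> m \<and>
    v - m - w0 \<in> span ((\<lambda>w. w - w0) ` (V - {v}))"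
proof -
  let ?B = "(\<lambda>w. w - w0) ` (V - {v})"
  obtain y z where yz: "y \<in> span ?B" "\<And>w. w \<in> span ?B \<Longrightarrow> orthogonal z w" "v - w0 = y + z"
    using orthogonal_subspace_decomp_exists[of ?B "v - w0"] by metis
  have nz: "z \<noteq> 0"
  proof
    assume "z = 0"
    have w0': "w0 \<in> V - {v}" using w0 by auto
    have "span ?B = span ((\<lambda>x. - w0 + x) ` (V - {v} - {w0}))"
    proof -
      have "?B = insert 0 ((\<lambda>x. - w0 + x) ` (V - {v} - {w0}))"
        using w0' by force
      then show ?thesis by simp
    qed
    moreover have "v = w0 + (v - w0)" by simp
    ultimately have "v \<in> affine hull (V - {v})"
      using yz \<open>z = 0\<close> affine_hull_span2[OF w0'] by (metis add.right_neutral image_eqI)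
    then show False using V v by (auto simp: affine_dependent_def)
  qed
  have perp: "z \<bullet> (w - w0) = 0" if "w \<in> V - {v}" for w
    using yz(2)[of "w - w0"] that by (auto simp: orthogonal_def intro: span_base)
  have zv: "z \<bullet> (v - w0) = z \<bullet> z"
    using yz(2)[OF yz(1)] yz(3) by (simp add: orthogonal_def inner_add_right)
  have sp: "v - z - w0 \<in> span ?B"
  proof -
    have "v - z - w0 = y" using yz(3) by (simp add: algebra_simps)
    then show ?thesis using yz(1) by simp
  qed
  show ?thesis
    by (intro exI[of _ z] conjI ballI nz perp zv sp)
qed

text \<open>Testing against the altitude removes all vertices but \<open>v\<close>, which turns a
  barycentric coordinate into an affine function of the point.\<close>

lemma barycentric_inner:
  fixes V :: "'a::real_inner set"
  assumes "finite V" "v \<in> V" and u: "sum u V = 1" and x: "x = (\<Sum>w\<in>V. u w *\<^sub>R w)"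
    and m: "\<And>w. w \<in> V - {v} \<Longrightarrow> m \<bullet> (w - w0) = 0" "m \<bullet> (v - w0) = m \<bullet> m"
  shows "m \<bullet> (x - w0) = u v * (m \<bullet> m)"
proof -
  have "(\<Sum>w\<in>V. u w *\<^sub>R (w - w0)) = x - w0"
    using u x by (simp add: scaleR_diff_right sum_subtractf flip: scaleR_sum_left)
  then have "m \<bullet> (x - w0) = (\<Sum>w\<in>V. u w * (m \<bullet> (w - w0)))"
    by (metis (no_types, lifting) inner_scaleR_right inner_sum_right sum.cong)
  also have "\<dots> = u v * (m \<bullet> (v - w0)) + (\<Sum>w\<in>V - {v}. u w * (m \<bullet> (w - w0)))"
    using assms by (simp add: sum.remove)
  also have "(\<Sum>w\<in>V - {v}. u w * (m \<bullet> (w - w0))) = 0"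
    using m by (intro sum.neutral) simp
  finally show ?thesis using m by simp
qed

text \<open>\<open>m \<bullet> (x - w0) / (m \<bullet> m)\<close> extends a barycentric coordinate
  affinely to the whole space, with Lipschitz constant \<open>1 / norm m\<close>; the sum over the
  vertices is a common \<open>K\<close>. With at least two vertices every opposite face is
  nonempty.\<close>

lemma barycentric_functions:
  fixes V :: "'a::euclidean_space set"
  assumes fin: "finite V" and V: "\<not> affine_dependent V" and card: "card V \<ge> 2"
  shows "\<exists>(\<beta> :: 'a \<Rightarrow> 'a \<Rightarrow> real) K. K \<ge> 0 \<and>
    (\<forall>x\<in>convex hull V. (\<forall>v\<in>V. 0 \<le> \<beta> v x) \<and> (\<Sum>v\<in>V. \<beta> v x) = 1 \<and> (\<Sum>v\<in>V. \<beta> v x *\<^sub>R v) = x) \<and>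
    (\<forall>v\<in>V. \<forall>x y. \<bar>\<beta> v x - \<beta> v y\<bar> \<le> K * dist x y)"
proof -
  have "\<forall>v\<in>V. \<exists>p. fst p \<noteq> 0 \<and> (\<forall>w\<in>V - {v}. fst p \<bullet> (w - snd p) = 0) \<and>
      fst p \<bullet> (v - snd p) = fst p \<bullet> fst p"
  proof
    fix v assume v: "v \<in> V"
    have "V \<noteq> {v}" using card by auto
    then obtain w0 where w0: "w0 \<in> V" "w0 \<noteq> v" using v by auto
    obtain m where "m \<noteq> 0" "\<forall>w\<in>V - {v}. m \<bullet> (w - w0) = 0" "m \<bullet> (v - w0) = m \<bullet> m"
      using height_vector[OF V v w0] by blast
    then show "\<exists>p. fst p \<noteq> 0 \<and> (\<forall>w\<in>V - {v}. fst p \<bullet> (w - snd p) = 0) \<and>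
        fst p \<bullet> (v - snd p) = fst p \<bullet> fst p"
      by (intro exI[of _ "(m, w0)"]) simp
  qed
  from bchoice[OF this] obtain g where g: "\<forall>v\<in>V. fst (g v) \<noteq> 0 \<and>
      (\<forall>w\<in>V - {v}. fst (g v) \<bullet> (w - snd (g v)) = 0) \<and> fst (g v) \<bullet> (v - snd (g v)) = fst (g v) \<bullet> fst (g v)"
    by blast
  define m where "m v = fst (g v)" for v
  define w0 where "w0 v = snd (g v)" for v
  have m: "\<And>v. v \<in> V \<Longrightarrow> m v \<noteq> 0"
    "\<And>v w. v \<in> V \<Longrightarrow> w \<in> V - {v} \<Longrightarrow> m v \<bullet> (w - w0 v) = 0"
    "\<And>v. v \<in> V \<Longrightarrow> m v \<bullet> (v - w0 v) = m v \<bullet> m v"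
    using g by (simp_all add: m_def w0_def)
  define \<beta> where "\<beta> v x = m v \<bullet> (x - w0 v) / (m v \<bullet> m v)" for v x
  define K where "K = (\<Sum>v\<in>V. 1 / norm (m v))"
  \<comment> \<open>Any coefficients that represent \<open>x\<close> agree with
    \<open>\<beta>\<close>, so its properties on the hull are inherited from a convex
    combination.\<close>
  have \<beta>u: "\<beta> v x = u v" if "v \<in> V" "sum u V = 1" "(\<Sum>w\<in>V. u w *\<^sub>R w) = x" for v x u
    using barycentric_inner[OF fin that(1,2) that(3)[symmetric] m(2)[OF that(1)] m(3)[OF that(1)]]
      m(1)[OF that(1)]
    unfolding \<beta>_def by simp
  have ex: "\<exists>u. (\<forall>v\<in>V. 0 \<le> u v) \<and> sum u V = 1 \<and> (\<Sum>w\<in>V. u w *\<^sub>R w) = x" if "x \<in> convex hull V" for x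
    using that by (auto simp: convex_hull_finite[OF fin])
  show ?thesis
  proof (intro exI[of _ \<beta>] exI[of _ K] conjI ballI allI)
    show "K \<ge> 0" unfolding K_def by (intro sum_nonneg) auto
    show "0 \<le> \<beta> v x" if x: "x \<in> convex hull V" and v: "v \<in> V" for x v
    proof -
      obtain u where u: "\<forall>v\<in>V. 0 \<le> u v" "sum u V = 1" "(\<Sum>w\<in>V. u w *\<^sub>R w) = x"
        using ex[OF x] by blast
      show ?thesis using u(1) v by (simp add: \<beta>u[OF _ u(2,3)])
    qed
    show "(\<Sum>v\<in>V. \<beta> v x) = 1" if x: "x \<in> convex hull V" for x
    proof -
      obtain u where u: "sum u V = 1" "(\<Sum>w\<in>V. u w *\<^sub>R w) = x" using ex[OF x] by blast
      have "(\<Sum>v\<in>V. \<beta> v x) = sum u V"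
        by (rule sum.cong) (auto simp: \<beta>u[OF _ u])
      then show ?thesis using u by simp
    qed
    show "(\<Sum>v\<in>V. \<beta> v x *\<^sub>R v) = x" if x: "x \<in> convex hull V" for x
    proof -
      obtain u where u: "sum u V = 1" "(\<Sum>w\<in>V. u w *\<^sub>R w) = x" using ex[OF x] by blast
      have "(\<Sum>v\<in>V. \<beta> v x *\<^sub>R v) = (\<Sum>w\<in>V. u w *\<^sub>R w)"
        by (rule sum.cong) (auto simp: \<beta>u[OF _ u])
      then show ?thesis using u by simp
    qed
    show "\<bar>\<beta> v x - \<beta> v y\<bar> \<le> K * dist x y" if v: "v \<in> V" for v x y
    proof -
      have "\<beta> v x - \<beta> v y = m v \<bullet> (x - y) / (m v \<bullet> m v)"
        unfolding \<beta>_def by (simp add: inner_diff_right flip: diff_divide_distrib)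
      then have "\<bar>\<beta> v x - \<beta> v y\<bar> = \<bar>m v \<bullet> (x - y)\<bar> / (m v \<bullet> m v)"
        by simp
      also have "\<dots> \<le> norm (m v) * norm (x - y) / (m v \<bullet> m v)"
        by (intro divide_right_mono Cauchy_Schwarz_ineq2) auto
      also have "\<dots> = 1 / norm (m v) * dist x y"
        using m(1)[OF v] by (simp add: dist_norm dot_square_norm power2_eq_square)
      also have "\<dots> \<le> K * dist x y"
        unfolding K_def using v fin
        by (intro mult_right_mono member_le_sum[where f="\<lambda>v. 1 / norm (m v)"]) auto
      finally show ?thesis .
    qed
  qed
qed

text \<open>Both coefficient families sum to \<open>1\<close>, so \<open>x - y\<close> is a
  combination of the vectors \<open>v - v0\<close> and the coefficient of \<open>v0\<close> drops
  out. This leaves \<open>card V - 1\<close> coordinates, the dimension count behind both measure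
  bounds.\<close>

lemma dist_convex_combinations_le:
  fixes V :: "'a::real_normed_vector set"
  assumes fin: "finite V" and v0: "v0 \<in> V" and u: "sum u V = 1" "sum u' V = 1"
    and x: "x = (\<Sum>v\<in>V. u v *\<^sub>R v)" "y = (\<Sum>v\<in>V. u' v *\<^sub>R v)"
    and le: "\<And>v. v \<in> V - {v0} \<Longrightarrow> \<bar>u v - u' v\<bar> \<le> \<epsilon>"
  shows "dist x y \<le> (\<Sum>v\<in>V. norm (v - v0)) * \<epsilon>"
proof -
  have "(\<Sum>v\<in>V. (u v - u' v) *\<^sub>R (v - v0)) = (\<Sum>v\<in>V. u v *\<^sub>R v - u' v *\<^sub>R v - (u v - u' v) *\<^sub>R v0)"
    by (rule sum.cong) (auto simp: algebra_simps)
  also have "\<dots> = x - y - (\<Sum>v\<in>V. u v - u' v) *\<^sub>R v0"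
    by (simp add: x sum_subtractf flip: scaleR_sum_left)
  also have "\<dots> = x - y" by (simp add: sum_subtractf u)
  finally have "dist x y = norm (\<Sum>v\<in>V. (u v - u' v) *\<^sub>R (v - v0))"
    by (simp add: dist_norm)
  also have "\<dots> \<le> (\<Sum>v\<in>V. norm ((u v - u' v) *\<^sub>R (v - v0)))" by (rule norm_sum)
  also have "\<dots> \<le> (\<Sum>v\<in>V. norm (v - v0) * \<epsilon>)"
  proof (rule sum_mono)
    fix v assume v: "v \<in> V"
    show "norm ((u v - u' v) *\<^sub>R (v - v0)) \<le> norm (v - v0) * \<epsilon>"
    proof (cases "v = v0")
      case False
      then show ?thesis
        using le[of v] v by (simp add: mult.commute mult_left_mono)
    qed simp
  qed
  also have "\<dots> = (\<Sum>v\<in>V. norm (v - v0)) * \<epsilon>" by (simp add: sum_distrib_right)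
  finally show ?thesis .
qed

text \<open>At most \<open>k - 1\<close> coefficients are free. Any choice of convex coefficients
  serves as coordinates, because only closeness of coefficients has to imply closeness of
  points.\<close>

lemma hausdorff_lipschitz_simplex_null:
  fixes V :: "'a::euclidean_space set" and F :: "'a \<Rightarrow> 'b::metric_space"
  assumes fin: "finite V" and card: "card V \<le> k" "0 < k" and L: "L \<ge> 0"
    and F: "\<And>x y. x \<in> convex hull V \<Longrightarrow> y \<in> convex hull V \<Longrightarrow> dist (F x) (F y) \<le> L * dist x y"
  shows "hausdorff k (F ` (convex hull V)) = 0"
proof (cases "V = {}")
  case True
  then show ?thesis
    using hausdorff_grid_null[of "{}" k 1 0 "{}" "\<lambda>_. 0" "\<lambda>_ _. 0" F] card by simp
next
  case False
  then obtain v0 where v0: "v0 \<in> V" by auto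
  have "\<forall>x\<in>convex hull V. \<exists>u. (\<forall>v\<in>V. 0 \<le> u v) \<and> sum u V = 1 \<and> (\<Sum>w\<in>V. u w *\<^sub>R w) = x"
    by (auto simp: convex_hull_finite[OF fin])
  then obtain u where u: "\<And>x v. x \<in> convex hull V \<Longrightarrow> v \<in> V \<Longrightarrow> 0 \<le> u x v"
    "\<And>x. x \<in> convex hull V \<Longrightarrow> sum (u x) V = 1"
    "\<And>x. x \<in> convex hull V \<Longrightarrow> (\<Sum>w\<in>V. u x w *\<^sub>R w) = x" by metis
  have u1: "u x v \<le> 1" if "x \<in> convex hull V" "v \<in> V" for x v
    using member_le_sum[OF that(2), of "u x"] u[OF that(1)] fin that by auto
  show ?thesis
  proof (rule hausdorff_grid_null[where J = "V - {v0}" and u = u and a = "\<lambda>_. 0" and R = 1])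
    show "finite (V - {v0})" using fin by simp
    show "card (V - {v0}) < k" using card v0 fin card_gt_0_iff[of V] by (auto simp: card_Diff_singleton)
    show "0 \<le> L * (\<Sum>v\<in>V. norm (v - v0))" using L by (simp add: sum_nonneg)
    fix x y and \<epsilon> :: real
    assume xy: "x \<in> convex hull V" "y \<in> convex hull V" "0 \<le> \<epsilon>"
      and le: "\<And>j. j \<in> V - {v0} \<Longrightarrow> \<bar>u x j - u y j\<bar> \<le> \<epsilon>"
    have "dist x y \<le> (\<Sum>v\<in>V. norm (v - v0)) * \<epsilon>"
      by (rule dist_convex_combinations_le[OF fin v0 u(2) u(2) u(3)[symmetric] u(3)[symmetric] le])
        (use xy in auto)
    then have "L * dist x y \<le> L * (\<Sum>v\<in>V. norm (v - v0)) * \<epsilon>"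
      using L by (simp add: mult_left_mono mult.assoc)
    then show "dist (F x) (F y) \<le> L * (\<Sum>v\<in>V. norm (v - v0)) * \<epsilon>"
      using F[OF xy(1,2)] by linarith
  qed (use u u1 in auto)
qed

text \<open>The lower distortion bound confines the preimage of a ball of radius \<open>r\<close> to
  a set of diameter of order \<open>r\<close>. Its barycentric coordinates then lie in windows of
  length proportional to \<open>r\<close>, to which the grid bound applies.\<close>

lemma hausdorff_bilipschitz_simplex_ball:
  fixes V :: "'a::euclidean_space set" and F :: "'a \<Rightarrow> 'b::metric_space"
  assumes fin: "finite V" and V: "\<not> affine_dependent V" and card: "card V = k + 1" "0 < k"
    and L: "L > 0"
    and F: "\<And>x y. x \<in> convex hull V \<Longrightarrow> y \<in> convex hull V \<Longrightarrow> dist (F x) (F y) \<le> L * dist x y"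
    and F': "\<And>x y. x \<in> convex hull V \<Longrightarrow> y \<in> convex hull V \<Longrightarrow> dist x y \<le> L * dist (F x) (F y)"
  shows "\<exists>K. \<forall>t r. r > 0 \<longrightarrow> hausdorff k (F ` {x \<in> convex hull V. F x \<in> ball t r}) \<le> ennreal (K * r ^ k)"
proof -
  have card2: "card V \<ge> 2" using card by simp
  obtain \<beta> K where K: "K \<ge> 0"
    and \<beta>: "\<And>x v. x \<in> convex hull V \<Longrightarrow> v \<in> V \<Longrightarrow> 0 \<le> \<beta> v x"
    "\<And>x. x \<in> convex hull V \<Longrightarrow> (\<Sum>v\<in>V. \<beta> v x) = 1"
    "\<And>x. x \<in> convex hull V \<Longrightarrow> (\<Sum>v\<in>V. \<beta> v x *\<^sub>R v) = x"
    and lip: "\<And>v x y. v \<in> V \<Longrightarrow> \<bar>\<beta> v x - \<beta> v y\<bar> \<le> K * dist x y"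
    using barycentric_functions[OF fin V card2] by blast
  obtain v0 where v0: "v0 \<in> V" using card by fastforce
  define D where "D = L * (\<Sum>v\<in>V. norm (v - v0))"
  \<comment> \<open>Preimage points lie within \<open>2 * L * r\<close> of \<open>x0\<close>, so
    their coordinates deviate by at most \<open>2 * K * L * r\<close>; the window of length
    \<open>M * r\<close> centred at those of \<open>x0\<close> contains them, and
    \<open>K + 1\<close> keeps \<open>M\<close> positive if \<open>K\<close> is
    \<open>0\<close>.\<close>
  define M where "M = (K + 1) * (4 * L)"
  have M: "M > 0" using K L by (simp add: M_def)
  have D: "D \<ge> 0" using L by (simp add: D_def sum_nonneg)
  have "hausdorff k (F ` {x \<in> convex hull V. F x \<in> ball t r})
      \<le> ennreal (unit_ball_vol (real k) * (D * M) ^ k * r ^ k)" if r: "r > 0" for t r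
  proof (cases "{x \<in> convex hull V. F x \<in> ball t r} = {}")
    case False
    then obtain x0 where x0: "x0 \<in> convex hull V" "dist t (F x0) < r" by auto
    have "hausdorff k (F ` {x \<in> convex hull V. F x \<in> ball t r})
      \<le> ennreal (unit_ball_vol (real k) * (D * (M * r)) ^ k)"
    proof (rule hausdorff_grid_bound[where J = "V - {v0}" and u = "\<lambda>x v. \<beta> v x"
          and a = "\<lambda>v. \<beta> v x0 - M * r / 2"])
      show "finite (V - {v0})" "card (V - {v0}) = k" using fin card v0 by auto
      show "0 < M * r" using M r by simp
      show "D \<ge> 0" by fact
      show "0 < k" by fact
    next
      fix x v assume x: "x \<in> {x \<in> convex hull V. F x \<in> ball t r}" and v: "v \<in> V - {v0}"
      have "dist (F x) (F x0) < 2 * r"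
        using x x0 dist_triangle_less_add[of "F x" t r "F x0" r] by (simp add: dist_commute)
      then have "L * dist (F x) (F x0) \<le> L * (2 * r)" using L by (intro mult_left_mono) auto
      then have "dist x x0 \<le> 2 * L * r" using F'[of x x0] x x0 by auto
      then have "K * dist x x0 \<le> K * (2 * L * r)" using K by (intro mult_left_mono) auto
      moreover have "K * (2 * L * r) \<le> M * r / 2" using L r by (simp add: M_def field_simps)
      ultimately have "\<bar>\<beta> v x - \<beta> v x0\<bar> \<le> M * r / 2"
        using lip[of v x x0] v by auto
      then show "\<beta> v x0 - M * r / 2 \<le> \<beta> v x \<and> \<beta> v x \<le> \<beta> v x0 - M * r / 2 + M * r"
        by linarith
    next
      fix x y and \<epsilon> :: real
      assume xy: "x \<in> {x \<in> convex hull V. F x \<in> ball t r}" "y \<in> {x \<in> convex hull V. F x \<in> ball t r}"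
        and le: "\<And>v. v \<in> V - {v0} \<Longrightarrow> \<bar>\<beta> v x - \<beta> v y\<bar> \<le> \<epsilon>"
      then have xy': "x \<in> convex hull V" "y \<in> convex hull V" by auto
      have "dist x y \<le> (\<Sum>v\<in>V. norm (v - v0)) * \<epsilon>"
        by (rule dist_convex_combinations_le[OF fin v0 \<beta>(2) \<beta>(2) \<beta>(3)[symmetric] \<beta>(3)[symmetric] le])
          (use xy' in auto)
      then have "L * dist x y \<le> D * \<epsilon>"
        using L by (simp add: D_def mult_left_mono mult.assoc)
      then show "dist (F x) (F y) \<le> D * \<epsilon>" using F[OF xy'] by linarith
    qed
    then show ?thesis by (simp add: power_mult_distrib mult.assoc)
  next
    case True
    have "hausdorff k (F ` {}) \<le> 0"
      using hausdorff_grid_null[of "{}" k 1 0 "{}" "\<lambda>_. 0" "\<lambda>_ _. 0" F] card by simp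
    then show ?thesis unfolding True by (metis image_empty le_zero_eq zero_le)
  qed
  then show ?thesis by blast
qed

lemma simplex_height_pos:
  fixes V :: "'a::euclidean_space set"
  assumes fin: "finite V" and V: "\<not> affine_dependent V"
  shows "\<exists>H>0. \<forall>v\<in>V. \<forall>z\<in>convex hull (V - {v}). H \<le> dist v z"
proof (rule finite_uniform_pos[OF fin])
  fix v assume v: "v \<in> V"
  have "v \<notin> convex hull (V - {v})"
    using V v convex_hull_subset_affine_hull[of "V - {v}"] by (auto simp: affine_dependent_def)
  moreover have "closed (convex hull (V - {v}))"
    using fin by (simp add: compact_imp_closed finite_imp_compact_convex_hull)
  ultimately show "\<exists>c>0. \<forall>z\<in>convex hull (V - {v}). c \<le> dist v z"
    using separate_point_closed by blast
qed (meson order_trans)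

text \<open>On a triangle the middle one of the three corner values is attained again, by the
  intermediate value theorem, on the edge joining the other two corners. On a segment the constancy
  of \<open>f\<close> takes over. The point of the conclusion is that a corner and a point of the
  opposite face are at least a height apart.\<close>

lemma simplex_ivt:
  fixes V :: "'a::real_normed_vector set" and f :: "'a \<Rightarrow> real"
  assumes f: "continuous_on (convex hull V) f"
    and V: "card V = 3 \<or> card V = 2 \<and> (\<forall>x\<in>convex hull V. \<forall>y\<in>convex hull V. f x = f y)"
  shows "\<exists>b\<in>V. \<exists>z\<in>convex hull (V - {b}). f z = f b"
  using V
proof
  assume "card V = 3"
  then obtain a b c where abc: "V = {a, b, c}" "a \<noteq> b" "a \<noteq> c" "b \<noteq> c"
    by (metis card_3_iff)
  have main: "\<exists>b\<in>V. \<exists>z\<in>convex hull (V - {b}). f z = f b"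
    if V: "V = {a, b, c}" "a \<noteq> b" "b \<noteq> c" and le: "f a \<le> f b" "f b \<le> f c" for a b c
  proof -
    have sub: "convex hull {a, c} \<subseteq> convex hull V" using V by (intro hull_mono) auto
    have "connected (f ` (convex hull {a, c}))"
      using continuous_on_subset[OF f sub] convex_convex_hull convex_connected
        connected_continuous_image by blast
    moreover have "f a \<in> f ` (convex hull {a, c})" "f c \<in> f ` (convex hull {a, c})"
      by (auto intro!: imageI hull_inc)
    ultimately have "{f a..f c} \<subseteq> f ` (convex hull {a, c})"
      by (rule connected_contains_Icc)
    then obtain z where z: "z \<in> convex hull {a, c}" "f z = f b"
      using le by (auto simp: subset_iff)
    moreover have "V - {b} = {a, c}" using V by auto
    ultimately have "z \<in> convex hull (V - {b})" by simp
    then show ?thesis using z(2) V(1) by blast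
  qed
  consider "f a \<le> f b" "f b \<le> f c" | "f a \<le> f c" "f c \<le> f b" | "f b \<le> f a" "f a \<le> f c"
    | "f b \<le> f c" "f c \<le> f a" | "f c \<le> f a" "f a \<le> f b" | "f c \<le> f b" "f b \<le> f a"
    by linarith
  then show ?thesis
  proof cases
    case 1
    then show ?thesis using main[of a b c] abc by blast
  next
    case 2
    then show ?thesis using main[of a c b] abc by blast
  next
    case 3
    then show ?thesis using main[of b a c] abc by blast
  next
    case 4
    then show ?thesis using main[of b c a] abc by blast
  next
    case 5
    then show ?thesis using main[of c a b] abc by blast
  next
    case 6
    then show ?thesis using main[of c b a] abc by blast
  qed
next
  assume V: "card V = 2 \<and> (\<forall>x\<in>convex hull V. \<forall>y\<in>convex hull V. f x = f y)"
  then obtain a b where ab: "V = {a, b}" "a \<noteq> b" by (meson card_2_iff)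
  have "a \<in> convex hull V" "b \<in> convex hull V" unfolding ab(1) by (auto simp: hull_inc)
  then have "f a = f b" using V by blast
  moreover have "V - {b} = {a}" using ab by auto
  then have "a \<in> convex hull (V - {b})" by simp
  moreover have "b \<in> V" using ab(1) by simp
  ultimately show ?thesis by blast
qed

section \<open>Pieces of the boundary\<close>

lemma curvilinear_simplexD:
  fixes T :: "('n::finite) simp"
  assumes "curvilinear_simplex L T"
  shows "\<not> affine_dependent (fst T)" "card (fst T) = CARD('n)" "finite (fst T)"
    and "x \<in> convex hull (fst T) \<Longrightarrow> y \<in> convex hull (fst T) \<Longrightarrow> dist (snd T x) (snd T y) \<le> L * dist x y"
    and "x \<in> convex hull (fst T) \<Longrightarrow> y \<in> convex hull (fst T) \<Longrightarrow> dist x y \<le> L * dist (snd T x) (snd T y)"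
  using assms by (auto simp: curvilinear_simplex_def split_beta intro: aff_independent_finite)

lemma curvilinear_simplex_mono:
  assumes "curvilinear_simplex L T" "L \<le> L'"
  shows "curvilinear_simplex L' T"
proof -
  have "dist (snd T x) (snd T y) \<le> L' * dist x y \<and> dist x y \<le> L' * dist (snd T x) (snd T y)"
    if "x \<in> convex hull (fst T)" "y \<in> convex hull (fst T)" for x y
    using curvilinear_simplexD(4,5)[OF assms(1) that]
      mult_right_mono[OF assms(2), of "dist x y"] mult_right_mono[OF assms(2), of "dist (snd T x) (snd T y)"]
    by auto
  then show ?thesis
    using assms(1) by (auto simp: curvilinear_simplex_def split_beta)
qed

lemma compact_pts:
  assumes "curvilinear_simplex L T"
  shows "compact (pts T)"
proof -
  \<comment> \<open>A Lipschitz constant has to be nonnegative, whence the maximum with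
    \<open>1\<close>.\<close>
  have c: "curvilinear_simplex (max L 1) T" using assms by (rule curvilinear_simplex_mono) simp
  have "(max L 1)-lipschitz_on (convex hull fst T) (snd T)"
    using curvilinear_simplexD(4)[OF c] by (intro lipschitz_onI) auto
  then have "continuous_on (convex hull fst T) (snd T)"
    by (rule lipschitz_on_continuous_on)
  then show ?thesis
    unfolding pts_def using curvilinear_simplexD(3)[OF assms]
    by (intro compact_continuous_image finite_imp_compact_convex_hull)
qed

lemma inj_on_curvilinear_simplex:
  assumes "curvilinear_simplex L T"
  shows "inj_on (snd T) (convex hull (fst T))"
proof (rule inj_onI)
  fix x y assume *: "x \<in> convex hull (fst T)" "y \<in> convex hull (fst T)" "snd T x = snd T y"
  have "dist x y \<le> 0"
    using curvilinear_simplexD(5)[OF assms *(1,2)] *(3) by simp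
  then show "x = y" by simp
qed

lemma is_mesh_mono:
  assumes "is_mesh L \<Gamma> \<T>" "L \<le> L'" shows "is_mesh L' \<Gamma> \<T>"
proof -
  have "\<forall>T\<in>\<T>. curvilinear_simplex L T"
    using assms(1) unfolding is_mesh_def by (elim conjE)
  then have "\<forall>T\<in>\<T>. curvilinear_simplex L' T"
    using curvilinear_simplex_mono[OF _ assms(2)] by blast
  with assms(1) show ?thesis
    unfolding is_mesh_def by (elim conjE) (intro conjI)
qed

lemma pts_subset_bounded_diameter:
  assumes "curvilinear_simplex L T" "x \<in> pts T" "y \<in> pts T"
  shows "dist x y \<le> diameter (pts T)"
  using diameter_bounded_bound[OF compact_imp_bounded[OF compact_pts[OF assms(1)]]] assms by blast

section \<open>Curves and geodesic distance\<close>

lemma dist_le_path_length: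
  assumes "a \<in> {0..1}"
  shows "ennreal (dist (g 0) (g a)) \<le> path_length g"
proof -
  \<comment> \<open>The partition \<open>0, a, a, ...\<close>, of which a single summand is
    used.\<close>
  define u :: "nat \<Rightarrow> real" where "u i = (if i = 0 then 0 else a)" for i
  have "(1 :: nat, u) \<in> {(m, u). mono u \<and> range u \<subseteq> {0..1}}"
    using assms by (auto simp: u_def mono_def)
  then have "(\<Sum>i<1::nat. ennreal (dist (g (u i)) (g (u (Suc i))))) \<le> path_length g"
    unfolding path_length_def by (intro SUP_upper2[where i = "(1, u)"]) auto
  then show ?thesis by (simp add: u_def)
qed

text \<open>The infimum over curves need not be attained; doubling the constant makes the bound
  strict for distinct points and yields an actual curve. Its image is connected, and none of its
  points is further from \<open>x\<close> than its length. Connectedness is what the separation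
  arguments exploit.\<close>

lemma geodesic_dist_connected:
  assumes le: "geodesic_dist S x y \<le> ennreal (C * dist x y)" and C: "C > 0" and x: "x \<in> S"
  shows "\<exists>K. connected K \<and> K \<subseteq> S \<and> x \<in> K \<and> y \<in> K \<and> (\<forall>z\<in>K. dist x z \<le> 2 * C * dist x y)"
proof (cases "x = y")
  case True
  then show ?thesis using x by (intro exI[of _ "{x}"]) auto
next
  case False
  then have "C * dist x y < 2 * C * dist x y" using C by simp
  then have "geodesic_dist S x y < ennreal (2 * C * dist x y)"
    using le C False by (intro le_less_trans[OF le]) (auto simp: ennreal_less_iff)
  then obtain g where g: "path g" "path_image g \<subseteq> S" "pathstart g = x" "pathfinish g = y"
    and len: "path_length g < ennreal (2 * C * dist x y)"
    unfolding geodesic_dist_def INF_less_iff by auto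
  show ?thesis
  proof (intro exI[of _ "path_image g"] conjI ballI)
    show "connected (path_image g)" using g by (simp add: connected_path_image)
    show "x \<in> path_image g" "y \<in> path_image g" using g by auto
    fix z assume "z \<in> path_image g"
    then obtain a where a: "a \<in> {0..1}" "z = g a" by (auto simp: path_image_def)
    have "ennreal (dist x z) < ennreal (2 * C * dist x y)"
      using dist_le_path_length[OF a(1), of g] len g a(2) by (simp add: pathstart_def)
    then show "dist x z \<le> 2 * C * dist x y" by (simp add: ennreal_less_iff)
  qed (use g in auto)
qed

lemma height_decomposition:
  fixes V :: "'a::euclidean_space set"
  assumes x: "x \<in> convex hull V" and v: "v \<in> V" and w0: "w0 \<in> V" "w0 \<noteq> v"
  obtains a x' where "0 \<le> a" "a \<le> 1" "x' \<in> convex hull (V - {v})" "x = (1 - a) *\<^sub>R x' + a *\<^sub>R v"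
proof -
  have "V = insert v (V - {v})" using v by auto
  then have "x \<in> convex hull (insert v (V - {v}))" using x by simp
  moreover have "V - {v} \<noteq> {}" using w0 by auto
  ultimately obtain a b x' where "0 \<le> a" "0 \<le> b" "a + b = 1" "x' \<in> convex hull (V - {v})"
    "x = a *\<^sub>R v + b *\<^sub>R x'"
    unfolding convex_hull_insert[OF \<open>V - {v} \<noteq> {}\<close>] by auto
  moreover from this have "b = 1 - a" by simp
  ultimately show thesis
    by (intro that[of a x']) (auto simp: add.commute)
qed

lemma convex_hull_span:
  assumes "x \<in> convex hull A"
  shows "x - w0 \<in> span ((\<lambda>w. w - w0) ` A)"
proof -
  let ?S = "span ((\<lambda>w. w - w0) ` A)"
  have "convex {y. y - w0 \<in> ?S}"
  proof (rule convexI)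
    fix y z and u v :: real
    assume yz: "y \<in> {y. y - w0 \<in> ?S}" "z \<in> {y. y - w0 \<in> ?S}" and uv: "0 \<le> u" "0 \<le> v" "u + v = 1"
    have "u *\<^sub>R y + v *\<^sub>R z - w0 = u *\<^sub>R (y - w0) + v *\<^sub>R (z - w0) - (1 - (u + v)) *\<^sub>R w0"
      by (simp add: algebra_simps)
    also have "\<dots> = u *\<^sub>R (y - w0) + v *\<^sub>R (z - w0)" using uv by simp
    also have "\<dots> \<in> ?S" using yz by (auto intro: span_add span_scale)
    finally show "u *\<^sub>R y + v *\<^sub>R z \<in> {y. y - w0 \<in> ?S}" by simp
  qed
  then have "convex hull A \<subseteq> {y. y - w0 \<in> ?S}"
    by (intro hull_minimal) (auto intro: span_base)
  then show ?thesis using assms by auto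
qed

text \<open>The constants are extrema over the finitely many pieces of the decomposition that comes
  with the domain, so they depend on the boundary alone; every point receives a piece to which they
  apply.\<close>

lemma polytope_pieces:
  fixes \<Omega> :: "(real^'n::finite) set"
  assumes "curvilinear_polytope \<Omega>"
  shows "\<exists>L0\<ge>1. \<exists>H0>0. \<exists>D0>0. \<forall>x\<in>frontier \<Omega>. \<exists>P. curvilinear_simplex L0 P \<and> x \<in> pts P \<and> pts P \<subseteq> frontier \<Omega> \<and>
    (\<forall>v\<in>fst P. \<forall>z\<in>convex hull (fst P - {v}). H0 \<le> dist v z) \<and>
    (\<forall>y\<in>convex hull (fst P). \<forall>z\<in>convex hull (fst P). dist y z \<le> D0)"
proof -
  obtain \<F> :: "'n simp set" where F: "finite \<F>" "\<forall>T\<in>\<F>. \<exists>L. curvilinear_simplex L T"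
    "frontier \<Omega> = (\<Union>T\<in>\<F>. pts T)"
    using assms unfolding curvilinear_polytope_def by (elim exE conjE) (rule that)
  have "\<exists>L. \<forall>T\<in>\<F>. curvilinear_simplex L T"
    by (rule finite_uniform_bound[OF F(1)]) (use F(2) curvilinear_simplex_mono in auto)
  then obtain L where L: "\<forall>T\<in>\<F>. curvilinear_simplex L T" by blast
  have L1: "curvilinear_simplex (max L 1) T" if "T \<in> \<F>" for T
    using L that by (auto intro: curvilinear_simplex_mono)
  have "\<exists>H>0. \<forall>T\<in>\<F>. \<forall>v\<in>fst T. \<forall>z\<in>convex hull (fst T - {v}). H \<le> dist v z"
  proof (rule finite_uniform_pos[OF F(1)])
    fix T assume "T \<in> \<F>"
    then show "\<exists>c>0. \<forall>v\<in>fst T. \<forall>z\<in>convex hull (fst T - {v}). c \<le> dist v z"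
      using curvilinear_simplexD[OF L1] by (intro simplex_height_pos)
  next
    fix T :: "'n simp" and c d :: real
    assume "\<forall>v\<in>fst T. \<forall>z\<in>convex hull (fst T - {v}). c \<le> dist v z" "d \<le> c"
    then show "\<forall>v\<in>fst T. \<forall>z\<in>convex hull (fst T - {v}). d \<le> dist v z"
      by (meson order_trans)
  qed
  then obtain H where H: "H > 0" "\<forall>T\<in>\<F>. \<forall>v\<in>fst T. \<forall>z\<in>convex hull (fst T - {v}). H \<le> dist v z"
    by blast
  have "\<exists>D. \<forall>T\<in>\<F>. \<forall>y\<in>convex hull (fst T). \<forall>z\<in>convex hull (fst T). dist y z \<le> D"
  proof (rule finite_uniform_bound[OF F(1)])
    fix T assume T: "T \<in> \<F>"
    have "bounded (convex hull (fst T))"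
      using curvilinear_simplexD(3)[OF L1[OF T]]
      by (intro compact_imp_bounded finite_imp_compact_convex_hull)
    then show "\<exists>c. \<forall>y\<in>convex hull (fst T). \<forall>z\<in>convex hull (fst T). dist y z \<le> c"
      by (simp add: bounded_two_points)
  next
    fix T :: "'n simp" and c d :: real
    assume "\<forall>y\<in>convex hull (fst T). \<forall>z\<in>convex hull (fst T). dist y z \<le> c" "c \<le> d"
    then show "\<forall>y\<in>convex hull (fst T). \<forall>z\<in>convex hull (fst T). dist y z \<le> d"
      by (meson order_trans)
  qed
  then obtain D where D: "\<forall>T\<in>\<F>. \<forall>y\<in>convex hull (fst T). \<forall>z\<in>convex hull (fst T). dist y z \<le> D"
    by blast
  show ?thesis
  proof (rule exI[of _ "max L 1"], rule conjI, simp, rule exI[of _ H], rule conjI[OF H(1)],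
      rule exI[of _ "max D 1"], rule conjI, simp, rule ballI)
    fix x assume "x \<in> frontier \<Omega>"
    then obtain T where T: "T \<in> \<F>" "x \<in> pts T" using F(3) by blast
    have "\<forall>y\<in>convex hull (fst T). \<forall>z\<in>convex hull (fst T). dist y z \<le> max D 1"
      using D T(1) by (meson max.coboundedI1)
    moreover have "pts T \<subseteq> frontier \<Omega>" using F(3) T(1) by blast
    ultimately show "\<exists>P. curvilinear_simplex (max L 1) P \<and> x \<in> pts P \<and> pts P \<subseteq> frontier \<Omega> \<and>
      (\<forall>v\<in>fst P. \<forall>z\<in>convex hull (fst P - {v}). H \<le> dist v z) \<and>
      (\<forall>y\<in>convex hull (fst P). \<forall>z\<in>convex hull (fst P). dist y z \<le> max D 1)"
      using T H(2) L1[OF T(1)] by (intro exI[of _ T] conjI) simp_all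
  qed
qed

text \<open>Each piece contributes at most a multiple of \<open>r ^ (n - 1)\<close>. The pieces are
  those of the fixed decomposition and not elements of a mesh, which keeps \<open>K\<close>
  independent of \<open>h\<close>.\<close>

lemma surface_measure_ball_bound:
  fixes \<Omega> :: "(real^'n::finite) set"
  assumes poly: "curvilinear_polytope \<Omega>" and dim: "CARD('n) \<ge> 2"
  shows "\<exists>K>0. \<forall>t r. r > 0 \<longrightarrow>
    emeasure (surface_measure (frontier \<Omega>)) (frontier \<Omega> \<inter> ball t r) \<le> ennreal (K * r ^ (CARD('n) - 1))"
proof -
  let ?k = "CARD('n) - 1" and ?M = "surface_measure (frontier \<Omega>)"
  obtain \<F> :: "'n simp set" where F: "finite \<F>" "\<forall>T\<in>\<F>. \<exists>L. curvilinear_simplex L T"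
    "frontier \<Omega> = (\<Union>T\<in>\<F>. pts T)"
    using poly unfolding curvilinear_polytope_def by (elim exE conjE) (rule that)
  have cl: "frontier \<Omega> \<in> sets borel" by (simp add: borel_closed)
  have "\<exists>K. \<forall>T\<in>\<F>. \<forall>t r. r > 0 \<longrightarrow> hausdorff ?k (pts T \<inter> ball t r) \<le> ennreal (K * r ^ ?k)"
  proof (rule finite_uniform_bound[OF F(1)])
    fix T assume "T \<in> \<F>"
    then obtain L where "curvilinear_simplex L T" using F by blast
    then have c: "curvilinear_simplex (max L 1) T" by (rule curvilinear_simplex_mono) simp
    have eq: "snd T ` {x \<in> convex hull (fst T). snd T x \<in> ball t r} = pts T \<inter> ball t r" for t r
      by (auto simp: pts_def)
    have "\<exists>K. \<forall>t r. r > 0 \<longrightarrow> hausdorff ?k (snd T ` {x \<in> convex hull (fst T). snd T x \<in> ball t r}) \<le> ennreal (K * r ^ ?k)"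
      by (rule hausdorff_bilipschitz_simplex_ball[where L = "max L 1"])
        (use curvilinear_simplexD[OF c] dim in auto)
    then show "\<exists>K. \<forall>t r. r > 0 \<longrightarrow> hausdorff ?k (pts T \<inter> ball t r) \<le> ennreal (K * r ^ ?k)"
      unfolding eq .
  next
    fix T :: "'n simp" and c d :: real
    assume *: "\<forall>t r. r > 0 \<longrightarrow> hausdorff ?k (pts T \<inter> ball t r) \<le> ennreal (c * r ^ ?k)" and "c \<le> d"
    have "ennreal (c * r ^ ?k) \<le> ennreal (d * r ^ ?k)" if "r > 0" for r
      using \<open>c \<le> d\<close> that by (intro ennreal_leI mult_right_mono) auto
    with * show "\<forall>t r. r > 0 \<longrightarrow> hausdorff ?k (pts T \<inter> ball t r) \<le> ennreal (d * r ^ ?k)"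
      by (meson order_trans)
  qed
  then obtain K where K: "\<And>T t r. T \<in> \<F> \<Longrightarrow> r > 0 \<Longrightarrow> hausdorff ?k (pts T \<inter> ball t r) \<le> ennreal (K * r ^ ?k)"
    by blast
  define K' where "K' = real (card \<F>) * max K 1 + 1"
  have "emeasure ?M (frontier \<Omega> \<inter> ball t r) \<le> ennreal (K' * r ^ ?k)" if r: "r > 0" for t r
  proof -
    have "closed (pts T)" if "T \<in> \<F>" for T
      using F(2) that compact_pts compact_imp_closed by blast
    then have ms: "pts T \<inter> ball t r \<in> sets ?M" if "T \<in> \<F>" for T
      using that F(3) cl by (subst sets_surface_measure, subst sets_restrict_space_iff) auto
    have "emeasure ?M (frontier \<Omega> \<inter> ball t r) = emeasure ?M (\<Union>T\<in>\<F>. pts T \<inter> ball t r)"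
      using F(3) by (intro arg_cong2[where f = emeasure]) auto
    also have "\<dots> \<le> (\<Sum>T\<in>\<F>. emeasure ?M (pts T \<inter> ball t r))"
      using ms by (intro emeasure_subadditive_finite[OF F(1)]) auto
    also have "\<dots> \<le> (\<Sum>T\<in>\<F>. ennreal (max K 1 * r ^ ?k))"
    proof (rule sum_mono)
      fix T assume T: "T \<in> \<F>"
      have "emeasure ?M (pts T \<inter> ball t r) \<le> hausdorff ?k (pts T \<inter> ball t r)"
        using T F(3) cl by (intro emeasure_surface_measure_le) auto
      also have "\<dots> \<le> ennreal (K * r ^ ?k)" by (rule K[OF T r])
      also have "\<dots> \<le> ennreal (max K 1 * r ^ ?k)"
        using r by (intro ennreal_leI mult_right_mono) auto
      finally show "emeasure ?M (pts T \<inter> ball t r) \<le> ennreal (max K 1 * r ^ ?k)" .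
    qed
    also have "\<dots> = ennreal (real (card \<F>) * (max K 1 * r ^ ?k))"
      using r by (simp add: ennreal_mult ennreal_of_nat_eq_real_of_nat)
    also have "\<dots> \<le> ennreal (K' * r ^ ?k)"
      using r by (intro ennreal_leI) (simp add: K'_def algebra_simps)
    finally show ?thesis .
  qed
  moreover have "K' > 0" unfolding K'_def by (intro add_nonneg_pos mult_nonneg_nonneg) auto
  ultimately show ?thesis by blast
qed

section \<open>Separation of disjoint elements\<close>

text \<open>
  \<open>G\<close> compares geodesic and Euclidean distance, and \<open>L0\<close>, \<open>H0\<close>, \<open>D0\<close> are distortion, minimal height and
  diameter bounds for a fixed decomposition of the surface. All constants below are explicit in
  \<open>L\<close>, \<open>q\<close>, \<open>\<kappa>\<close>, \<open>G\<close>, \<open>L0\<close>, \<open>H0\<close>, \<open>D0\<close>, which makes them independent of \<open>h\<close> and of the mesh.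
\<close>
locale surface_mesh =
  fixes \<Gamma> :: "(real^'n::finite) set" and L q \<kappa> G L0 H0 D0 h :: real and \<T> :: "'n simp set"
  assumes dim: "CARD('n) = 2 \<or> CARD('n) = 3"
    and params: "L \<ge> 1" "q \<ge> 1" "\<kappa> \<ge> 1" "G \<ge> 1" "L0 \<ge> 1" "H0 > 0" "D0 > 0" "h > 0"
    and diameter_surface: "\<And>x y. x \<in> \<Gamma> \<Longrightarrow> y \<in> \<Gamma> \<Longrightarrow> dist x y \<le> D0"
    and pieces: "\<And>x. x \<in> \<Gamma> \<Longrightarrow> \<exists>P. curvilinear_simplex L0 P \<and> x \<in> pts P \<and> pts P \<subseteq> \<Gamma> \<and>
      (\<forall>v\<in>fst P. \<forall>z\<in>convex hull (fst P - {v}). H0 \<le> dist v z) \<and>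
      (\<forall>y\<in>convex hull (fst P). \<forall>z\<in>convex hull (fst P). dist y z \<le> D0)"
    and geodesic: "\<And>x y. x \<in> \<Gamma> \<Longrightarrow> y \<in> \<Gamma> \<Longrightarrow> geodesic_dist \<Gamma> x y \<le> ennreal (G * dist x y)"
    and connection: "\<And>x y. x \<in> \<Gamma> \<Longrightarrow> y \<in> \<Gamma> \<Longrightarrow>
      \<exists>K. connected K \<and> K \<subseteq> \<Gamma> \<and> x \<in> K \<and> y \<in> K \<and> (\<forall>z\<in>K. dist x z \<le> G * dist x y)"
    and mesh: "is_mesh L \<Gamma> \<T>" and qu: "quasi_uniform q h \<T>" and sr: "shape_regular \<kappa> \<Gamma> \<T>"
begin

lemma finite_mesh: "finite \<T>"
  using mesh unfolding is_mesh_def by (elim conjE)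

lemma union_pts: "(\<Union>T\<in>\<T>. pts T) = \<Gamma>"
  using mesh unfolding is_mesh_def by (elim conjE)

lemma element:
  assumes "T \<in> \<T>" shows "curvilinear_simplex L T"
proof -
  have "\<forall>T\<in>\<T>. curvilinear_simplex L T"
    using mesh unfolding is_mesh_def by (elim conjE)
  then show ?thesis using assms by blast
qed

lemma pts_subset: "T \<in> \<T> \<Longrightarrow> pts T \<subseteq> \<Gamma>"
  using union_pts by blast

lemma closed_pts: "T \<in> \<T> \<Longrightarrow> closed (pts T)"
  using element compact_pts compact_imp_closed by blast

lemma conforming:
  assumes "T \<in> \<T>" "T' \<in> \<T>" "T \<noteq> T'"
  shows "\<exists>A A'. A \<subset> fst T \<and> A' \<subset> fst T' \<and> snd T ` A = snd T' ` A' \<and>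
    pts T \<inter> pts T' = snd T ` (convex hull A) \<and> pts T \<inter> pts T' = snd T' ` (convex hull A')"
proof -
  have "\<forall>T\<in>\<T>. \<forall>T'\<in>\<T>. T \<noteq> T' \<longrightarrow>
        (\<exists>A A'. A \<subset> fst T \<and> A' \<subset> fst T' \<and>
           snd T ` A = snd T' ` A' \<and>
           pts T \<inter> pts T' = snd T ` (convex hull A) \<and>
           pts T \<inter> pts T' = snd T' ` (convex hull A'))"
    using mesh unfolding is_mesh_def by (elim conjE)
  from this[rule_format, OF assms] show ?thesis .
qed

lemma dist_element_le: "T \<in> \<T> \<Longrightarrow> x \<in> pts T \<Longrightarrow> y \<in> pts T \<Longrightarrow> dist x y \<le> q * h"
  using pts_subset_bounded_diameter[OF element] qu unfolding quasi_uniform_def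
  by (meson order_trans)

text \<open>An inscribed ball has a centre, so the element is nonempty and no wider than the
  surface. The bound keeps a scaling factor below \<open>1\<close> later on and absorbs the power of
  \<open>h\<close> left over in the \<open>L\<^sup>2\<close> part of the norm.\<close>

lemma mesh_size_le: 
  assumes "T \<in> \<T>" shows "h \<le> q * D0"
proof -
  have "pts T \<noteq> {}"
    using sr assms unfolding shape_regular_def by blast
  then have "diameter (pts T) \<le> D0"
    unfolding diameter_def using diameter_surface pts_subset[OF assms]
    by (auto intro!: cSUP_least)
  then have "q * diameter (pts T) \<le> q * D0" using params by (intro mult_left_mono) auto
  then show ?thesis using qu assms unfolding quasi_uniform_def by fastforce
qed

text \<open>The factor \<open>h / (4 * \<kappa> * q * G * L0 * D0)\<close> shrinks a piece with
  heights at least \<open>H0\<close> into the inscribed ball, and \<open>L0 * L\<close> is the loss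
  in passing through its parametrisation and that of the element.\<close>

definition hgt :: real where "hgt = H0 / (4 * \<kappa> * q * G * L0 * D0) / (L0 * L)"

lemma hgt_pos: "hgt > 0"
  using params unfolding hgt_def by (intro divide_pos_pos mult_pos_pos) auto

text \<open>Three points of a fixed piece of the surface, scaled down into the inscribed ball, are mapped
  to the reference simplex. If that were thin around one of its edges, the intermediate
  value theorem would yield two points, far apart on the surface, with the same projection to the
  edge. In the plane the edge is a point and the projection is constant.\<close>
lemma reference_height:
  assumes T: "T \<in> \<T>" and v: "v \<in> fst T" and w0: "w0 \<in> fst T" "w0 \<noteq> v"
    and m: "\<And>w. w \<in> fst T - {v} \<Longrightarrow> m \<bullet> (w - w0) = 0"
    and sp: "v - m - w0 \<in> span ((\<lambda>w. w - w0) ` (fst T - {v}))"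
  shows "hgt * h \<le> norm m"
proof -
  note el = curvilinear_simplexD[OF element[OF T]]
  obtain x r where x: "x \<in> pts T" and r: "r > 0" and ball: "geodesic_ball \<Gamma> x r \<subseteq> pts T"
    and dm: "diameter (pts T) \<le> \<kappa> * (2 * r)"
    using sr T unfolding shape_regular_def by blast
  have "q * diameter (pts T) \<le> q * (\<kappa> * (2 * r))"
    using dm params by (intro mult_left_mono) auto
  moreover have "h \<le> q * diameter (pts T)"
    using qu T unfolding quasi_uniform_def by blast
  ultimately have hr: "h \<le> 2 * \<kappa> * q * r" by (simp add: mult_ac)
  have x\<Gamma>: "x \<in> \<Gamma>" using x pts_subset T by blast
  obtain P where P: "curvilinear_simplex L0 P" "x \<in> pts P" "pts P \<subseteq> \<Gamma>"
    and H: "\<And>v z. v \<in> fst P \<Longrightarrow> z \<in> convex hull (fst P - {v}) \<Longrightarrow> H0 \<le> dist v z"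
    and D: "\<And>y z. y \<in> convex hull (fst P) \<Longrightarrow> z \<in> convex hull (fst P) \<Longrightarrow> dist y z \<le> D0"
    using pieces[OF x\<Gamma>] by blast
  note pc = curvilinear_simplexD[OF P(1)]
  obtain p where p: "p \<in> convex hull (fst P)" "snd P p = x" using P(2) by (auto simp: pts_def)
  \<comment> \<open>Points of the shrunk piece have geodesic distance at most
    \<open>G * L0 * lam * D0 = h / (4 * \<kappa> * q)\<close> from \<open>x\<close>, which is half
    of the lower bound \<open>h / (2 * \<kappa> * q)\<close> for \<open>r\<close>; the spare factor
    gives the strict inequality.\<close>
  define lam where "lam = h / (4 * \<kappa> * q * G * L0 * D0)"
  have lam: "0 < lam" unfolding lam_def using params by simp
  have "1 * 1 * 1 \<le> \<kappa> * G * L0"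
    using params by (intro mult_mono) auto
  then have "q * D0 * 1 \<le> q * D0 * (\<kappa> * G * L0)" using params by (intro mult_left_mono) simp_all
  moreover have "0 \<le> q * D0 * (\<kappa> * G * L0)" using params by simp
  ultimately have "h \<le> 4 * (q * D0 * (\<kappa> * G * L0))" using mesh_size_le[OF T] by linarith
  then have lam1: "lam \<le> 1" unfolding lam_def using params by (simp add: mult_ac)
  \<comment> \<open>Contraction towards the parameter \<open>p\<close> of the ball centre: distances
    scale by \<open>lam\<close>, and convexity keeps the image in the reference simplex of the
    piece.\<close>
  define s where "s z = (1 - lam) *\<^sub>R p + lam *\<^sub>R z" for z
  have s_in: "s z \<in> convex hull (fst P)" if "z \<in> convex hull (fst P)" for z
    unfolding s_def using p that lam lam1 by (intro convexD[OF convex_convex_hull]) auto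
  have s_diff: "s z - s z' = lam *\<^sub>R (z - z')" for z z'
    unfolding s_def by (simp add: algebra_simps)
  have s_dist: "dist (s z) (s z') = lam * dist z z'" for z z'
    using lam by (simp add: dist_norm s_diff)
  have s_p: "s p = p" unfolding s_def by (simp add: algebra_simps)
  have in_T: "snd P (s z) \<in> pts T" if z: "z \<in> convex hull (fst P)" for z
  proof -
    have "dist x (snd P (s z)) \<le> L0 * dist (s p) (s z)"
      using pc(4)[OF p(1) s_in[OF z]] p(2) s_p by simp
    also have "\<dots> \<le> L0 * (lam * D0)"
      using params lam D[OF p(1) z] by (simp add: s_dist mult_left_mono)
    finally have "G * dist x (snd P (s z)) \<le> G * (L0 * (lam * D0))"
      using params by (intro mult_left_mono) auto
    also have "\<dots> = h / (4 * \<kappa> * q)" unfolding lam_def using params by simp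
    also have "\<dots> \<le> r / 2" using hr params by (simp add: field_simps)
    also have "\<dots> < r" using r by simp
    finally have *: "G * dist x (snd P (s z)) < r" .
    have g: "snd P (s z) \<in> \<Gamma>" using P(3) s_in[OF z] by (auto simp: pts_def)
    have "geodesic_dist \<Gamma> x (snd P (s z)) < ennreal r"
      using geodesic[OF x\<Gamma> g] * params(4) by (intro le_less_trans[OF geodesic[OF x\<Gamma> g]]) (simp add: ennreal_less_iff)
    then show ?thesis using ball g by (auto simp: geodesic_ball_def)
  qed
  then have "\<forall>z\<in>convex hull (fst P). \<exists>y. y \<in> convex hull (fst T) \<and> snd T y = snd P (s z)"
    by (force simp: pts_def image_iff)
  \<comment> \<open>\<open>g\<close> carries the shrunk piece to the reference simplex of
    \<open>T\<close>. Its upper Lipschitz bound gives continuity, the lower one keeps separated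
    points apart.\<close>
  from bchoice[OF this] obtain g where
    g: "\<forall>z\<in>convex hull (fst P). g z \<in> convex hull (fst T) \<and> snd T (g z) = snd P (s z)" by blast
  have g_le: "dist (g z) (g z') \<le> L * L0 * lam * dist z z'"
    if "z \<in> convex hull (fst P)" "z' \<in> convex hull (fst P)" for z z'
  proof -
    have "dist (g z) (g z') \<le> L * dist (snd P (s z)) (snd P (s z'))"
      using el(5)[of "g z" "g z'"] g that by metis
    also have "\<dots> \<le> L * (L0 * dist (s z) (s z'))"
      using pc(4)[OF s_in[OF that(1)] s_in[OF that(2)]] params by (intro mult_left_mono) auto
    finally show ?thesis by (simp add: s_dist mult_ac)
  qed
  have g_ge: "lam * dist z z' \<le> L0 * L * dist (g z) (g z')"
    if "z \<in> convex hull (fst P)" "z' \<in> convex hull (fst P)" for z z'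
  proof -
    have "lam * dist z z' \<le> L0 * dist (snd P (s z)) (snd P (s z'))"
      using pc(5)[OF s_in[OF that(1)] s_in[OF that(2)]] by (simp add: s_dist)
    also have "\<dots> = L0 * dist (snd T (g z)) (snd T (g z'))" using g that by simp
    also have "\<dots> \<le> L0 * (L * dist (g z) (g z'))"
      using el(4)[of "g z" "g z'"] g that params by (intro mult_left_mono) auto
    finally show ?thesis by (simp add: mult_ac)
  qed
  let ?B = "(\<lambda>w. w - w0) ` (fst T - {v})"
  \<comment> \<open>\<open>d\<close> spans the directions of the face opposite to \<open>v\<close>:
    an edge vector for triangles, \<open>0\<close> for segments, where that face is a point.\<close>
  obtain d where d: "?B \<subseteq> {0, d}" "d \<in> insert 0 ?B" "CARD('n) = 2 \<longrightarrow> d = 0"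
  proof -
    have c: "card (fst T - {v} - {w0}) = CARD('n) - 2" using el(2,3) v w0 by simp
    from dim show thesis
    proof
      assume "CARD('n) = 2"
      then have "card (fst T - {v} - {w0}) = 0" using c by simp
      then have "fst T - {v} - {w0} = {}" using el(3) by (metis card_0_eq finite_Diff)
      then have "fst T - {v} = {w0}" using w0 by auto
      then show thesis by (intro that[of 0]) auto
    next
      assume n3: "CARD('n) = 3"
      then have "card (fst T - {v} - {w0}) = 1" using c by simp
      then obtain w1 where "fst T - {v} - {w0} = {w1}" by (auto simp: card_1_singleton_iff)
      then have "fst T - {v} = {w0, w1}" using w0 by auto
      then show thesis using n3 by (intro that[of "w1 - w0"]) auto
    qed
  qed
  have span_B: "\<exists>k. e = k *\<^sub>R d" if "e \<in> span ?B" for e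
  proof -
    have "e \<in> span {0, d}" using span_mono[OF d(1)] that by blast
    then show ?thesis by (auto simp: span_insert_0 span_singleton)
  qed
  have md: "m \<bullet> d = 0" using d(2) m by auto
  define f where "f z = (g z - w0) \<bullet> d" for z
  have "(L * L0 * lam)-lipschitz_on (convex hull fst P) g"
    using g_le params lam by (intro lipschitz_onI) auto
  then have "continuous_on (convex hull fst P) f"
    unfolding f_def by (intro continuous_intros lipschitz_on_continuous_on)
  moreover have "card (fst P) = 3 \<or> card (fst P) = 2 \<and>
      (\<forall>x\<in>convex hull fst P. \<forall>y\<in>convex hull fst P. f x = f y)"
    using dim d(3) pc(2) by (auto simp: f_def)
  ultimately obtain b z where b: "b \<in> fst P" and z: "z \<in> convex hull (fst P - {b})" and fzb: "f z = f b"
    using simplex_ivt by blast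
  have zP: "z \<in> convex hull (fst P)" using z hull_mono[of "fst P - {b}" "fst P"] by blast
  have bP: "b \<in> convex hull (fst P)" using b by (rule hull_inc)
  \<comment> \<open>The reference simplex lies in a slab: the height coordinate \<open>a\<close>, in
    units of \<open>m\<close>, stays between \<open>0\<close> and \<open>1\<close>.\<close>
  have dec: "\<exists>a k. 0 \<le> a \<and> a \<le> 1 \<and> y - w0 = a *\<^sub>R m + k *\<^sub>R d" if y: "y \<in> convex hull (fst T)" for y
  proof -
    obtain a x' where a: "0 \<le> a" "a \<le> 1" "x' \<in> convex hull (fst T - {v})" "y = (1 - a) *\<^sub>R x' + a *\<^sub>R v"
      by (rule height_decomposition[OF y v w0])
    have "y - w0 - a *\<^sub>R m = (1 - a) *\<^sub>R (x' - w0) + a *\<^sub>R (v - m - w0)"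
      unfolding a(4) by (simp add: algebra_simps)
    also have "\<dots> \<in> span ?B"
      using convex_hull_span[OF a(3)] sp by (intro span_add span_scale)
    finally obtain k where "y - w0 - a *\<^sub>R m = k *\<^sub>R d" using span_B by blast
    then have "y - w0 = a *\<^sub>R m + k *\<^sub>R d" by (simp add: algebra_simps)
    then show ?thesis using a(1,2) by blast
  qed
  obtain a k where a: "0 \<le> a" "a \<le> 1" "g z - w0 = a *\<^sub>R m + k *\<^sub>R d" using dec g zP by blast
  obtain a' k' where a': "0 \<le> a'" "a' \<le> 1" "g b - w0 = a' *\<^sub>R m + k' *\<^sub>R d" using dec g bP by blast
  \<comment> \<open>Equal components along \<open>d\<close> leave a difference that is a multiple of
    \<open>m\<close> with factor at most \<open>1\<close> in absolute value.\<close>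
  have "k * (d \<bullet> d) = k' * (d \<bullet> d)"
    using fzb md unfolding f_def a(3) a'(3) by (simp add: inner_add_left)
  then have kd: "k *\<^sub>R d = k' *\<^sub>R d" by auto
  have "g z - g b = (g z - w0) - (g b - w0)" by simp
  also have "\<dots> = (a - a') *\<^sub>R m"
    unfolding a(3) a'(3) kd by (simp add: algebra_simps)
  finally have "dist (g z) (g b) = \<bar>a - a'\<bar> * norm m" by (simp add: dist_norm)
  also have "\<dots> \<le> 1 * norm m" using a a' by (intro mult_right_mono) auto
  finally have gm: "dist (g z) (g b) \<le> norm m" by simp
  \<comment> \<open>In the fixed piece the two points are a corner and a point of the opposite face,
    hence at least \<open>H0\<close> apart.\<close>
  have "lam * H0 \<le> lam * dist z b"
    using H[OF b z] lam by (simp add: dist_commute)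
  also have "\<dots> \<le> L0 * L * dist (g z) (g b)" by (rule g_ge[OF zP bP])
  also have "\<dots> \<le> L0 * L * norm m"
    using gm params by (intro mult_left_mono) simp_all
  finally have "lam * H0 / (L0 * L) \<le> norm m"
    using params by (simp add: field_simps)
  moreover have "lam * H0 / (L0 * L) = hgt * h" unfolding lam_def hgt_def by simp
  ultimately show ?thesis by simp
qed

text \<open>Passing from a reference simplex to the surface shortens a height by at most the factor
  \<open>L\<close>.\<close>

definition c1 :: real where "c1 = hgt / L"

lemma c1_pos: "c1 > 0"
  using hgt_pos params by (simp add: c1_def)

text \<open>\<open>a\<close> is the barycentric weight of \<open>v\<close>, so the point has
  \<open>a\<close> times the altitude as its height over the opposite face. Testing with the
  altitude vector gives the distance in the reference simplex, and the parametrisation costs a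
  factor \<open>L\<close>.\<close>

lemma face_distance:
  assumes T: "T \<in> \<T>" and v: "v \<in> fst T" and a: "0 \<le> a" "a \<le> 1"
    and x': "x' \<in> convex hull (fst T - {v})" and y: "y \<in> convex hull (fst T - {v})"
  shows "a * (c1 * h) \<le> dist (snd T ((1 - a) *\<^sub>R x' + a *\<^sub>R v)) (snd T y)"
proof -
  note el = curvilinear_simplexD[OF element[OF T]]
  have "fst T - {v} \<noteq> {}" using y by (metis convex_hull_empty empty_iff)
  then obtain w0 where w0: "w0 \<in> fst T" "w0 \<noteq> v" by blast
  obtain m where m0: "m \<noteq> 0" and m: "\<forall>w\<in>fst T - {v}. m \<bullet> (w - w0) = 0"
    and mv: "m \<bullet> (v - w0) = m \<bullet> m" and sp: "v - m - w0 \<in> span ((\<lambda>w. w - w0) ` (fst T - {v}))"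
    using height_vector[OF el(1) v w0] by blast
  have hm: "hgt * h \<le> norm m"
    using reference_height[OF T v w0 _ sp] m by blast
  have perp: "m \<bullet> (z - w0) = 0" if "z \<in> convex hull (fst T - {v})" for z
  proof -
    have "z - w0 \<in> span ((\<lambda>w. w - w0) ` (fst T - {v}))" by (rule convex_hull_span[OF that])
    then have "orthogonal m (z - w0)"
      by (rule orthogonal_to_span) (use m in \<open>auto simp: orthogonal_def\<close>)
    then show ?thesis by (simp add: orthogonal_def)
  qed
  define x where "x = (1 - a) *\<^sub>R x' + a *\<^sub>R v"
  have sub: "convex hull (fst T - {v}) \<subseteq> convex hull (fst T)" by (intro hull_mono) auto
  have xT: "x \<in> convex hull (fst T)"
    unfolding x_def using a x' sub v by (intro convexD[OF convex_convex_hull]) (auto intro: hull_inc)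
  have "x - y = (1 - a) *\<^sub>R (x' - w0) + a *\<^sub>R (v - w0) - (y - w0)"
    unfolding x_def by (simp add: algebra_simps)
  then have "m \<bullet> (x - y) = a * (m \<bullet> m)"
    using perp[OF x'] perp[OF y] mv by (simp add: inner_add_right inner_diff_right)
  then have "a * norm m * norm m \<le> norm m * norm (x - y)"
    using norm_cauchy_schwarz[of m "x - y"] by (simp add: dot_square_norm power2_eq_square mult.assoc)
  then have "a * norm m \<le> dist x y"
    using m0 by (simp add: dist_norm mult.commute[of "norm m"])
  moreover have "dist x y \<le> L * dist (snd T x) (snd T y)"
    using el(5)[OF xT] y sub by blast
  moreover have "a * (hgt * h) \<le> a * norm m" using hm a by (intro mult_left_mono)
  ultimately have "a * (hgt * h) \<le> L * dist (snd T x) (snd T y)" by linarith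
  then show ?thesis using params unfolding c1_def x_def by (simp add: field_simps)
qed

text \<open>Injectivity moves the question to the reference simplex, where affine independence keeps
  a corner out of the hull of the others.\<close>

lemma node_corner_of_face:
  assumes T: "T \<in> \<T>" and v: "v \<in> fst T" and A: "A \<subseteq> fst T" and y: "snd T v \<in> snd T ` (convex hull A)"
  shows "v \<in> A"
proof (rule ccontr)
  note el = curvilinear_simplexD[OF element[OF T]]
  assume "v \<notin> A"
  then have "A \<subseteq> fst T - {v}" using A by blast
  then have 1: "convex hull A \<subseteq> convex hull (fst T - {v})" by (rule hull_mono)
  obtain x where x: "x \<in> convex hull A" "snd T v = snd T x" using y by blast
  have "x \<in> convex hull (fst T)" using x(1) hull_mono[OF A] by blast
  then have "v = x"
    using inj_onD[OF inj_on_curvilinear_simplex[OF element[OF T]] x(2)] v hull_inc by metis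
  then have "v \<in> affine hull (fst T - {v})"
    using x(1) 1 convex_hull_subset_affine_hull by blast
  then show False using el(1) v by (auto simp: affine_dependent_def)
qed

section \<open>Nodes and patches\<close>

lemma corners_subset_pts: "corners T \<subseteq> pts T"
  unfolding corners_def pts_def by (auto intro: hull_inc)

lemma corners_subset_nodes: "T \<in> \<T> \<Longrightarrow> corners T \<subseteq> nodes \<T>"
  unfolding nodes_def by blast

lemma nodes_subset: "nodes \<T> \<subseteq> \<Gamma>"
  using corners_subset_pts pts_subset unfolding nodes_def by fastforce

text \<open>There are no hanging nodes: a corner of \<open>T'\<close> in \<open>T\<close> lies in
  the common face, is therefore a corner of that face, and conformity makes the corners of the face
  corners of both elements.\<close>

lemma node_is_corner:
  assumes y: "y \<in> nodes \<T>" and T: "T \<in> \<T>" "y \<in> pts T"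
  shows "y \<in> corners T"
proof -
  obtain T' where T': "T' \<in> \<T>" "y \<in> corners T'" using y unfolding nodes_def by blast
  show ?thesis
  proof (cases "T = T'")
    case False
    obtain A A' where A: "A \<subset> fst T" "A' \<subset> fst T'" "snd T ` A = snd T' ` A'"
      "pts T \<inter> pts T' = snd T ` (convex hull A)" "pts T \<inter> pts T' = snd T' ` (convex hull A')"
      using conforming[OF T(1) T'(1) False] by (elim exE conjE) (rule that)
    obtain v where v: "v \<in> fst T'" "y = snd T' v" using T'(2) by (auto simp: corners_def)
    have "y \<in> pts T \<inter> pts T'" using T T' corners_subset_pts by blast
    then have "snd T' v \<in> snd T' ` (convex hull A')" using A(5) v(2) by simp
    then have "v \<in> A'" using node_corner_of_face[OF T'(1) v(1)] A(2) by blast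
    then have "y \<in> snd T ` A" using A(3) v(2) by simp
    then show ?thesis using A(1) unfolding corners_def by blast
  qed (use T' in simp)
qed

text \<open>Corners are extreme points, and a convex set with more than one point has none of them
  in its relative interior.\<close>

lemma corner_in_bdry:
  assumes T: "T \<in> \<T>" and y: "y \<in> corners T"
  shows "y \<in> bdry T"
proof -
  note el = curvilinear_simplexD[OF element[OF T]]
  obtain v where v: "v \<in> fst T" "y = snd T v" using y by (auto simp: corners_def)
  have "convex hull (fst T) \<noteq> {v}"
  proof
    assume "convex hull (fst T) = {v}"
    then have "fst T \<subseteq> {v}" using hull_subset[of "fst T" convex] by simp
    then have "card (fst T) \<le> 1" using card_mono[of "{v}" "fst T"] by simp
    then show False using el(2) dim by auto
  qed
  moreover have "v extreme_point_of (convex hull (fst T))"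
    using extreme_point_of_convex_hull_affine_independent[OF el(1)] v by blast
  ultimately have "v \<notin> rel_interior (convex hull (fst T))"
    by (intro extreme_point_not_in_REL_INTERIOR)
  moreover have "v \<in> closure (convex hull (fst T))"
    using hull_inc[OF v(1), of convex] closure_subset[of "convex hull (fst T)"] by blast
  ultimately have "v \<in> rel_frontier (convex hull (fst T))"
    by (simp add: rel_frontier_def)
  then show ?thesis unfolding bdry_def v(2) by blast
qed

lemma bdry_subset_pts:
  assumes T: "T \<in> \<T>" shows "bdry T \<subseteq> pts T"
proof -
  have "closed (convex hull (fst T))"
    using curvilinear_simplexD(3)[OF element[OF T]]
    by (intro compact_imp_closed finite_imp_compact_convex_hull)
  then have "rel_frontier (convex hull (fst T)) \<subseteq> convex hull (fst T)"
    by (auto simp: rel_frontier_def)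
  then show ?thesis unfolding bdry_def pts_def by blast
qed

text \<open>Patches are defined through boundaries; at a node this identifies the patch with the
  union of the elements that have the node as a corner.\<close>

lemma node_in_bdry_iff:
  "y \<in> nodes \<T> \<Longrightarrow> T \<in> \<T> \<Longrightarrow> y \<in> bdry T \<longleftrightarrow> y \<in> corners T"
  using corner_in_bdry node_is_corner bdry_subset_pts by blast

lemma patchI:
  assumes "T \<in> \<T>" "y \<in> corners T" "x \<in> pts T"
  shows "x \<in> patch \<T> y"
  using corner_in_bdry[OF assms(1,2)] assms unfolding patch_def by blast

lemma corners_nonempty:
  assumes "T \<in> \<T>" shows "corners T \<noteq> {}"
proof -
  have "fst T \<noteq> {}" using curvilinear_simplexD(2)[OF element[OF assms]] by auto
  then show ?thesis by (simp add: corners_def)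
qed

lemma common_corner:
  assumes T: "T \<in> \<T>" "T' \<in> \<T>" and ne: "pts T \<inter> pts T' \<noteq> {}"
  shows "\<exists>y. y \<in> corners T \<and> y \<in> corners T'"
proof (cases "T = T'")
  case True
  then show ?thesis using corners_nonempty[OF T(1)] by blast
next
  case False
  obtain A A' where A: "A \<subset> fst T" "A' \<subset> fst T'" "snd T ` A = snd T' ` A'"
    "pts T \<inter> pts T' = snd T ` (convex hull A)" "pts T \<inter> pts T' = snd T' ` (convex hull A')"
    using conforming[OF T False] by (elim exE conjE) (rule that)
  have "A \<noteq> {}"
  proof
    assume "A = {}"
    then show False using A(4) ne by simp
  qed
  then obtain a where a: "a \<in> A" by blast
  have "snd T a \<in> corners T" using a A(1) unfolding corners_def by blast
  moreover have "snd T a \<in> snd T' ` A'" using a A(3) by blast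
  then have "snd T a \<in> corners T'" using A(2) unfolding corners_def by blast
  ultimately show ?thesis by blast
qed

text \<open>A connected set joining \<open>p\<close> to an element that misses \<open>p\<close> has to cross a face that misses \<open>p\<close>
  of some element containing \<open>p\<close>.\<close>
lemma star_lemma:
  assumes p: "p \<in> \<Gamma>" and T': "T' \<in> \<T>" "s \<in> pts T'" and close: "G * dist p s < \<delta>"
    and far: "\<And>T A z. T \<in> \<T> \<Longrightarrow> p \<in> pts T \<Longrightarrow> A \<subseteq> fst T \<Longrightarrow> p \<notin> snd T ` (convex hull A) \<Longrightarrow>
      z \<in> snd T ` (convex hull A) \<Longrightarrow> \<delta> \<le> dist p z"
  shows "p \<in> pts T'"
proof (rule ccontr)
  assume np: "p \<notin> pts T'"
  have s: "s \<in> \<Gamma>" using T' pts_subset by blast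
  obtain K where K: "connected K" "K \<subseteq> \<Gamma>" "p \<in> K" "s \<in> K" "\<forall>z\<in>K. dist p z \<le> G * dist p s"
    using connection[OF p s] by blast
  \<comment> \<open>The elements containing \<open>p\<close> and those missing it form two closed
    sets that cover \<open>K\<close> and both meet it, so connectedness provides a common point. It
    lies in a face that misses \<open>p\<close>, as one of its two elements does.\<close>
  define S1 where "S1 = (\<Union>T\<in>{T\<in>\<T>. p \<in> pts T}. pts T)"
  define S2 where "S2 = (\<Union>T\<in>{T\<in>\<T>. p \<notin> pts T}. pts T)"
  have "closed S1" "closed S2"
    unfolding S1_def S2_def using finite_mesh closed_pts by (auto intro!: closed_UN)
  moreover have "K \<subseteq> S1 \<union> S2"
    using K(2) union_pts unfolding S1_def S2_def by blast
  moreover have "S1 \<inter> K \<noteq> {}"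
    using p K(3) union_pts unfolding S1_def by blast
  moreover have "S2 \<inter> K \<noteq> {}"
    using T' np K(4) unfolding S2_def by blast
  ultimately have "S1 \<inter> S2 \<inter> K \<noteq> {}"
    using connected_closedD[OF K(1)] by blast
  then obtain z T1 T2 where z: "z \<in> K" "z \<in> pts T1" "z \<in> pts T2"
    and T1: "T1 \<in> \<T>" "p \<in> pts T1" and T2: "T2 \<in> \<T>" "p \<notin> pts T2"
    unfolding S1_def S2_def by blast
  then have neq: "T1 \<noteq> T2" by blast
  obtain A where A: "A \<subset> fst T1" "pts T1 \<inter> pts T2 = snd T1 ` (convex hull A)"
    using conforming[OF T1(1) T2(1) neq] by (elim exE conjE) (rule that)
  have "\<delta> \<le> dist p z"
    using A T1 T2 z by (intro far[of T1 A]) blast+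
  then show False using K(5) z(1) close by fastforce
qed

text \<open>Every face that misses a corner lies in the opposite face, so the distance estimate
  applies with the full weight \<open>1\<close>.\<close>

lemma node_star:
  assumes y: "y \<in> nodes \<T>" and T': "T' \<in> \<T>" "s \<in> pts T'" and close: "G * dist y s < c1 * h"
  shows "y \<in> pts T'"
proof (rule star_lemma[OF _ T' close])
  show "y \<in> \<Gamma>" using y nodes_subset by blast
  fix T A z
  assume T: "T \<in> \<T>" "y \<in> pts T" and A: "A \<subseteq> fst T" "y \<notin> snd T ` (convex hull A)"
    and z: "z \<in> snd T ` (convex hull A)"
  obtain v where v: "v \<in> fst T" "y = snd T v"
    using node_is_corner[OF y T] by (auto simp: corners_def)
  obtain x' where x': "x' \<in> convex hull A" "z = snd T x'" using z by blast
  have "v \<notin> A" using A(2) v(2) hull_inc by (metis imageI)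
  then have "A \<subseteq> fst T - {v}" using A(1) by blast
  then have "x' \<in> convex hull (fst T - {v})" using x'(1) hull_mono by blast
  from face_distance[OF T(1) v(1) _ _ this this, of 1]
  show "c1 * h \<le> dist y z" using v(2) x'(2) by simp
qed

text \<open>\<open>c1 / (2 * G * L\<^sup>2 * q)\<close> bounds from below the weight of one end of
  an edge at points that keep distance \<open>c1 * h / (2 * G)\<close> from the other end. The
  second factor \<open>c1\<close> comes from the height estimate.\<close>

definition c2 :: real where "c2 = c1\<^sup>2 / (2 * G * L\<^sup>2 * q)"

text \<open>A curve from \<open>t\<close> to \<open>s\<close> leads to a point within
  \<open>2 * G * dist t s\<close> of \<open>s\<close>, and the star argument costs another
  \<open>G\<close>: hence \<open>2 * G\<^sup>2\<close> for edges. Near a node half of the scale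
  \<open>c1 * h\<close> is already spent, hence \<open>4 * G\<^sup>2\<close>.\<close>

definition sep :: real where "sep = min (c1 / (4 * G\<^sup>2)) (c2 / (2 * G\<^sup>2))"

lemma sep_pos: "sep > 0"
  using c1_pos params by (simp add: sep_def c2_def)

text \<open>The edge has length at most of order \<open>h\<close>, so distance of order
  \<open>h\<close> from \<open>b'\<close> forces a weight of \<open>b\<close> that is bounded below,
  and this weight controls the distance to every face without \<open>b\<close>.\<close>

lemma edge_point_far:
  assumes T: "T \<in> \<T>" and b: "b \<in> fst T" "b' \<in> fst T" "b \<noteq> b'" and a: "0 \<le> a" "a \<le> 1"
    and p: "p = snd T ((1 - a) *\<^sub>R b' + a *\<^sub>R b)"
    and far: "c1 * h / (2 * G) \<le> dist p (snd T b')"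
    and A: "A \<subseteq> fst T" "b \<notin> A" and z: "z \<in> snd T ` (convex hull A)"
  shows "c2 * h \<le> dist p z"
proof -
  note el = curvilinear_simplexD[OF element[OF T]]
  obtain x' where x': "x' \<in> convex hull A" "z = snd T x'" using z by blast
  have "A \<subseteq> fst T - {b}" using A by blast
  then have x'2: "x' \<in> convex hull (fst T - {b})" using x'(1) hull_mono by blast
  have b'2: "b' \<in> convex hull (fst T - {b})" using b by (auto intro: hull_inc)
  have bT: "b \<in> convex hull (fst T)" "b' \<in> convex hull (fst T)" using b by (auto intro: hull_inc)
  have 1: "a * (c1 * h) \<le> dist p z"
    using face_distance[OF T b(1) a b'2 x'2] p x'(2) by simp
  have xT: "(1 - a) *\<^sub>R b' + a *\<^sub>R b \<in> convex hull (fst T)"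
    using a bT by (intro convexD[OF convex_convex_hull]) auto
  have "(1 - a) *\<^sub>R b' + a *\<^sub>R b - b' = a *\<^sub>R (b - b')" by (simp add: algebra_simps)
  then have "dist ((1 - a) *\<^sub>R b' + a *\<^sub>R b) b' = a * dist b b'"
    using a by (simp add: dist_norm)
  then have "dist p (snd T b') \<le> L * (a * dist b b')"
    using el(4)[OF xT bT(2)] p by simp
  also have "dist b b' \<le> L * dist (snd T b) (snd T b')" by (rule el(5)[OF bT])
  also have "dist (snd T b) (snd T b') \<le> q * h"
    using dist_element_le[OF T] bT unfolding pts_def by blast
  finally have "dist p (snd T b') \<le> L * (a * (L * (q * h)))"
    using params a by (simp add: mult_left_mono)
  then have "c1 * h / (2 * G) \<le> L * (a * (L * (q * h)))" using far by linarith
  then have "c1 / (2 * G * L\<^sup>2 * q) \<le> a"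
    using params by (simp add: field_simps power2_eq_square)
  then have "c1 / (2 * G * L\<^sup>2 * q) * (c1 * h) \<le> a * (c1 * h)"
    using c1_pos params by (intro mult_right_mono) auto
  moreover have "c1 / (2 * G * L\<^sup>2 * q) * (c1 * h) = c2 * h"
    by (simp add: c2_def power2_eq_square)
  ultimately show ?thesis using 1 by linarith
qed

text \<open>A short curve from \<open>t\<close> to \<open>s\<close> leaves \<open>T\<close> at a
  point \<open>p\<close> shared with another element. If a node is close to \<open>p\<close>, it
  belongs to both \<open>T\<close> and \<open>T'\<close>. Otherwise \<open>p\<close> lies on an edge
  away from its ends, and then \<open>T'\<close> contains \<open>p\<close>. Both contradict
  disjointness. For \<open>n = 2\<close> a shared point is itself a node.\<close>

lemma separation:
  assumes T: "T \<in> \<T>" "t \<in> pts T" and T': "T' \<in> \<T>" "s \<in> pts T'" and disj: "pts T \<inter> pts T' = {}"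
  shows "sep * h \<le> dist t s"
proof (rule ccontr)
  assume "\<not> sep * h \<le> dist t s"
  then have d: "dist t s < sep * h" by simp
  have s1: "sep * h \<le> c1 / (4 * G\<^sup>2) * h"
    using params by (intro mult_right_mono) (simp_all add: sep_def)
  have s2: "sep * h \<le> c2 / (2 * G\<^sup>2) * h"
    using params by (intro mult_right_mono) (simp_all add: sep_def)
  have "dist t s < c1 / (4 * G\<^sup>2) * h" "dist t s < c2 / (2 * G\<^sup>2) * h"
    by (rule order.strict_trans2[OF d s1], rule order.strict_trans2[OF d s2])
  then have d1: "4 * G\<^sup>2 * dist t s < c1 * h" and d2: "2 * G\<^sup>2 * dist t s < c2 * h"
    using params by (simp_all add: field_simps)
  have t\<Gamma>: "t \<in> \<Gamma>" and s\<Gamma>: "s \<in> \<Gamma>" using T T' pts_subset by blast+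
  obtain K where K: "connected K" "K \<subseteq> \<Gamma>" "t \<in> K" "s \<in> K" "\<forall>z\<in>K. dist t z \<le> G * dist t s"
    using connection[OF t\<Gamma> s\<Gamma>] by blast
  define S2 where "S2 = (\<Union>T'\<in>\<T> - {T}. pts T')"
  have "closed S2" unfolding S2_def using finite_mesh closed_pts by (auto intro!: closed_UN)
  moreover have "K \<subseteq> pts T \<union> S2" using K(2) union_pts unfolding S2_def by blast
  moreover have "pts T \<inter> K \<noteq> {}" using T K(3) by blast
  moreover have "S2 \<inter> K \<noteq> {}" using T' K(4) disj T(2) unfolding S2_def by blast
  ultimately have "pts T \<inter> S2 \<inter> K \<noteq> {}"
    using connected_closedD[OF K(1)] closed_pts[OF T(1)] by blast
  then obtain p T1 where p: "p \<in> K" "p \<in> pts T" "p \<in> pts T1" and T1: "T1 \<in> \<T>" "T1 \<noteq> T"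
    unfolding S2_def by blast
  have "dist t p \<le> G * dist t s" using K(5) p(1) by blast
  moreover have "dist t s \<le> G * dist t s" using params mult_right_mono[of 1 G "dist t s"] by simp
  ultimately have ps: "dist p s \<le> 2 * G * dist t s"
    using dist_triangle[of p s t] by (simp add: dist_commute)
  then have Gps: "G * dist p s \<le> 2 * G\<^sup>2 * dist t s"
    using params mult_left_mono[OF ps, of G] by (simp add: power2_eq_square)
  \<comment> \<open>The threshold uses up half of the scale \<open>c1 * h\<close> of nodes, after
    the factor \<open>G\<close>; the other half is left for the way from \<open>p\<close> to
    \<open>s\<close>.\<close>
  show False
  proof (cases "\<exists>y\<in>nodes \<T>. dist p y < c1 * h / (2 * G)")
    case True
    then obtain y where y: "y \<in> nodes \<T>" "dist p y < c1 * h / (2 * G)" by blast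
    then have py: "G * dist y p < c1 * h / 2"
      using params by (simp add: field_simps dist_commute)
    have pos: "c1 * h > 0" using c1_pos params by simp
    have "y \<in> pts T" using py pos by (intro node_star[OF y(1) T(1) p(2)]) linarith
    moreover have "G * dist y s \<le> G * dist y p + G * dist p s"
      using mult_left_mono[OF dist_triangle[of y s p], of G] params by (simp add: distrib_left)
    then have "G * dist y s < c1 * h" using py Gps d1 by linarith
    then have "y \<in> pts T'" by (rule node_star[OF y(1) T'])
    ultimately show False using disj by blast
  next
    case False
    then have far: "\<And>y. y \<in> nodes \<T> \<Longrightarrow> c1 * h / (2 * G) \<le> dist p y" by force
    have c1G: "c1 * h / (2 * G) > 0" using c1_pos params by simp
    have "p \<in> pts T'"
    proof (rule star_lemma[OF _ T'])
      show "p \<in> \<Gamma>" using p K(2) by blast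
      show "G * dist p s < c2 * h" using Gps d2 by linarith
    next
      fix K A z
      assume K: "K \<in> \<T>" "p \<in> pts K" and A: "A \<subseteq> fst K" "p \<notin> snd K ` (convex hull A)"
        and z: "z \<in> snd K ` (convex hull A)"
      note el = curvilinear_simplexD[OF element[OF K(1)]]
      \<comment> \<open>Whichever element contains \<open>p\<close>, at least one of
        \<open>T\<close> and \<open>T1\<close> is a different element containing it.\<close>
      obtain K2 where K2: "K2 \<in> \<T>" "p \<in> pts K2" "K \<noteq> K2"
        using T T1 p by (cases "K = T") blast+
      obtain B where B: "B \<subset> fst K" "pts K \<inter> pts K2 = snd K ` (convex hull B)"
        using conforming[OF K(1) K2(1) K2(3)] by (elim exE conjE) (rule that)
      have "p \<in> snd K ` (convex hull B)" using B(2) K(2) K2(2) by blast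
      then obtain x where x: "x \<in> convex hull B" "p = snd K x" by blast
      have finB: "finite B" using B(1) el(3) finite_subset by blast
      \<comment> \<open>A proper face has at most \<open>n - 1 \<le> 2\<close> corners. As
        \<open>p\<close> lies in it without being a node, the face is an edge. A face
        \<open>A\<close> that misses \<open>p\<close> must then miss an end of this edge.\<close>
      have "card B < CARD('n)" using psubset_card_mono[OF el(3) B(1)] el(2) by simp
      then have cB: "card B \<le> 2" using dim by auto
      have corner: "snd K b \<in> nodes \<T>" if "b \<in> B" for b
        using corners_subset_nodes[OF K(1)] that B(1) unfolding corners_def by blast
      have not_corner: "p \<noteq> snd K b" if "b \<in> B" for b
        using far[OF corner[OF that]] c1G by auto
      have "B \<noteq> {}"
      proof
        assume "B = {}"
        then show False using x(1) by simp
      qed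
      then obtain b1 where b1: "b1 \<in> B" by blast
      have "B \<noteq> {b1}"
      proof
        assume "B = {b1}"
        then have "x = b1" using x(1) by simp
        then show False using not_corner[OF b1] x(2) by simp
      qed
      then obtain b2 where b2: "b2 \<in> B" "b2 \<noteq> b1" using b1 by blast
      have "card {b1, b2} = 2" using b2 by simp
      then have "{b1, b2} = B"
        using b1 b2 cB finB by (intro card_seteq) auto
      then have "x \<in> closed_segment b1 b2" using x(1) by (simp add: segment_convex_hull)
      then obtain a where a: "0 \<le> a" "a \<le> 1" "x = (1 - a) *\<^sub>R b1 + a *\<^sub>R b2"
        by (auto simp: in_segment)
      have bK: "b1 \<in> fst K" "b2 \<in> fst K" using b1 b2 B(1) by blast+
      have "b1 \<notin> A \<or> b2 \<notin> A"
      proof (rule ccontr)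
        assume "\<not> (b1 \<notin> A \<or> b2 \<notin> A)"
        then have "b1 \<in> convex hull A" "b2 \<in> convex hull A" by (auto intro: hull_inc)
        then have "x \<in> convex hull A"
          unfolding a(3) using a(1,2) by (intro convexD[OF convex_convex_hull]) auto
        then show False using A(2) x(2) by blast
      qed
      then show "c2 * h \<le> dist p z"
      proof
        assume "b2 \<notin> A"
        then show ?thesis
          using far[OF corner[OF b1]] a x(2) bK b2(2) A(1) z
          by (intro edge_point_far[OF K(1) bK(2,1) _ a(1,2)]) auto
      next
        assume "b1 \<notin> A"
        moreover have "p = snd K ((1 - (1 - a)) *\<^sub>R b2 + (1 - a) *\<^sub>R b1)"
          using x(2) a(3) by (simp add: add.commute)
        ultimately show ?thesis
          using far[OF corner[OF b2(1)]] a(1,2) b2(2) A(1) z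
          by (intro edge_point_far[OF K(1) bK(1,2), where a = "1 - a"]) auto
      qed
    qed
    then show False using disj p(2) by blast
  qed
qed

text \<open>Elements through the two points either meet, and then share a corner, or are disjoint
  and separated. This is the alternative along which the double integral is split.\<close>

lemma near_or_far:
  assumes "t \<in> \<Gamma>" "s \<in> \<Gamma>"
  shows "(\<exists>y\<in>nodes \<T>. t \<in> patch \<T> y \<and> s \<in> patch \<T> y) \<or> sep * h \<le> dist t s"
proof -
  obtain T T' where T: "T \<in> \<T>" "t \<in> pts T" "T' \<in> \<T>" "s \<in> pts T'"
    using assms union_pts by blast
  show ?thesis
  proof (cases "pts T \<inter> pts T' = {}")
    case True
    then show ?thesis using separation T by blast
  next
    case False
    then obtain y where "y \<in> corners T" "y \<in> corners T'" using common_corner T by blast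
    then show ?thesis using patchI corners_subset_nodes T by blast
  qed
qed

end

section \<open>Integral estimates\<close>

text \<open>The complement of the support is a union of open sets on which \<open>f\<close> vanishes
  almost everywhere; a countable basis leaves only countably many null sets to be collected.\<close>

lemma AE_ess_supp:
  fixes f :: "real^'n::finite \<Rightarrow> real"
  shows "AE s in surface_measure \<Gamma>. s \<notin> ess_supp \<Gamma> f \<longrightarrow> f s = 0"
proof -
  obtain B :: "(real^'n) set set" where B: "countable B" "topological_basis B"
    using ex_countable_basis by blast
  define B' where "B' = {b \<in> B. AE s in surface_measure \<Gamma>. s \<in> b \<longrightarrow> f s = 0}"
  have "countable B'" using B(1) by (simp add: B'_def)
  then have "AE s in surface_measure \<Gamma>. \<forall>b\<in>B'. s \<in> b \<longrightarrow> f s = 0"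
    by (subst AE_ball_countable) (auto simp: B'_def)
  moreover have "AE s in surface_measure \<Gamma>. s \<in> \<Gamma>"
    using AE_space[of "surface_measure \<Gamma>"] by simp
  ultimately show ?thesis
  proof eventually_elim
    fix s assume s: "\<forall>b\<in>B'. s \<in> b \<longrightarrow> f s = 0" "s \<in> \<Gamma>"
    show "s \<notin> ess_supp \<Gamma> f \<longrightarrow> f s = 0"
    proof
      assume "s \<notin> ess_supp \<Gamma> f"
      then obtain U where U: "open U" "s \<in> U" "AE x in surface_measure \<Gamma>. x \<in> U \<longrightarrow> f x = 0"
        using s(2) by (auto simp: ess_supp_def)
      obtain b where b: "b \<in> B" "s \<in> b" "b \<subseteq> U"
        using topological_basisE[OF B(2) U(1,2)] by blast
      have "AE x in surface_measure \<Gamma>. x \<in> b \<longrightarrow> f x = 0"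
        using U(3) by eventually_elim (use b(3) in auto)
      then have "b \<in> B'" using b(1) by (simp add: B'_def)
      then show "f s = 0" using s(1) b(2) by blast
    qed
  qed
qed

locale measured_surface_mesh = surface_mesh \<Gamma> L q \<kappa> G L0 H0 D0 h \<T>
  for \<Gamma> :: "(real^'n::finite) set" and L q \<kappa> G L0 H0 D0 h :: real and \<T> :: "'n simp set" +
  fixes K1 :: real
  assumes K1: "K1 > 0"
    and ball_bound: "\<And>t r. r > 0 \<Longrightarrow>
      emeasure (surface_measure \<Gamma>) (\<Gamma> \<inter> ball t r) \<le> ennreal (K1 * r ^ (CARD('n) - 1))"
begin

section \<open>Measurability and finiteness of the surface measure\<close>

abbreviation \<mu> :: "(real^'n) measure" where "\<mu> \<equiv> surface_measure \<Gamma>"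

lemma closed_surface: "closed \<Gamma>"
proof -
  have "closed (\<Union>T\<in>\<T>. pts T)"
    using finite_mesh closed_pts by (intro closed_UN) auto
  then show ?thesis by (simp add: union_pts)
qed

lemma in_sets_mu: "A \<in> sets borel \<Longrightarrow> A \<subseteq> \<Gamma> \<Longrightarrow> A \<in> sets \<mu>"
  using closed_surface by (subst sets_surface_measure, subst sets_restrict_space_iff) (auto intro: borel_closed)

lemma borel_measurable_mu:
  assumes "f \<in> measurable borel N" shows "f \<in> measurable \<mu> N"
  using measurable_restrict_space1[OF assms, of \<Gamma>] measurable_cong_sets[OF sets_surface_measure refl] by blast

lemma measurable_ident_mu [measurable]: "(\<lambda>x. x) \<in> measurable \<mu> borel"
  by (rule borel_measurable_mu) simp

lemma measurable_fst_mu [measurable]: "fst \<in> measurable (\<mu> \<Otimes>\<^sub>M \<mu>) borel"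
  using measurable_compose[OF measurable_fst measurable_ident_mu] by simp

lemma measurable_snd_mu [measurable]: "snd \<in> measurable (\<mu> \<Otimes>\<^sub>M \<mu>) borel"
  using measurable_compose[OF measurable_snd measurable_ident_mu] by simp

lemma finite_measure_mu: "finite_measure \<mu>"
proof (cases "\<Gamma> = {}")
  case True
  then show ?thesis by (intro finite_measureI) simp
next
  case False
  then obtain x where x: "x \<in> \<Gamma>" by blast
  have "\<Gamma> \<inter> ball x (D0 + 1) = \<Gamma>"
    using diameter_surface[OF x] by fastforce
  then have "emeasure \<mu> \<Gamma> \<le> ennreal (K1 * (D0 + 1) ^ (CARD('n) - 1))"
    using ball_bound[of "D0 + 1" x] params by simp
  then show ?thesis by (intro finite_measureI) (auto simp: top_unique)
qed

lemma sigma_finite_mu: "sigma_finite_measure \<mu>"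
  using finite_measure_mu by (rule finite_measure.axioms)

lemma patch_subset: "patch \<T> y \<subseteq> \<Gamma>"
  unfolding patch_def using pts_subset by blast

lemma closed_patch: "closed (patch \<T> y)"
  unfolding patch_def using finite_mesh closed_pts by (intro closed_UN) auto

lemma patch_sets [measurable]: "patch \<T> y \<in> sets borel"
  using closed_patch by (rule borel_closed)

lemma patch_sets_mu [measurable]: "patch \<T> y \<in> sets \<mu>"
  using patch_sets patch_subset by (rule in_sets_mu)

lemma finite_nodes: "finite (nodes \<T>)"
  unfolding nodes_def corners_def
  using finite_mesh curvilinear_simplexD(3)[OF element] by blast

lemma union_patches: "\<Gamma> = (\<Union>y\<in>nodes \<T>. patch \<T> y)"
proof
  show "\<Gamma> \<subseteq> (\<Union>y\<in>nodes \<T>. patch \<T> y)"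
  proof
    fix x assume "x \<in> \<Gamma>"
    then obtain T where T: "T \<in> \<T>" "x \<in> pts T" using union_pts by blast
    then obtain y where "y \<in> corners T" using corners_nonempty by blast
    then show "x \<in> (\<Union>y\<in>nodes \<T>. patch \<T> y)"
      using patchI[OF T(1) _ T(2)] corners_subset_nodes[OF T(1)] by blast
  qed
qed (use patch_subset in blast)

lemma patch_diameter:
  assumes "t \<in> patch \<T> y" "s \<in> patch \<T> y"
  shows "dist t s \<le> 2 * q * h"
proof -
  obtain T T' where T: "T \<in> \<T>" "y \<in> bdry T" "t \<in> pts T" "T' \<in> \<T>" "y \<in> bdry T'" "s \<in> pts T'"
    using assms by (auto simp: patch_def)
  have "dist t y \<le> q * h" "dist y s \<le> q * h"
    using T bdry_subset_pts dist_element_le by blast+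
  then show ?thesis using dist_triangle[of t s y] by simp
qed

text \<open>On the dyadic shell between \<open>2 ^ j * \<rho>\<close> and
  \<open>2 ^ Suc j * \<rho>\<close> the kernel is at most \<open>c j\<close>, and the surrounding
  ball of radius \<open>R j\<close> has measure at most \<open>K1 * R j ^ (n - 1)\<close>. The
  products form a geometric series of ratio \<open>1 / 2\<close> with first term of order
  \<open>1 / \<rho>\<close>.\<close>

lemma kernel_tail:
  assumes \<rho>: "\<rho> > 0"
  shows "(\<integral>\<^sup>+ s. ennreal (1 / norm (t - s) ^ CARD('n)) * indicator {s. \<rho> \<le> dist t s} s \<partial>\<mu>)
    \<le> ennreal (K1 * 2 ^ CARD('n) / \<rho>)"
proof -
  let ?n = "CARD('n)"
  define c where "c j = 1 / (2 ^ j * \<rho>) ^ ?n" for j :: nat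
  define R where "R j = 2 ^ Suc j * \<rho>" for j :: nat
  have c0: "c j \<ge> 0" for j using \<rho> by (simp add: c_def)
  have R0: "R j > 0" for j using \<rho> by (simp add: R_def)
  have [measurable]: "ball t (R j) \<in> sets borel" for j by simp
  \<comment> \<open>Full balls replace the shells: an upper bound is enough, and balls are what the
    measure bound covers.\<close>
  have pw: "ennreal (1 / norm (t - s) ^ ?n) * indicator {s. \<rho> \<le> dist t s} s
      \<le> (\<Sum>j. ennreal (c j) * indicator (ball t (R j)) s)" for s
  proof (cases "\<rho> \<le> dist t s")
    case True
    obtain N :: nat where "dist t s / \<rho> < 2 ^ N"
      using real_arch_pow[of 2 "dist t s / \<rho>"] by auto
    then have "dist t s < 2 ^ N * \<rho>" using \<rho> by (simp add: field_simps)
    moreover have "\<not> dist t s < 2 ^ 0 * \<rho>" using True by simp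
    ultimately obtain j where j: "\<forall>i\<le>j. \<not> dist t s < 2 ^ i * \<rho>" "dist t s < 2 ^ Suc j * \<rho>"
      using ex_least_nat_less[of "\<lambda>j. dist t s < 2 ^ j * \<rho>" N] by blast
    have pos: "0 < 2 ^ j * \<rho>" using \<rho> by simp
    have le: "2 ^ j * \<rho> \<le> norm (t - s)" using j(1) by (auto simp: dist_norm)
    then have "(2 ^ j * \<rho>) ^ ?n \<le> norm (t - s) ^ ?n" using \<rho> by (intro power_mono) auto
    then have "1 / norm (t - s) ^ ?n \<le> c j"
      unfolding c_def using less_le_trans[OF pos le] pos \<rho>
      by (intro divide_left_mono mult_pos_pos zero_less_power) simp_all
    then have "ennreal (1 / norm (t - s) ^ ?n) \<le> ennreal (c j) * indicator (ball t (R j)) s"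
      using j(2) by (simp add: R_def ennreal_leI)
    also have "\<dots> = (\<Sum>i\<in>{j}. ennreal (c i) * indicator (ball t (R i)) s)"
      by (simp only: sum.insert finite.emptyI empty_iff not_False_eq_True sum.empty add_0_right)
    also have "\<dots> \<le> (\<Sum>i. ennreal (c i) * indicator (ball t (R i)) s)"
      by (rule sum_le_suminf) auto
    finally show ?thesis using True by simp
  qed simp
  have "(\<integral>\<^sup>+ s. ennreal (1 / norm (t - s) ^ ?n) * indicator {s. \<rho> \<le> dist t s} s \<partial>\<mu>)
      \<le> (\<integral>\<^sup>+ s. (\<Sum>j. ennreal (c j) * indicator (ball t (R j)) s) \<partial>\<mu>)"
    by (intro nn_integral_mono pw)
  also have "\<dots> = (\<Sum>j. \<integral>\<^sup>+ s. ennreal (c j) * indicator (ball t (R j)) s \<partial>\<mu>)"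
    by (rule nn_integral_suminf, rule borel_measurable_mu) measurable
  also have "\<dots> \<le> (\<Sum>j. ennreal (K1 * 2 ^ (?n - 1) / \<rho> * (1 / 2) ^ j))"
  proof (intro suminf_le summableI)
    fix j
    have ms: "ball t (R j) \<inter> space \<mu> \<in> sets \<mu>"
      using closed_surface by (intro in_sets_mu) (auto intro: borel_closed)
    have "(\<integral>\<^sup>+ s. ennreal (c j) * indicator (ball t (R j)) s \<partial>\<mu>)
        = ennreal (c j) * (\<integral>\<^sup>+ s. indicator (ball t (R j)) s \<partial>\<mu>)"
      by (rule nn_integral_cmult, rule borel_measurable_mu) measurable
    also have "(\<integral>\<^sup>+ s. indicator (ball t (R j)) s \<partial>\<mu>) = emeasure \<mu> (\<Gamma> \<inter> ball t (R j))"
      using nn_integral_indicator'[OF ms] by (simp add: Int_commute)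
    also have "ennreal (c j) * \<dots> \<le> ennreal (c j) * ennreal (K1 * R j ^ (?n - 1))"
      by (intro mult_left_mono ball_bound R0) simp
    also have "\<dots> = ennreal (c j * (K1 * R j ^ (?n - 1)))"
      using c0 K1 R0[of j] by (simp add: ennreal_mult)
    also have "c j * (K1 * R j ^ (?n - 1)) = K1 * 2 ^ (?n - 1) / \<rho> * (1 / 2) ^ j"
    proof -
      obtain m where m: "?n = Suc m" using dim by (metis One_nat_def Suc_1 numeral_3_eq_3)
      have "c j * (K1 * R j ^ m) = K1 * 2 ^ m * (2 ^ j * \<rho>) ^ m / (2 ^ j * \<rho>) ^ Suc m"
        unfolding c_def R_def m by (simp add: power_mult_distrib)
      also have "\<dots> = K1 * 2 ^ m / (2 ^ j * \<rho>)"
        using \<rho> by simp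
      finally show ?thesis unfolding m by (simp add: power_one_over field_simps)
    qed
    finally show "(\<integral>\<^sup>+ s. ennreal (c j) * indicator (ball t (R j)) s \<partial>\<mu>)
      \<le> ennreal (K1 * 2 ^ (?n - 1) / \<rho> * (1 / 2) ^ j)" .
  qed
  also have "\<dots> = ennreal (K1 * 2 ^ (?n - 1) / \<rho> * 2)"
  proof (rule suminf_ennreal_eq)
    show "0 \<le> K1 * 2 ^ (?n - 1) / \<rho> * (1 / 2) ^ j" for j using K1 \<rho> by simp
    have "(\<lambda>j. (1 / 2 :: real) ^ j) sums 2" using geometric_sums[of "1/2 :: real"] by simp
    then show "(\<lambda>j. K1 * 2 ^ (?n - 1) / \<rho> * (1 / 2) ^ j) sums (K1 * 2 ^ (?n - 1) / \<rho> * 2)"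
      by (rule sums_mult)
  qed
  also have "K1 * 2 ^ (?n - 1) / \<rho> * 2 = K1 * 2 ^ ?n / \<rho>"
    using power_minus_mult[of ?n "2 :: real"] by (simp add: field_simps)
  finally show ?thesis .
qed

section \<open>Square integrable functions and the estimate on a patch\<close>

lemma L2_integrable:
  assumes "v \<in> L2_space \<Gamma>" shows "integrable \<mu> (\<lambda>s. (v s)\<^sup>2)"
proof -
  have [measurable]: "v \<in> borel_measurable \<mu>" using assms by (simp add: L2_space_def)
  have "(\<integral>\<^sup>+ s. ennreal (norm ((v s)\<^sup>2)) \<partial>\<mu>) = L2_norm_sq \<Gamma> \<Gamma> v"
    unfolding L2_norm_sq_def by (intro nn_integral_cong) simp
  also have "\<dots> < \<infinity>" using assms by (simp add: L2_space_def)
  finally show ?thesis by (intro integrableI_bounded) measurable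
qed

lemma L2_product_integrable:
  assumes "v \<in> L2_space \<Gamma>" "w \<in> L2_space \<Gamma>" shows "integrable \<mu> (\<lambda>s. v s * w s)"
proof (rule Bochner_Integration.integrable_bound[OF Bochner_Integration.integrable_add])
  show "integrable \<mu> (\<lambda>s. (v s)\<^sup>2)" "integrable \<mu> (\<lambda>s. (w s)\<^sup>2)"
    using assms by (auto intro: L2_integrable)
  show "(\<lambda>s. v s * w s) \<in> borel_measurable \<mu>" using assms by (auto simp: L2_space_def)
  show "AE s in \<mu>. norm (v s * w s) \<le> norm ((v s)\<^sup>2 + (w s)\<^sup>2)"
  proof (rule AE_I2)
    fix s
    have "2 * (\<bar>v s\<bar> * \<bar>w s\<bar>) \<le> \<bar>v s\<bar>\<^sup>2 + \<bar>w s\<bar>\<^sup>2"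
      using sum_squares_bound[of "\<bar>v s\<bar>" "\<bar>w s\<bar>"] by (simp add: mult.assoc)
    moreover have "0 \<le> \<bar>v s\<bar> * \<bar>w s\<bar>" by simp
    moreover have "norm (v s * w s) = \<bar>v s\<bar> * \<bar>w s\<bar>" by (simp add: abs_mult)
    moreover have "norm ((v s)\<^sup>2 + (w s)\<^sup>2) = \<bar>v s\<bar>\<^sup>2 + \<bar>w s\<bar>\<^sup>2" by simp
    ultimately show "norm (v s * w s) \<le> norm ((v s)\<^sup>2 + (w s)\<^sup>2)"
      by linarith
  qed
qed

text \<open>Since the measure is finite, constants are square integrable; the product with the
  constant \<open>1\<close> shows that square integrable functions are integrable.\<close>

lemma const_L2: "(\<lambda>_. c) \<in> L2_space \<Gamma>"
proof -
  interpret finite_measure \<mu> by (rule finite_measure_mu)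
  have "L2_norm_sq \<Gamma> \<Gamma> (\<lambda>_. c) = (\<integral>\<^sup>+ s. ennreal (c\<^sup>2) \<partial>\<mu>)"
    unfolding L2_norm_sq_def by (intro nn_integral_cong) simp
  also have "\<dots> < \<infinity>"
  proof -
    have "emeasure \<mu> \<Gamma> < top" using emeasure_finite[of \<Gamma>] by (simp add: less_top[symmetric])
    then show ?thesis by (simp add: ennreal_mult_less_top)
  qed
  finally show ?thesis by (simp add: L2_space_def)
qed

text \<open>A Poincare inequality for the mean weighted by \<open>\<psi>\<close>. With
  \<open>B\<close> of order \<open>h powr ((1 - n) / 2)\<close> the factor on the right is of order
  \<open>h\<close>.\<close>

lemma patch_estimate:
  assumes \<psi>: "\<psi> \<in> L2_space \<Gamma>" and one: "(LINT s|\<mu>. \<psi> s) = 1"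
    and supp: "ess_supp \<Gamma> \<psi> \<subseteq> patch \<T> y" and B: "L2_norm \<Gamma> (patch \<T> y) \<psi> \<le> B"
    and w: "w \<in> L2_space \<Gamma>" and orth: "(LINT s|\<mu>. w s * \<psi> s) = 0"
  shows "L2_norm_sq \<Gamma> (patch \<T> y) w \<le> ennreal ((2 * q * h) ^ CARD('n) * B\<^sup>2) * Hhalf_seminorm_sq \<Gamma> (patch \<T> y) w"
proof -
  let ?\<tau> = "patch \<T> y" and ?n = "CARD('n)"
  interpret sigma_finite_measure \<mu> by (rule sigma_finite_mu)
  have [measurable]: "\<psi> \<in> borel_measurable \<mu>" "w \<in> borel_measurable \<mu>"
    using \<psi> w by (auto simp: L2_space_def)
  have ae: "AE s in \<mu>. s \<notin> ?\<tau> \<longrightarrow> \<psi> s = 0"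
    using AE_ess_supp[of \<Gamma> \<psi>] by eventually_elim (use supp in auto)
  have i\<psi>: "integrable \<mu> \<psi>"
    using L2_product_integrable[OF const_L2[of 1] \<psi>] by simp
  have iw: "integrable \<mu> (\<lambda>s. w s * \<psi> s)" by (rule L2_product_integrable[OF w \<psi>])
  have "L2_norm_sq \<Gamma> ?\<tau> \<psi> \<le> L2_norm_sq \<Gamma> \<Gamma> \<psi>"
    unfolding L2_norm_sq_def using patch_subset[of y]
    by (intro nn_integral_mono) (auto simp: indicator_def)
  also have "\<dots> < \<infinity>" using \<psi> by (simp add: L2_space_def)
  finally have fin: "L2_norm_sq \<Gamma> ?\<tau> \<psi> < \<infinity>" .
  \<comment> \<open>\<open>L2_norm\<close> passes through \<open>enn2real\<close>, which maps
    \<infinity> to \<open>0\<close>; only with the finiteness just shown does a bound on it control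
    the integral.\<close>
  have "L2_norm \<Gamma> ?\<tau> \<psi> \<ge> 0" by (simp add: L2_norm_def)
  then have "(L2_norm \<Gamma> ?\<tau> \<psi>)\<^sup>2 \<le> B\<^sup>2" using B by (intro power_mono)
  then have "enn2real (L2_norm_sq \<Gamma> ?\<tau> \<psi>) \<le> B\<^sup>2" by (simp add: L2_norm_def)
  then have "ennreal (enn2real (L2_norm_sq \<Gamma> ?\<tau> \<psi>)) \<le> ennreal (B\<^sup>2)" by (rule ennreal_leI)
  then have \<psi>B: "L2_norm_sq \<Gamma> ?\<tau> \<psi> \<le> ennreal (B\<^sup>2)" 
    by (simp only: ennreal_enn2real[OF fin[unfolded infinity_ennreal_def]])
  have pw: "ennreal (\<bar>w t\<bar>\<^sup>2) \<le> ennreal ((2 * q * h) ^ ?n * B\<^sup>2) *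
      (\<integral>\<^sup>+ s\<in>?\<tau>. ennreal (\<bar>w t - w s\<bar>\<^sup>2 / norm (t - s) ^ ?n) \<partial>\<mu>)" if t: "t \<in> ?\<tau>" for t
  proof -
    have "(LINT s|\<mu>. w t * \<psi> s - w s * \<psi> s) = w t * 1 - 0"
      using i\<psi> iw one orth by (subst Bochner_Integration.integral_diff) auto
    then have wt: "(LINT s|\<mu>. (w t - w s) * \<psi> s) = w t" by (simp add: left_diff_distrib)
    have int: "integrable \<mu> (\<lambda>s. (w t - w s) * \<psi> s)"
      using i\<psi> iw by (simp add: left_diff_distrib)
    have "ennreal \<bar>w t\<bar> \<le> (\<integral>\<^sup>+ s. ennreal (norm ((w t - w s) * \<psi> s)) \<partial>\<mu>)"
      using integral_norm_bound_ennreal[OF int] wt by simp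
    also have "\<dots> = (\<integral>\<^sup>+ s. (ennreal \<bar>w t - w s\<bar> * indicator ?\<tau> s) * (ennreal \<bar>\<psi> s\<bar> * indicator ?\<tau> s) \<partial>\<mu>)"
      using ae by (intro nn_integral_cong_AE, eventually_elim) (auto simp: indicator_def abs_mult ennreal_mult)
    finally have "(ennreal \<bar>w t\<bar>)\<^sup>2 \<le>
        (\<integral>\<^sup>+ s. (ennreal \<bar>w t - w s\<bar> * indicator ?\<tau> s) * (ennreal \<bar>\<psi> s\<bar> * indicator ?\<tau> s) \<partial>\<mu>)\<^sup>2"
      by (intro power_mono) auto
    also have "\<dots> \<le> (\<integral>\<^sup>+ s. (ennreal \<bar>w t - w s\<bar> * indicator ?\<tau> s)\<^sup>2 \<partial>\<mu>) *
        (\<integral>\<^sup>+ s. (ennreal \<bar>\<psi> s\<bar> * indicator ?\<tau> s)\<^sup>2 \<partial>\<mu>)"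
      by (intro Cauchy_Schwarz_nn_integral) measurable
    also have "(\<integral>\<^sup>+ s. (ennreal \<bar>\<psi> s\<bar> * indicator ?\<tau> s)\<^sup>2 \<partial>\<mu>) = L2_norm_sq \<Gamma> ?\<tau> \<psi>"
      unfolding L2_norm_sq_def
      by (intro nn_integral_cong) (auto simp: indicator_def ennreal_power)
    \<comment> \<open>Distances in the patch are at most \<open>2 * q * h\<close>, so inserting the
      kernel costs only the \<open>n\<close>-th power of that number; at \<open>s = t\<close> both
      sides vanish.\<close>
    also have "(\<integral>\<^sup>+ s. (ennreal \<bar>w t - w s\<bar> * indicator ?\<tau> s)\<^sup>2 \<partial>\<mu>) \<le>
        (\<integral>\<^sup>+ s. ennreal ((2 * q * h) ^ ?n) * (ennreal (\<bar>w t - w s\<bar>\<^sup>2 / norm (t - s) ^ ?n) * indicator ?\<tau> s) \<partial>\<mu>)"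
    proof (rule nn_integral_mono)
      fix s
      show "(ennreal \<bar>w t - w s\<bar> * indicator ?\<tau> s)\<^sup>2 \<le>
        ennreal ((2 * q * h) ^ ?n) * (ennreal (\<bar>w t - w s\<bar>\<^sup>2 / norm (t - s) ^ ?n) * indicator ?\<tau> s)"
      proof (cases "s \<in> ?\<tau> \<and> s \<noteq> t")
        case True
        then have s: "s \<in> ?\<tau>" and pos: "0 < norm (t - s)" by auto
        have "norm (t - s) ^ ?n \<le> (2 * q * h) ^ ?n"
          using patch_diameter[OF t s] by (intro power_mono) (auto simp: dist_norm)
        then have "1 \<le> (2 * q * h) ^ ?n / norm (t - s) ^ ?n" using pos by simp
        then have "\<bar>w t - w s\<bar>\<^sup>2 * 1 \<le> \<bar>w t - w s\<bar>\<^sup>2 * ((2 * q * h) ^ ?n / norm (t - s) ^ ?n)"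
          by (intro mult_left_mono) auto
        then have "ennreal (\<bar>w t - w s\<bar>\<^sup>2) \<le> ennreal ((2 * q * h) ^ ?n * (\<bar>w t - w s\<bar>\<^sup>2 / norm (t - s) ^ ?n))"
          by (intro ennreal_leI) (simp add: mult.commute)
        also have "\<dots> = ennreal ((2 * q * h) ^ ?n) * ennreal (\<bar>w t - w s\<bar>\<^sup>2 / norm (t - s) ^ ?n)"
          using params by (intro ennreal_mult) auto
        finally show ?thesis using s by (simp add: ennreal_power)
      next
        case False
        then have "s \<notin> ?\<tau> \<or> s = t" by blast
        then show ?thesis by (elim disjE) simp_all
      qed
    qed
    also have "\<dots> = ennreal ((2 * q * h) ^ ?n) * (\<integral>\<^sup>+ s\<in>?\<tau>. ennreal (\<bar>w t - w s\<bar>\<^sup>2 / norm (t - s) ^ ?n) \<partial>\<mu>)"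
      by (intro nn_integral_cmult) measurable
    finally have "ennreal (\<bar>w t\<bar>\<^sup>2) \<le> ennreal ((2 * q * h) ^ ?n) *
        (\<integral>\<^sup>+ s\<in>?\<tau>. ennreal (\<bar>w t - w s\<bar>\<^sup>2 / norm (t - s) ^ ?n) \<partial>\<mu>) * L2_norm_sq \<Gamma> ?\<tau> \<psi>"
      by (simp add: ennreal_power mult_right_mono)
    also have "\<dots> \<le> ennreal ((2 * q * h) ^ ?n) *
        (\<integral>\<^sup>+ s\<in>?\<tau>. ennreal (\<bar>w t - w s\<bar>\<^sup>2 / norm (t - s) ^ ?n) \<partial>\<mu>) * ennreal (B\<^sup>2)"
      by (intro mult_left_mono \<psi>B) simp
    also have "\<dots> = ennreal ((2 * q * h) ^ ?n * B\<^sup>2) *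
        (\<integral>\<^sup>+ s\<in>?\<tau>. ennreal (\<bar>w t - w s\<bar>\<^sup>2 / norm (t - s) ^ ?n) \<partial>\<mu>)"
      using params by (simp add: ennreal_mult mult_ac)
    finally show ?thesis .
  qed
  have "L2_norm_sq \<Gamma> ?\<tau> w \<le> (\<integral>\<^sup>+ t. ennreal ((2 * q * h) ^ ?n * B\<^sup>2) *
      ((\<integral>\<^sup>+ s\<in>?\<tau>. ennreal (\<bar>w t - w s\<bar>\<^sup>2 / norm (t - s) ^ ?n) \<partial>\<mu>) * indicator ?\<tau> t) \<partial>\<mu>)"
    unfolding L2_norm_sq_def using pw
    by (intro nn_integral_mono) (auto simp: indicator_def)
  also have "\<dots> = ennreal ((2 * q * h) ^ ?n * B\<^sup>2) * Hhalf_seminorm_sq \<Gamma> ?\<tau> w"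
    unfolding Hhalf_seminorm_sq_def by (intro nn_integral_cmult) measurable
  finally show ?thesis .
qed

text \<open>The common face is proper, so it has at most \<open>n - 1\<close> corners and vanishing
  Hausdorff measure in dimension \<open>n - 1\<close>.\<close>

lemma overlap_null:
  assumes T: "T \<in> \<T>" "T' \<in> \<T>" "T \<noteq> T'"
  shows "AE t in \<mu>. \<not> (t \<in> pts T \<and> t \<in> pts T')"
proof -
  note el = curvilinear_simplexD[OF element[OF T(1)]]
  obtain A where A: "A \<subset> fst T" "pts T \<inter> pts T' = snd T ` (convex hull A)"
    using conforming[OF T] by (elim exE conjE) (rule that)
  have sub: "convex hull A \<subseteq> convex hull (fst T)" using A(1) by (intro hull_mono) blast
  have "card A < CARD('n)" using psubset_card_mono[OF el(3) A(1)] el(2) by simp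
  moreover have "finite A" using A(1) el(3) finite_subset by blast
  ultimately have "hausdorff (CARD('n) - 1) (snd T ` (convex hull A)) = 0"
    using dim params el(4) sub by (intro hausdorff_lipschitz_simplex_null[where L = L]) auto
  moreover have cl: "closed (pts T \<inter> pts T')" using closed_pts T by blast
  moreover have "pts T \<inter> pts T' \<subseteq> \<Gamma>" using pts_subset[OF T(1)] by blast
  ultimately have "emeasure \<mu> (pts T \<inter> pts T') = 0" and "pts T \<inter> pts T' \<in> sets \<mu>"
    using emeasure_surface_measure_le[of \<Gamma> "pts T \<inter> pts T'"] closed_surface A(2)
    by (auto simp: borel_closed intro!: in_sets_mu)
  then have "AE t in \<mu>. t \<notin> pts T \<inter> pts T'"
    by (intro AE_not_in) (auto simp: null_sets_def)
  then show ?thesis by simp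
qed

text \<open>Off the overlaps \<open>t\<close> lies in a single element, only the corners of that
  element have a patch containing \<open>t\<close>, and there are at most \<open>n\<close> of them.
  This is the origin of the constant \<open>1 / n\<close> in the lower estimate.\<close>

lemma AE_patch_count:
  "AE t in \<mu>. (\<Sum>y\<in>nodes \<T>. indicator (patch \<T> y) t :: ennreal) \<le> of_nat (CARD('n))"
proof -
  have "AE t in \<mu>. \<forall>T\<in>\<T>. \<forall>T'\<in>\<T>. T \<noteq> T' \<longrightarrow> \<not> (t \<in> pts T \<and> t \<in> pts T')"
    using finite_mesh overlap_null by (intro AE_finite_allI) (auto intro!: AE_impI)
  moreover have "AE t in \<mu>. t \<in> \<Gamma>" using AE_space[of \<mu>] by simp
  ultimately show ?thesis
  proof eventually_elim
    fix t assume t: "\<forall>T\<in>\<T>. \<forall>T'\<in>\<T>. T \<noteq> T' \<longrightarrow> \<not> (t \<in> pts T \<and> t \<in> pts T')" "t \<in> \<Gamma>"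
    obtain T where T: "T \<in> \<T>" "t \<in> pts T" using t(2) union_pts by blast
    have "{y \<in> nodes \<T>. t \<in> patch \<T> y} \<subseteq> corners T"
    proof
      fix y assume "y \<in> {y \<in> nodes \<T>. t \<in> patch \<T> y}"
      then obtain T' where T': "y \<in> nodes \<T>" "T' \<in> \<T>" "y \<in> bdry T'" "t \<in> pts T'"
        by (auto simp: patch_def)
      then have "T' = T" using t(1) T by blast
      then show "y \<in> corners T" using T' node_in_bdry_iff by blast
    qed
    moreover have "finite (corners T)" "card (corners T) \<le> CARD('n)"
      using curvilinear_simplexD(2,3)[OF element[OF T(1)]] card_image_le[of "fst T" "snd T"]
      by (auto simp: corners_def)
    ultimately have card: "card {y \<in> nodes \<T>. t \<in> patch \<T> y} \<le> CARD('n)"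
      using card_mono le_trans by blast
    have "(\<Sum>y\<in>nodes \<T>. indicator (patch \<T> y) t :: ennreal) = (\<Sum>y\<in>{y \<in> nodes \<T>. t \<in> patch \<T> y}. 1)"
      using finite_nodes by (intro sum.mono_neutral_cong_right) auto
    also have "\<dots> = of_nat (card {y \<in> nodes \<T>. t \<in> patch \<T> y})" by simp
    also have "\<dots> \<le> of_nat (CARD('n))" using card by (simp add: of_nat_mono)
    finally show "(\<Sum>y\<in>nodes \<T>. indicator (patch \<T> y) t :: ennreal) \<le> of_nat (CARD('n))" .
  qed
qed

text \<open>Counting in the outer variable suffices: once the inner integral is enlarged from the
  patch to \<Gamma>, the patches enter only through their multiplicity at \<open>t\<close>.\<close>

lemma sum_patch_seminorms_le:
  assumes w [measurable]: "w \<in> borel_measurable \<mu>"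
  shows "(\<Sum>y\<in>nodes \<T>. Hhalf_seminorm_sq \<Gamma> (patch \<T> y) w) \<le> of_nat (CARD('n)) * Hhalf_seminorm_sq \<Gamma> \<Gamma> w"
proof -
  interpret sigma_finite_measure \<mu> by (rule sigma_finite_mu)
  let ?n = "CARD('n)"
  have \<Gamma>_sets [measurable]: "\<Gamma> \<in> sets borel" using closed_surface by (rule borel_closed)
  define I where "I t = (\<integral>\<^sup>+ s\<in>\<Gamma>. ennreal (\<bar>w t - w s\<bar>\<^sup>2 / norm (t - s) ^ ?n) \<partial>\<mu>)" for t
  have I [measurable]: "I \<in> borel_measurable \<mu>" unfolding I_def by measurable
  have "Hhalf_seminorm_sq \<Gamma> (patch \<T> y) w \<le> (\<integral>\<^sup>+ t. I t * indicator (patch \<T> y) t \<partial>\<mu>)" for y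
    unfolding Hhalf_seminorm_sq_def I_def using patch_subset[of y]
    by (intro nn_integral_mono mult_right_mono) (auto simp: indicator_def)
  then have "(\<Sum>y\<in>nodes \<T>. Hhalf_seminorm_sq \<Gamma> (patch \<T> y) w)
      \<le> (\<Sum>y\<in>nodes \<T>. \<integral>\<^sup>+ t. I t * indicator (patch \<T> y) t \<partial>\<mu>)"
    by (intro sum_mono)
  also have "\<dots> = (\<integral>\<^sup>+ t. (\<Sum>y\<in>nodes \<T>. I t * indicator (patch \<T> y) t) \<partial>\<mu>)"
    by (intro nn_integral_sum[symmetric]) measurable
  also have "\<dots> \<le> (\<integral>\<^sup>+ t. of_nat ?n * I t \<partial>\<mu>)"
  proof (rule nn_integral_mono_AE)
    show "AE t in \<mu>. (\<Sum>y\<in>nodes \<T>. I t * indicator (patch \<T> y) t) \<le> of_nat ?n * I t"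
      using AE_patch_count
    proof eventually_elim
      fix t assume "(\<Sum>y\<in>nodes \<T>. indicator (patch \<T> y) t :: ennreal) \<le> of_nat ?n"
      then have "I t * (\<Sum>y\<in>nodes \<T>. indicator (patch \<T> y) t) \<le> I t * of_nat ?n"
        by (rule mult_left_mono) simp
      then show "(\<Sum>y\<in>nodes \<T>. I t * indicator (patch \<T> y) t) \<le> of_nat ?n * I t"
        by (simp add: sum_distrib_left mult.commute)
    qed
  qed
  also have "\<dots> = of_nat ?n * (\<integral>\<^sup>+ t. I t \<partial>\<mu>)" by (intro nn_integral_cmult) measurable
  also have "(\<integral>\<^sup>+ t. I t \<partial>\<mu>) = Hhalf_seminorm_sq \<Gamma> \<Gamma> w"
    unfolding Hhalf_seminorm_sq_def I_def by (intro nn_integral_cong) simp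
  finally show ?thesis .
qed

text \<open>The constant \<open>4\<close> collects a factor \<open>2\<close> from splitting the
  square of a difference and another from the two variables, which contribute equally because the
  kernel is symmetric.\<close>

lemma seminorm_le_patches_plus_L2:
  assumes w [measurable]: "w \<in> borel_measurable \<mu>"
  shows "Hhalf_seminorm_sq \<Gamma> \<Gamma> w \<le> (\<Sum>y\<in>nodes \<T>. Hhalf_seminorm_sq \<Gamma> (patch \<T> y) w) +
    ennreal (4 * (K1 * 2 ^ CARD('n) / (sep * h))) * L2_norm_sq \<Gamma> \<Gamma> w"
proof -
  interpret sigma_finite_measure \<mu> by (rule sigma_finite_mu)
  interpret pair_sigma_finite \<mu> \<mu> ..
  have [measurable]: "\<Gamma> \<in> sets \<mu>"
    by (rule in_sets_mu[OF borel_closed[OF closed_surface] subset_refl])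
  let ?n = "CARD('n)"
  define \<rho> where "\<rho> = sep * h"
  have \<rho>: "\<rho> > 0" using sep_pos params by (simp add: \<rho>_def)
  define Kf where "Kf = K1 * 2 ^ ?n / \<rho>"
  have Kf: "Kf \<ge> 0" using K1 \<rho> by (simp add: Kf_def)
  define k :: "real^'n \<Rightarrow> real^'n \<Rightarrow> ennreal" where "k t s = ennreal (\<bar>w t - w s\<bar>\<^sup>2 / norm (t - s) ^ ?n)" for t s
  define g :: "real^'n \<Rightarrow> real^'n \<Rightarrow> ennreal" where "g t s = ennreal (1 / norm (t - s) ^ ?n) * indicator {s. \<rho> \<le> dist t s} s" for t s
  \<comment> \<open>A pair is counted once for every common patch, which only enlarges the
    majorant.\<close>
  define N :: "real^'n \<Rightarrow> real^'n \<Rightarrow> ennreal" where "N t s = (\<Sum>y\<in>nodes \<T>. k t s * indicator (patch \<T> y) s * indicator (patch \<T> y) t)" for t s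
  have [measurable]: "(\<lambda>(t, s). k t s) \<in> borel_measurable (\<mu> \<Otimes>\<^sub>M \<mu>)"
    unfolding k_def by measurable
  \<comment> \<open>As a case distinction on the norm the truncated kernel is visibly jointly
    measurable and symmetric.\<close>
  have g_alt: "g = (\<lambda>t s. if \<rho> \<le> norm (t - s) then ennreal (1 / norm (t - s) ^ ?n) else 0)"
    by (auto simp: g_def fun_eq_iff dist_norm)
  have gm [measurable]: "(\<lambda>(t, s). g t s) \<in> borel_measurable (\<mu> \<Otimes>\<^sub>M \<mu>)"
    unfolding g_alt by measurable
  have g_sym: "g t s = g s t" for t s
    unfolding g_alt by (simp add: norm_minus_commute)
  have [measurable]: "(\<lambda>(t, s). N t s) \<in> borel_measurable (\<mu> \<Otimes>\<^sub>M \<mu>)"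
    unfolding N_def by measurable
  have g_int: "(\<integral>\<^sup>+ s. g t s \<partial>\<mu>) \<le> ennreal Kf" for t
    unfolding g_def Kf_def by (rule kernel_tail[OF \<rho>])
  have ennreal_distrib: "ennreal ((a + b) * x) = ennreal a * ennreal x + ennreal b * ennreal x"
    if "0 \<le> a" "0 \<le> b" "0 \<le> x" for a b x :: real
    using that by (simp add: distrib_right ennreal_mult)
  have pw: "k t s \<le> N t s + (ennreal (2 * \<bar>w t\<bar>\<^sup>2) * g t s + ennreal (2 * \<bar>w s\<bar>\<^sup>2) * g t s)"
    if ts: "t \<in> \<Gamma>" "s \<in> \<Gamma>" for t s
    using near_or_far[OF ts]
  proof
    assume "\<exists>y\<in>nodes \<T>. t \<in> patch \<T> y \<and> s \<in> patch \<T> y"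
    then obtain y where y: "y \<in> nodes \<T>" "t \<in> patch \<T> y" "s \<in> patch \<T> y" by blast
    have "k t s = k t s * indicator (patch \<T> y) s * indicator (patch \<T> y) t" using y by simp
    also have "\<dots> \<le> N t s"
      unfolding N_def using y(1) finite_nodes
      by (intro member_le_sum[where f = "\<lambda>y. k t s * indicator (patch \<T> y) s * indicator (patch \<T> y) t"]) auto
    finally show ?thesis by (simp add: add_increasing2)
  next
    assume far: "sep * h \<le> dist t s"
    have "(w t - w s)\<^sup>2 + (w t + w s)\<^sup>2 = 2 * (w t)\<^sup>2 + 2 * (w s)\<^sup>2"
      by (simp add: power2_eq_square algebra_simps)
    then have "\<bar>w t - w s\<bar>\<^sup>2 \<le> 2 * \<bar>w t\<bar>\<^sup>2 + 2 * \<bar>w s\<bar>\<^sup>2"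
      using zero_le_power2[of "w t + w s"] unfolding power2_abs by linarith
    then have "\<bar>w t - w s\<bar>\<^sup>2 / norm (t - s) ^ ?n \<le> (2 * \<bar>w t\<bar>\<^sup>2 + 2 * \<bar>w s\<bar>\<^sup>2) * (1 / norm (t - s) ^ ?n)"
      by (simp add: divide_right_mono)
    then have "k t s \<le> ennreal ((2 * \<bar>w t\<bar>\<^sup>2 + 2 * \<bar>w s\<bar>\<^sup>2) * (1 / norm (t - s) ^ ?n))"
      unfolding k_def by (rule ennreal_leI)
    also have "\<dots> = ennreal (2 * \<bar>w t\<bar>\<^sup>2) * g t s + ennreal (2 * \<bar>w s\<bar>\<^sup>2) * g t s"
      using far unfolding g_def \<rho>_def by (subst ennreal_distrib) auto
    finally show ?thesis by (simp add: add_increasing)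
  qed
  have "Hhalf_seminorm_sq \<Gamma> \<Gamma> w = (\<integral>\<^sup>+ t. (\<integral>\<^sup>+ s. k t s \<partial>\<mu>) \<partial>\<mu>)"
    unfolding Hhalf_seminorm_sq_def k_def
    by (intro nn_integral_cong) (auto intro!: nn_integral_cong)
  also have "\<dots> \<le> (\<integral>\<^sup>+ t. (\<integral>\<^sup>+ s. N t s + (ennreal (2 * \<bar>w t\<bar>\<^sup>2) * g t s + ennreal (2 * \<bar>w s\<bar>\<^sup>2) * g t s) \<partial>\<mu>) \<partial>\<mu>)"
    by (intro nn_integral_mono pw) simp_all
  also have "\<dots> = (\<integral>\<^sup>+ t. (\<integral>\<^sup>+ s. N t s \<partial>\<mu>) + ((\<integral>\<^sup>+ s. ennreal (2 * \<bar>w t\<bar>\<^sup>2) * g t s \<partial>\<mu>) +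
      (\<integral>\<^sup>+ s. ennreal (2 * \<bar>w s\<bar>\<^sup>2) * g t s \<partial>\<mu>)) \<partial>\<mu>)"
  proof (rule nn_integral_cong)
    fix t assume [measurable]: "t \<in> space \<mu>"
    have m: "(\<lambda>s. N t s) \<in> borel_measurable \<mu>" "(\<lambda>s. ennreal (2 * \<bar>w t\<bar>\<^sup>2) * g t s) \<in> borel_measurable \<mu>"
      "(\<lambda>s. ennreal (2 * \<bar>w s\<bar>\<^sup>2) * g t s) \<in> borel_measurable \<mu>"
      "(\<lambda>s. ennreal (2 * \<bar>w t\<bar>\<^sup>2) * g t s + ennreal (2 * \<bar>w s\<bar>\<^sup>2) * g t s) \<in> borel_measurable \<mu>"
      by measurable
    show "(\<integral>\<^sup>+ s. N t s + (ennreal (2 * \<bar>w t\<bar>\<^sup>2) * g t s + ennreal (2 * \<bar>w s\<bar>\<^sup>2) * g t s) \<partial>\<mu>)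
      = (\<integral>\<^sup>+ s. N t s \<partial>\<mu>) + ((\<integral>\<^sup>+ s. ennreal (2 * \<bar>w t\<bar>\<^sup>2) * g t s \<partial>\<mu>) +
      (\<integral>\<^sup>+ s. ennreal (2 * \<bar>w s\<bar>\<^sup>2) * g t s \<partial>\<mu>))"
      by (simp only: nn_integral_add[OF m(1,4)] nn_integral_add[OF m(2,3)])
  qed
  also have "\<dots> = (\<integral>\<^sup>+ t. (\<integral>\<^sup>+ s. N t s \<partial>\<mu>) \<partial>\<mu>) +
      ((\<integral>\<^sup>+ t. (\<integral>\<^sup>+ s. ennreal (2 * \<bar>w t\<bar>\<^sup>2) * g t s \<partial>\<mu>) \<partial>\<mu>) +
       (\<integral>\<^sup>+ t. (\<integral>\<^sup>+ s. ennreal (2 * \<bar>w s\<bar>\<^sup>2) * g t s \<partial>\<mu>) \<partial>\<mu>))"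
  proof -
    have m: "(\<lambda>t. \<integral>\<^sup>+ s. N t s \<partial>\<mu>) \<in> borel_measurable \<mu>"
      "(\<lambda>t. \<integral>\<^sup>+ s. ennreal (2 * \<bar>w t\<bar>\<^sup>2) * g t s \<partial>\<mu>) \<in> borel_measurable \<mu>"
      "(\<lambda>t. \<integral>\<^sup>+ s. ennreal (2 * \<bar>w s\<bar>\<^sup>2) * g t s \<partial>\<mu>) \<in> borel_measurable \<mu>"
      "(\<lambda>t. (\<integral>\<^sup>+ s. ennreal (2 * \<bar>w t\<bar>\<^sup>2) * g t s \<partial>\<mu>) + (\<integral>\<^sup>+ s. ennreal (2 * \<bar>w s\<bar>\<^sup>2) * g t s \<partial>\<mu>))
        \<in> borel_measurable \<mu>"
      by measurable
    show ?thesis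
      by (simp only: nn_integral_add[OF m(1,4)] nn_integral_add[OF m(2,3)])
  qed
  also have "(\<integral>\<^sup>+ t. (\<integral>\<^sup>+ s. N t s \<partial>\<mu>) \<partial>\<mu>) = (\<Sum>y\<in>nodes \<T>. Hhalf_seminorm_sq \<Gamma> (patch \<T> y) w)"
  proof -
    have "(\<integral>\<^sup>+ s. N t s \<partial>\<mu>) = (\<Sum>y\<in>nodes \<T>. (\<integral>\<^sup>+ s. k t s * indicator (patch \<T> y) s \<partial>\<mu>) * indicator (patch \<T> y) t)"
      if "t \<in> space \<mu>" for t
    proof -
      have [measurable]: "t \<in> space \<mu>" by fact
      have "(\<integral>\<^sup>+ s. N t s \<partial>\<mu>)
          = (\<Sum>y\<in>nodes \<T>. \<integral>\<^sup>+ s. k t s * indicator (patch \<T> y) s * indicator (patch \<T> y) t \<partial>\<mu>)"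
        unfolding N_def by (rule nn_integral_sum) measurable
      also have "\<dots> = (\<Sum>y\<in>nodes \<T>. (\<integral>\<^sup>+ s. k t s * indicator (patch \<T> y) s \<partial>\<mu>) * indicator (patch \<T> y) t)"
        by (intro sum.cong refl nn_integral_multc) measurable
      finally show ?thesis .
    qed
    then have "(\<integral>\<^sup>+ t. (\<integral>\<^sup>+ s. N t s \<partial>\<mu>) \<partial>\<mu>) =
        (\<integral>\<^sup>+ t. (\<Sum>y\<in>nodes \<T>. (\<integral>\<^sup>+ s. k t s * indicator (patch \<T> y) s \<partial>\<mu>) * indicator (patch \<T> y) t) \<partial>\<mu>)"
      by (intro nn_integral_cong)
    also have "\<dots> = (\<Sum>y\<in>nodes \<T>. \<integral>\<^sup>+ t. (\<integral>\<^sup>+ s. k t s * indicator (patch \<T> y) s \<partial>\<mu>) * indicator (patch \<T> y) t \<partial>\<mu>)"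
      by (intro nn_integral_sum) measurable
    finally show ?thesis unfolding Hhalf_seminorm_sq_def k_def .
  qed
  also have le1: "(\<integral>\<^sup>+ t. (\<integral>\<^sup>+ s. ennreal (2 * \<bar>w t\<bar>\<^sup>2) * g t s \<partial>\<mu>) \<partial>\<mu>) \<le> ennreal (2 * Kf) * L2_norm_sq \<Gamma> \<Gamma> w"
  proof -
    have "(\<integral>\<^sup>+ t. (\<integral>\<^sup>+ s. ennreal (2 * \<bar>w t\<bar>\<^sup>2) * g t s \<partial>\<mu>) \<partial>\<mu>) \<le>
        (\<integral>\<^sup>+ t. ennreal (2 * Kf) * (ennreal (\<bar>w t\<bar>\<^sup>2) * indicator \<Gamma> t) \<partial>\<mu>)"
    proof (rule nn_integral_mono)
      fix t assume t: "t \<in> space \<mu>"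
      have "(\<integral>\<^sup>+ s. ennreal (2 * \<bar>w t\<bar>\<^sup>2) * g t s \<partial>\<mu>) = ennreal (2 * \<bar>w t\<bar>\<^sup>2) * (\<integral>\<^sup>+ s. g t s \<partial>\<mu>)"
        using t by (intro nn_integral_cmult) measurable
      also have "\<dots> \<le> ennreal (2 * \<bar>w t\<bar>\<^sup>2) * ennreal Kf" by (intro mult_left_mono g_int) simp
      also have "\<dots> = ennreal (2 * Kf) * (ennreal (\<bar>w t\<bar>\<^sup>2) * indicator \<Gamma> t)"
        using t Kf by (simp add: ennreal_mult mult_ac)
      finally show "(\<integral>\<^sup>+ s. ennreal (2 * \<bar>w t\<bar>\<^sup>2) * g t s \<partial>\<mu>) \<le> ennreal (2 * Kf) * (ennreal (\<bar>w t\<bar>\<^sup>2) * indicator \<Gamma> t)" .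
    qed
    also have "\<dots> = ennreal (2 * Kf) * L2_norm_sq \<Gamma> \<Gamma> w"
      unfolding L2_norm_sq_def by (intro nn_integral_cmult) measurable
    finally show ?thesis .
  qed
  \<comment> \<open>Exchanging the order of integration and using the symmetry of \<open>g\<close>
    moves the weight to the outer variable; up to renaming this is the previous integral, so
    \<open>le1\<close> applies again.\<close>
  also have "(\<integral>\<^sup>+ t. (\<integral>\<^sup>+ s. ennreal (2 * \<bar>w s\<bar>\<^sup>2) * g t s \<partial>\<mu>) \<partial>\<mu>)
      = (\<integral>\<^sup>+ s. (\<integral>\<^sup>+ t. ennreal (2 * \<bar>w s\<bar>\<^sup>2) * g s t \<partial>\<mu>) \<partial>\<mu>)"
  proof -
    have "(\<lambda>(t, s). ennreal (2 * \<bar>w s\<bar>\<^sup>2) * g t s) \<in> borel_measurable (\<mu> \<Otimes>\<^sub>M \<mu>)"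
      by measurable
    from Fubini'[OF this] show ?thesis by (simp only: g_sym)
  qed
  also note le1
  finally have "Hhalf_seminorm_sq \<Gamma> \<Gamma> w \<le> (\<Sum>y\<in>nodes \<T>. Hhalf_seminorm_sq \<Gamma> (patch \<T> y) w) +
      (ennreal (2 * Kf) * L2_norm_sq \<Gamma> \<Gamma> w + ennreal (2 * Kf) * L2_norm_sq \<Gamma> \<Gamma> w)"
    by (simp add: add_mono)
  also have "ennreal (2 * Kf) * L2_norm_sq \<Gamma> \<Gamma> w + ennreal (2 * Kf) * L2_norm_sq \<Gamma> \<Gamma> w
      = ennreal (2 * Kf + 2 * Kf) * L2_norm_sq \<Gamma> \<Gamma> w"
    using Kf by (subst ennreal_plus) (auto simp: distrib_right)
  also have "2 * Kf + 2 * Kf = 4 * (K1 * 2 ^ ?n / (sep * h))" by (simp add: Kf_def \<rho>_def)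
  finally show ?thesis .
qed

end

section \<open>Norm equivalence\<close>

context measured_surface_mesh
begin

text \<open>Three terms make up the upper constant: \<open>1\<close> from near pairs,
  \<open>q * D0\<close> from the \<open>L\<^sup>2\<close> part of the norm, where a lone
  \<open>h\<close> survives and is bounded through the diameter of the surface, and the term with
  \<open>sep\<close> from far pairs.\<close>

lemma norm_equivalence:
  assumes C0: "C0 \<ge> 0" and w: "w \<in> Hhalf_space \<Gamma>"
    and \<phi>: "\<And>y. y \<in> nodes \<T> \<Longrightarrow> \<phi> y \<in> L2_space \<Gamma>" "\<And>y. y \<in> nodes \<T> \<Longrightarrow> (LINT s|\<mu>. \<phi> y s) = 1"
    "\<And>y. y \<in> nodes \<T> \<Longrightarrow> ess_supp \<Gamma> (\<phi> y) \<subseteq> patch \<T> y"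
    "\<And>y. y \<in> nodes \<T> \<Longrightarrow> L2_norm \<Gamma> (patch \<T> y) (\<phi> y) \<le> C0 * h powr (1/2 - real CARD('n) / 2)"
    and orth: "\<And>y. y \<in> nodes \<T> \<Longrightarrow> (LINT s|\<mu>. w s * \<phi> y s) = 0"
  shows "ennreal (1 / real CARD('n)) * (\<Sum>y\<in>nodes \<T>. Hhalf_seminorm_sq \<Gamma> (patch \<T> y) w) \<le> Hhalf_norm_sq \<Gamma> \<Gamma> w"
    and "Hhalf_norm_sq \<Gamma> \<Gamma> w \<le> ennreal (1 + (2 * q) ^ CARD('n) * C0\<^sup>2 * (q * D0 + 4 * (K1 * 2 ^ CARD('n) / sep)))
      * (\<Sum>y\<in>nodes \<T>. Hhalf_seminorm_sq \<Gamma> (patch \<T> y) w)"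
proof -
  let ?n = "CARD('n)"
  define S where "S = (\<Sum>y\<in>nodes \<T>. Hhalf_seminorm_sq \<Gamma> (patch \<T> y) w)"
  have wL2: "w \<in> L2_space \<Gamma>" using w by (simp add: Hhalf_space_def)
  then have wm [measurable]: "w \<in> borel_measurable \<mu>" by (simp add: L2_space_def)
  have n0: "real ?n > 0" by simp
  have "ennreal (1 / real ?n) * S \<le> ennreal (1 / real ?n) * (of_nat ?n * Hhalf_seminorm_sq \<Gamma> \<Gamma> w)"
    unfolding S_def by (intro mult_left_mono sum_patch_seminorms_le wm) simp
  also have "\<dots> = ennreal (1 / real ?n * real ?n) * Hhalf_seminorm_sq \<Gamma> \<Gamma> w"
    by (subst ennreal_mult) (simp_all add: ennreal_of_nat_eq_real_of_nat mult.assoc)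
  also have "\<dots> = Hhalf_seminorm_sq \<Gamma> \<Gamma> w" by simp
  also have "\<dots> \<le> Hhalf_norm_sq \<Gamma> \<Gamma> w" unfolding Hhalf_norm_sq_def by simp
  finally show "ennreal (1 / real ?n) * S \<le> Hhalf_norm_sq \<Gamma> \<Gamma> w" .
  define B where "B = C0 * h powr (1/2 - real ?n / 2)"
  define E where "E = (2 * q) ^ ?n * C0\<^sup>2"
  have E: "E \<ge> 0" using params by (simp add: E_def)
  \<comment> \<open>The square of \<open>B\<close> carries \<open>h powr (1 - n)\<close>; against
    the \<open>n\<close>-th power of the patch diameter exactly one \<open>h\<close> is
    left.\<close>
  have "(h powr (1/2 - real ?n / 2))\<^sup>2 = h powr (1 - real ?n)"
    using params by (simp add: power2_eq_square flip: powr_add)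
  also have "\<dots> = h / h ^ ?n"
    using params by (simp add: powr_diff powr_realpow)
  finally have "B\<^sup>2 = C0\<^sup>2 * (h / h ^ ?n)" by (simp add: B_def power_mult_distrib)
  then have Ch: "(2 * q * h) ^ ?n * B\<^sup>2 = E * h"
    using params by (simp add: E_def power_mult_distrib)
  have "L2_norm_sq \<Gamma> \<Gamma> w \<le> (\<integral>\<^sup>+ s. (\<Sum>y\<in>nodes \<T>. ennreal (\<bar>w s\<bar>\<^sup>2) * indicator (patch \<T> y) s) \<partial>\<mu>)"
    unfolding L2_norm_sq_def
  proof (rule nn_integral_mono)
    fix s assume "s \<in> space \<mu>"
    then obtain y where y: "y \<in> nodes \<T>" "s \<in> patch \<T> y" using union_patches by auto
    have "ennreal (\<bar>w s\<bar>\<^sup>2) * indicator \<Gamma> s \<le> ennreal (\<bar>w s\<bar>\<^sup>2) * indicator (patch \<T> y) s"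
      using y(2) by (simp add: indicator_def)
    also have "\<dots> \<le> (\<Sum>y\<in>nodes \<T>. ennreal (\<bar>w s\<bar>\<^sup>2) * indicator (patch \<T> y) s)"
      using y(1) finite_nodes
      by (intro member_le_sum[where f = "\<lambda>y. ennreal (\<bar>w s\<bar>\<^sup>2) * indicator (patch \<T> y) s"]) simp_all
    finally show "ennreal (\<bar>w s\<bar>\<^sup>2) * indicator \<Gamma> s \<le> (\<Sum>y\<in>nodes \<T>. ennreal (\<bar>w s\<bar>\<^sup>2) * indicator (patch \<T> y) s)" .
  qed
  also have "\<dots> = (\<Sum>y\<in>nodes \<T>. L2_norm_sq \<Gamma> (patch \<T> y) w)"
    unfolding L2_norm_sq_def by (rule nn_integral_sum) measurable
  also have "\<dots> \<le> (\<Sum>y\<in>nodes \<T>. ennreal (E * h) * Hhalf_seminorm_sq \<Gamma> (patch \<T> y) w)"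
  proof (rule sum_mono)
    fix y assume y: "y \<in> nodes \<T>"
    show "L2_norm_sq \<Gamma> (patch \<T> y) w \<le> ennreal (E * h) * Hhalf_seminorm_sq \<Gamma> (patch \<T> y) w"
      using patch_estimate[OF \<phi>(1)[OF y] \<phi>(2)[OF y] \<phi>(3)[OF y] \<phi>(4)[OF y] wL2 orth[OF y]]
      unfolding B_def[symmetric] Ch .
  qed
  also have "\<dots> = ennreal (E * h) * S" by (simp add: S_def sum_distrib_left)
  finally have L2: "L2_norm_sq \<Gamma> \<Gamma> w \<le> ennreal (E * h) * S" .
  define F where "F = 4 * (K1 * 2 ^ ?n / (sep * h))"
  have F: "F \<ge> 0" using K1 sep_pos params by (simp add: F_def)
  have "Hhalf_norm_sq \<Gamma> \<Gamma> w \<le> L2_norm_sq \<Gamma> \<Gamma> w + (S + ennreal F * L2_norm_sq \<Gamma> \<Gamma> w)"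
    unfolding Hhalf_norm_sq_def S_def F_def
    by (intro add_left_mono seminorm_le_patches_plus_L2 wm)
  also have "\<dots> \<le> ennreal (E * h) * S + (S + ennreal F * (ennreal (E * h) * S))"
    by (intro add_mono mult_left_mono L2 order_refl) simp
  also have "\<dots> = ennreal (E * h + (1 + F * (E * h))) * S"
  proof -
    have nn: "0 \<le> E * h" "0 \<le> F * (E * h)" using E F params by simp_all
    have "ennreal (E * h + (1 + F * (E * h))) = ennreal (E * h) + (1 + ennreal F * ennreal (E * h))"
      using nn F by (simp add: ennreal_mult)
    then show ?thesis by (simp add: distrib_right mult.assoc)
  qed
  also have "\<dots> \<le> ennreal (1 + (2 * q) ^ ?n * C0\<^sup>2 * (q * D0 + 4 * (K1 * 2 ^ ?n / sep))) * S"
  proof (cases "\<T> = {}")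
    \<comment> \<open>Without elements there is no bound on \<open>h\<close>, but then the sum over
      the nodes is \<open>0\<close>.\<close>
    case True
    then have "S = 0" by (simp add: S_def nodes_def)
    then show ?thesis by simp
  next
    case False
    then have "h \<le> q * D0" using mesh_size_le by blast
    then have "E * h \<le> E * (q * D0)" using E by (intro mult_left_mono)
    moreover have "F * (E * h) = E * (4 * (K1 * 2 ^ ?n / sep))"
      using params sep_pos by (simp add: F_def)
    ultimately have "E * h + (1 + F * (E * h)) \<le> 1 + E * (q * D0 + 4 * (K1 * 2 ^ ?n / sep))"
      by (simp add: distrib_left)
    then show ?thesis unfolding E_def by (intro mult_right_mono ennreal_leI) simp_all
  qed
  finally show "Hhalf_norm_sq \<Gamma> \<Gamma> w \<le>
      ennreal (1 + (2 * q) ^ ?n * C0\<^sup>2 * (q * D0 + 4 * (K1 * 2 ^ ?n / sep))) * S" .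
qed

end

section \<open>Enlarging the mesh constants and the uniform choice of \<open>c\<close> and
  \<open>C\<close>\<close>

lemma quasi_uniform_mono:
  assumes "quasi_uniform q h \<T>" "q \<le> q'" "h > 0" and el: "\<And>T. T \<in> \<T> \<Longrightarrow> curvilinear_simplex L T"
  shows "quasi_uniform q' h \<T>"
  unfolding quasi_uniform_def
proof
  fix T assume T: "T \<in> \<T>"
  have "0 \<le> diameter (pts T)"
    using compact_pts[OF el[OF T]] by (intro diameter_ge_0 compact_imp_bounded)
  then have "q * h \<le> q' * h" "q * diameter (pts T) \<le> q' * diameter (pts T)"
    using assms(2,3) by (auto intro: mult_right_mono)
  then show "diameter (pts T) \<le> q' * h \<and> h \<le> q' * diameter (pts T)"
    using assms(1) T unfolding quasi_uniform_def by fastforce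
qed

lemma shape_regular_mono:
  assumes "shape_regular \<kappa> \<Gamma> \<T>" "\<kappa> \<le> \<kappa>'"
  shows "shape_regular \<kappa>' \<Gamma> \<T>"
  unfolding shape_regular_def
proof
  fix T assume "T \<in> \<T>"
  then obtain x r where *: "x \<in> pts T" "r > 0" "geodesic_ball \<Gamma> x r \<subseteq> pts T" "diameter (pts T) \<le> \<kappa> * (2 * r)"
    using assms(1) unfolding shape_regular_def by blast
  have "\<kappa> * (2 * r) \<le> \<kappa>' * (2 * r)" using assms(2) *(2) by (intro mult_right_mono) auto
  then have "diameter (pts T) \<le> \<kappa>' * (2 * r)" using *(4) by linarith
  then show "\<exists>x\<in>pts T. \<exists>r>0. geodesic_ball \<Gamma> x r \<subseteq> pts T \<and> diameter (pts T) \<le> \<kappa>' * (2 * r)"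
    using * by blast
qed

text \<open>All constants are fixed from the domain and the given parameters before a mesh appears;
  the locale is then interpreted for each single mesh with these same constants.\<close>

theorem theorem3p3:
  fixes \<Omega> \<Gamma> :: "(real^'n::finite) set" and L q \<kappa> c0 C0 :: real
  assumes "CARD('n) = 2 \<or> CARD('n) = 3"
    and "admissible_domain \<Omega>" and "\<Gamma> = frontier \<Omega>"
    and "c0 > 0" and "C0 > 0"
  shows "\<exists>c>0. \<exists>C>0. \<forall>(h::real) (\<T> :: 'n simp set) (\<phi> :: real^'n \<Rightarrow> real^'n \<Rightarrow> real).
    h > 0 \<longrightarrow>
    is_mesh L \<Gamma> \<T> \<longrightarrow> quasi_uniform q h \<T> \<longrightarrow> shape_regular \<kappa> \<Gamma> \<T> \<longrightarrow>
    (\<forall>y \<in> nodes \<T>.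
       \<phi> y \<in> L2_space \<Gamma> \<and>
       (LINT s|surface_measure \<Gamma>. \<phi> y s) = 1 \<and>
       ess_supp \<Gamma> (\<phi> y) \<subseteq> patch \<T> y \<and>
       c0 * h powr (1/2 - real CARD('n) / 2) \<le> L2_norm \<Gamma> (patch \<T> y) (\<phi> y) \<and>
       L2_norm \<Gamma> (patch \<T> y) (\<phi> y) \<le> C0 * h powr (1/2 - real CARD('n) / 2)) \<longrightarrow>
    (\<forall>w \<in> Hhalf_space \<Gamma>.
       (\<forall>y \<in> nodes \<T>. (LINT s|surface_measure \<Gamma>. w s * \<phi> y s) = 0) \<longrightarrow>
       ennreal c * (\<Sum>y \<in> nodes \<T>. Hhalf_seminorm_sq \<Gamma> (patch \<T> y) w) \<le> Hhalf_norm_sq \<Gamma> \<Gamma> w \<and>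
       Hhalf_norm_sq \<Gamma> \<Gamma> w \<le> ennreal C * (\<Sum>y \<in> nodes \<T>. Hhalf_seminorm_sq \<Gamma> (patch \<T> y) w))"
proof -
  have bd: "bounded \<Omega>" and poly: "curvilinear_polytope \<Omega>"
    and geo: "\<exists>C. \<forall>x \<in> frontier \<Omega>. \<forall>y \<in> frontier \<Omega>.
        geodesic_dist (frontier \<Omega>) x y \<le> ennreal (C * dist x y)"
    using assms(2) unfolding admissible_domain_def by simp_all
  obtain C1 where C1: "\<forall>x \<in> \<Gamma>. \<forall>y \<in> \<Gamma>. geodesic_dist \<Gamma> x y \<le> ennreal (C1 * dist x y)"
    using geo unfolding assms(3) by blast
  define G1 where "G1 = max C1 1"
  have geo1: "geodesic_dist \<Gamma> x y \<le> ennreal (G1 * dist x y)" if "x \<in> \<Gamma>" "y \<in> \<Gamma>" for x y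
  proof -
    have "ennreal (C1 * dist x y) \<le> ennreal (G1 * dist x y)"
      by (intro ennreal_leI mult_right_mono) (auto simp: G1_def)
    then show ?thesis using C1 that by (meson order_trans)
  qed
  have G1: "G1 \<ge> 1" by (simp add: G1_def)
  obtain L0 H0 D where pieces: "\<forall>x\<in>\<Gamma>. \<exists>P. curvilinear_simplex L0 P \<and> x \<in> pts P \<and> pts P \<subseteq> \<Gamma> \<and>
      (\<forall>v\<in>fst P. \<forall>z\<in>convex hull (fst P - {v}). H0 \<le> dist v z) \<and>
      (\<forall>y\<in>convex hull (fst P). \<forall>z\<in>convex hull (fst P). dist y z \<le> D)"
    and L0: "L0 \<ge> 1" and H0: "H0 > 0" and D: "D > 0"
    using polytope_pieces[OF poly, folded assms(3)] by (elim exE conjE) (rule that)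
  have "CARD('n) \<ge> 2" using assms(1) by auto
  from surface_measure_ball_bound[OF poly this, folded assms(3)] obtain K1 where K1: "K1 > 0"
    and ball_bound: "\<And>t r. r > 0 \<Longrightarrow>
      emeasure (surface_measure \<Gamma>) (\<Gamma> \<inter> ball t r) \<le> ennreal (K1 * r ^ (CARD('n) - 1))"
    by blast
  have "bounded \<Gamma>" using bd unfolding assms(3) frontier_def by (intro bounded_diff bounded_closure)
  then obtain e where e: "\<forall>x\<in>\<Gamma>. \<forall>y\<in>\<Gamma>. dist x y \<le> e" by (auto simp: bounded_two_points)
  \<comment> \<open>One bound for the reference simplices of the pieces and for the surface
    itself.\<close>
  define D0 where "D0 = max D e"
  \<comment> \<open>\<open>L\<close>, \<open>q\<close> and \<open>\<kappa>\<close> are arbitrary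
    reals here; raising them to at least \<open>1\<close> preserves the mesh conditions and meets
    the assumptions of the locale.\<close>
  define L' where "L' = max L 1"
  define q' where "q' = max q 1"
  define \<kappa>' where "\<kappa>' = max \<kappa> 1"
  \<comment> \<open>The factor \<open>2\<close> is the price of an actual curve instead of a
    geodesic infimum; one \<open>G\<close> then serves both the metric comparison and the connecting
    sets.\<close>
  define G where "G = 2 * G1"
  \<comment> \<open>Outside the locale \<open>sep\<close> is a function of the seven listed
    parameters alone, so \<open>C\<close> can be fixed before \<open>h\<close> and the mesh. The
    maximum with \<open>1\<close> gives positivity at once.\<close>
  define C where "C = max 1 (1 + (2 * q') ^ CARD('n) * C0\<^sup>2 *
    (q' * D0 + 4 * (K1 * 2 ^ CARD('n) / surface_mesh.sep L' q' \<kappa>' G L0 H0 D0)))"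
  have mesh: "measured_surface_mesh \<Gamma> L' q' \<kappa>' G L0 H0 D0 h \<T> K1"
    if h: "h > 0" and m: "is_mesh L \<Gamma> \<T>" and qu: "quasi_uniform q h \<T>" and sr: "shape_regular \<kappa> \<Gamma> \<T>"
    for h and \<T> :: "'n simp set"
  proof unfold_locales
    show "CARD('n) = 2 \<or> CARD('n) = 3" by fact
    show "L' \<ge> 1" "q' \<ge> 1" "\<kappa>' \<ge> 1" "G \<ge> 1" "L0 \<ge> 1" "H0 > 0" "D0 > 0" "h > 0" "K1 > 0"
      using L0 H0 D h K1 G1 by (auto simp: L'_def q'_def \<kappa>'_def G_def D0_def)
    show "dist x y \<le> D0" if "x \<in> \<Gamma>" "y \<in> \<Gamma>" for x y
      using e that unfolding D0_def by (meson max.coboundedI2)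
    show "\<exists>P. curvilinear_simplex L0 P \<and> x \<in> pts P \<and> pts P \<subseteq> \<Gamma> \<and>
      (\<forall>v\<in>fst P. \<forall>z\<in>convex hull (fst P - {v}). H0 \<le> dist v z) \<and>
      (\<forall>y\<in>convex hull (fst P). \<forall>z\<in>convex hull (fst P). dist y z \<le> D0)" if "x \<in> \<Gamma>" for x
    proof -
      obtain P where P: "curvilinear_simplex L0 P" "x \<in> pts P" "pts P \<subseteq> \<Gamma>"
        "\<forall>v\<in>fst P. \<forall>z\<in>convex hull (fst P - {v}). H0 \<le> dist v z"
        "\<forall>y\<in>convex hull (fst P). \<forall>z\<in>convex hull (fst P). dist y z \<le> D"
        using pieces \<open>x \<in> \<Gamma>\<close> by blast
      have "\<forall>y\<in>convex hull (fst P). \<forall>z\<in>convex hull (fst P). dist y z \<le> D0"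
        using P(5) unfolding D0_def by (meson max.coboundedI1)
      with P show ?thesis by blast
    qed
    show "geodesic_dist \<Gamma> x y \<le> ennreal (G * dist x y)" if "x \<in> \<Gamma>" "y \<in> \<Gamma>" for x y
    proof -
      have "ennreal (G1 * dist x y) \<le> ennreal (G * dist x y)"
        using G1 by (intro ennreal_leI mult_right_mono) (auto simp: G_def)
      then show ?thesis using geo1[OF that] by (rule order_trans[rotated])
    qed
    show "\<exists>K. connected K \<and> K \<subseteq> \<Gamma> \<and> x \<in> K \<and> y \<in> K \<and> (\<forall>z\<in>K. dist x z \<le> G * dist x y)"
      if "x \<in> \<Gamma>" "y \<in> \<Gamma>" for x y
      unfolding G_def using geo1[OF that] G1 that(1) by (intro geodesic_dist_connected) auto
    show "is_mesh L' \<Gamma> \<T>" using m by (rule is_mesh_mono) (simp add: L'_def)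
    have "\<forall>T\<in>\<T>. curvilinear_simplex L T" using m unfolding is_mesh_def by (elim conjE)
    then show "quasi_uniform q' h \<T>"
      using qu h by (intro quasi_uniform_mono[OF qu]) (auto simp: q'_def)
    show "shape_regular \<kappa>' \<Gamma> \<T>" using sr by (rule shape_regular_mono) (simp add: \<kappa>'_def)
    show "emeasure (surface_measure \<Gamma>) (\<Gamma> \<inter> ball t r) \<le> ennreal (K1 * r ^ (CARD('n) - 1))" if "r > 0" for t r
      by (rule ball_bound[OF that])
  qed
  show ?thesis
  proof (rule exI[of _ "1 / real CARD('n)"], rule conjI, simp, rule exI[of _ C], rule conjI,
      simp add: C_def less_max_iff_disj, intro allI impI ballI)
    fix h :: real and \<T> :: "'n simp set" and \<phi> :: "real^'n \<Rightarrow> real^'n \<Rightarrow> real" and w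
    assume h: "h > 0" "is_mesh L \<Gamma> \<T>" "quasi_uniform q h \<T>" "shape_regular \<kappa> \<Gamma> \<T>"
      and \<phi>: "\<forall>y \<in> nodes \<T>. \<phi> y \<in> L2_space \<Gamma> \<and> (LINT s|surface_measure \<Gamma>. \<phi> y s) = 1 \<and>
       ess_supp \<Gamma> (\<phi> y) \<subseteq> patch \<T> y \<and>
       c0 * h powr (1/2 - real CARD('n) / 2) \<le> L2_norm \<Gamma> (patch \<T> y) (\<phi> y) \<and>
       L2_norm \<Gamma> (patch \<T> y) (\<phi> y) \<le> C0 * h powr (1/2 - real CARD('n) / 2)"
      and w: "w \<in> Hhalf_space \<Gamma>"
      and orth: "\<forall>y \<in> nodes \<T>. (LINT s|surface_measure \<Gamma>. w s * \<phi> y s) = 0"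
    interpret measured_surface_mesh \<Gamma> L' q' \<kappa>' G L0 H0 D0 h \<T> K1
      by (rule mesh[OF h])
    let ?S = "\<Sum>y\<in>nodes \<T>. Hhalf_seminorm_sq \<Gamma> (patch \<T> y) w"
    have "C0 \<ge> 0" using assms(5) by simp
    note eq = norm_equivalence[OF this w bspec[OF \<phi>, THEN conjunct1]
        bspec[OF \<phi>, THEN conjunct2, THEN conjunct1]
        bspec[OF \<phi>, THEN conjunct2, THEN conjunct2, THEN conjunct1]
        bspec[OF \<phi>, THEN conjunct2, THEN conjunct2, THEN conjunct2, THEN conjunct2] bspec[OF orth]]
    have "Hhalf_norm_sq \<Gamma> \<Gamma> w \<le> ennreal (1 + (2 * q') ^ CARD('n) * C0\<^sup>2 * (q' * D0 + 4 * (K1 * 2 ^ CARD('n) / sep))) * ?S"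
      by (rule eq(2))
    also have "\<dots> \<le> ennreal C * ?S"
      unfolding C_def by (intro mult_right_mono ennreal_leI max.cobounded2) simp
    finally show "ennreal (1 / real CARD('n)) * ?S \<le> Hhalf_norm_sq \<Gamma> \<Gamma> w \<and> Hhalf_norm_sq \<Gamma> \<Gamma> w \<le> ennreal C * ?S"
      using eq(1) by blast
  qed
qed

end
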